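(* Assume that $\mu$ is purifying and ergodic. Let $g:\mathrm{P}(\mathbb{C}^d)\to\mathbb{R}$ be Hölder continuous with $\mathbb{E}_{\nu_{inv}}(g)=0$. Let $\tilde g$ be a continuous solution of the Poisson equation $\tilde g-\Pi\tilde g=g$ and $\gamma_g^2=\mathbb{E}_{\nu_{inv}}(\tilde g^2-(\Pi\tilde g)^2)$. Assume $\gamma_g^2>0$. Then for any initial probability measure $\nu$ on $\mathrm{P}(\mathbb{C}^d)$, with $S_n(g)=\sum_{k=0}^{n-1}g(\hat x_k)$, for each choice of sign $\pm$, $$\limsup_{n\to\infty}\frac{\pm S_n(g)}{\sqrt{2n\gamma_g^2\log\log(n)}}=1\qquad\mathbb{P}_\nu\text{-almost surely}.$$
   Context: Setting. Let $d\ge 1$ be an integer, $\mathrm{P}(\mathbb{C}^d)$ the complex projective space of $\mathbb{C}^d$ with Borel $\sigma$-algebra $\mathcal{B}$. For nonzero $x\in\mathbb{C}^d$, $\hat x$ is its class in $\mathrm{P}(\mathbb{C}^d)$; for $\hat x\in \mathrm{P}(\mathbb{C}^d)$, $x$ denotes an arbitrary norm-one representative. The metric on $\mathrm{P}(\mathbb{C}^d)$ is $d(\hat x,\hat y)=\sqrt{1-|\langle x,y\rangle|^2}$. Hölder continuous means $\alpha$-Hölder for this metric for some $\alpha\in(0,1]$. For $v\in M_d(\mathbb{C})$ with $vx\neq 0$, $v\cdot\hat x$ is the class of $vx$. $\mu$ is a measure on the Borel sets of $M_d(\mathbb{C})$ with $\int\|v\|^2\mathrm{d}\mu(v)<\infty$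 and $\int v^*v\,\mathrm{d}\mu(v)=\mathrm{Id}_{\mathbb{C}^d}$. Kernel. $\Pi(\hat x,S)=\int \mathbf{1}_S(v\cdot\hat x)\|vx\|^2\mathrm{d}\mu(v)$ for $S\in\mathcal{B}$ (the integrand is $0$ when $vx=0$), and $\Pi f(\hat x)=\int f(v\cdot\hat x)\|vx\|^2\mathrm{d}\mu(v)$. Process. $\Omega=M_d(\mathbb{C})^{\mathbb{N}}$, elements written $\omega=(v_1,v_2,\dots)$; $\mathcal{O}_n$ is the $\sigma$-algebra generated by the first $n$ coordinates and $\mathcal{O}$ the one generated by all coordinates; $V_i(\omega)=v_i$, $W_n=V_n\cdots V_1$, $W_0=\mathrm{Id}$. For a probability measure $\nu$ on $\mathrm{P}(\mathbb{C}^d)$, $\mathbb{P}_\nu$ is the unique probability measure on $(\mathrm{P}(\mathbb{C}^d)\times\Omega,\mathcal{B}\otimes\mathcal{O})$ with $\mathbb{P}_\nu(S\times O_n)=\int_{S\times O_n}\|W_n(\omega)x\|^2\,\mathrm{d}\nu(\hat x)\,\mathrm{d}\mu^{\otimes n}(\omega)$ for $S\in\mathcal{B}$, $O_n\in\mathcal{O}_n$. On it, $\hat x_n(\hat x,\omega)=W_n(\omega)\cdot\hat x$ when $W_n(\omega)x\ne0$ (which holds $\mathbb{P}_\nu$-a.s.), extended arbitrarily otherwise; $(\hat x_n)$ is a Markov chain with kernel $\Pi$ and initial law $\nu$. $\mathbb{E}_\nu$ is expectation under $\mathbb{P}_\nu$; in particular $\mathbb{E}_{\nu}(g)=\int g\,\mathrm{d}\nu$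 for $g$ a function on $\mathrm{P}(\mathbb{C}^d)$. Assumptions. $\mu$ is purifying (assumption (Pur)) if every nonzero orthogonal projector $\pi$ such that for all $n\in\mathbb{N}$, $\pi v_1^*\cdots v_n^*v_n\cdots v_1\pi\propto\pi$ for $\mu^{\otimes n}$-almost all $(v_1,\dots,v_n)$, has rank one. $\mu$ is ergodic (assumption (Erg)) if there is a unique minimal subspace $E\ne\{0\}$ of $\mathbb{C}^d$ such that $vE\subset E$ for all $v\in\operatorname{supp}\mu$ (minimal among nonzero subspaces with this property). It is known that if $\mu$ is purifying and ergodic then $\Pi$ has a unique invariant probability measure $\nu_{inv}$. Under these assumptions, for Hölder continuous $g$ with $\mathbb{E}_{\nu_{inv}}(g)=0$, the Poisson equation $\tilde g-\Pi\tilde g=g$ has a continuous solution, unique up to an additive constant ($\gamma_g^2$ does not depend on the choice). *)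

theory Defs
  imports "HOL-Probability.Probability"
begin

definition hinner :: "complex ^ 'd \<Rightarrow> complex ^ 'd \<Rightarrow> complex" where
  "hinner x y = (\<Sum>i\<in>UNIV. cnj (x $ i) * y $ i)"

definition adj :: "complex ^ 'd ^ 'd \<Rightarrow> complex ^ 'd ^ 'd" where
  "adj A = (\<chi> i j. cnj (A $ j $ i))"

definition orthogonal_projector :: "complex ^ 'd ^ 'd \<Rightarrow> bool" where
  "orthogonal_projector A \<longleftrightarrow> A ** A = A \<and> adj A = A"

definition proportional_to :: "complex ^ 'd ^ 'd \<Rightarrow> complex ^ 'd ^ 'd \<Rightarrow> bool" where
  "proportional_to A B \<longleftrightarrow> (\<exists>c. A = map_matrix ((*) c) B)"

definition proj_rel :: "complex ^ 'd \<Rightarrow> complex ^ 'd \<Rightarrow> bool" where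
  "proj_rel x y \<longleftrightarrow> x \<noteq> 0 \<and> y \<noteq> 0 \<and> (\<exists>c. y = c *s x)"

lemma part_equivp_proj_rel: "part_equivp (proj_rel :: complex ^ 'd \<Rightarrow> _)"
proof (rule part_equivpI)
  have "proj_rel (axis undefined 1 :: complex ^ 'd) (axis undefined 1)"
    unfolding proj_rel_def by (auto simp: axis_eq_0_iff intro: exI[of _ 1])
  then show "\<exists>x :: complex ^ 'd. proj_rel x x" by blast
  show "symp (proj_rel :: complex ^ 'd \<Rightarrow> _)"
  proof (rule sympI)
    fix x y :: "complex ^ 'd" assume "proj_rel x y"
    then obtain c where c: "x \<noteq> 0" "y \<noteq> 0" "y = c *s x" unfolding proj_rel_def by blast
    then have "c \<noteq> 0" by auto
    then have "x = inverse c *s y" using c by (simp add: vector_smult_assoc)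
    then show "proj_rel y x" using c unfolding proj_rel_def by blast
  qed
  show "transp (proj_rel :: complex ^ 'd \<Rightarrow> _)"
    by (rule transpI) (auto simp: proj_rel_def vector_smult_assoc)
qed

quotient_type 'd cproj = "complex ^ ('d :: finite)" / partial: proj_rel
  by (rule part_equivp_proj_rel)

text \<open>The class of the zero vector is a fixed unspecified point.\<close>

definition proj_class :: "complex ^ 'd \<Rightarrow> 'd cproj" where
  "proj_class x = abs_cproj x"

definition unit_rep :: "'d cproj \<Rightarrow> complex ^ 'd" where
  "unit_rep p = (SOME x. norm x = 1 \<and> proj_class x = p)"

lemma proj_class_eq_iff:
  assumes "x \<noteq> 0" "y \<noteq> 0"
  shows "proj_class x = proj_class y \<longleftrightarrow> (\<exists>c. y = c *s x)"
proof -
  have refl: "proj_rel z z" if "z \<noteq> 0" for z :: "complex ^ 'd"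
    using that unfolding proj_rel_def by (auto intro: exI[of _ 1])
  show ?thesis
    using Quotient3_rel[OF Quotient3_cproj, of x y] assms refl
    unfolding proj_class_def by (auto simp: proj_rel_def)
qed

lemma norm_smult_vec: "norm (c *s (x :: complex ^ 'd)) = cmod c * norm x"
  by (simp add: norm_vec_def norm_mult L2_set_right_distrib)

lemma unit_rep: "norm (unit_rep p) = 1" "proj_class (unit_rep p) = p"
proof -
  define x where "x = rep_cproj p"
  have "proj_rel x x" "proj_class x = p"
    using Quotient3_rep_reflp[OF Quotient3_cproj] Quotient3_abs_rep[OF Quotient3_cproj]
    by (auto simp: x_def proj_class_def)
  then have x: "x \<noteq> 0" "proj_class x = p" by (auto simp: proj_rel_def)
  define y where "y = complex_of_real (inverse (norm x)) *s x"
  have ny: "norm y = 1" using x by (simp add: y_def norm_smult_vec norm_inverse)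
  then have "y \<noteq> 0" by auto
  with x have "proj_class y = p" using proj_class_eq_iff[of x y] by (auto simp: y_def)
  with ny have "\<exists>x. norm x = 1 \<and> proj_class x = p" by blast
  from someI_ex[OF this] show "norm (unit_rep p) = 1" "proj_class (unit_rep p) = p"
    unfolding unit_rep_def by auto
qed

text \<open>
  The triangle inequality comes from the fact that the distance of two classes is, up to the
  factor $\sqrt 2$, the Hilbert--Schmidt distance of the projectors onto the two lines.
\<close>

definition line_projector :: "complex ^ 'd \<Rightarrow> complex ^ 'd ^ 'd" where
  "line_projector x = (\<chi> i j. x $ i * cnj (x $ j))"

lemma norm_matrix_sq: "(norm (A :: complex ^ 'd ^ 'd))\<^sup>2 = (\<Sum>i\<in>UNIV. \<Sum>j\<in>UNIV. (cmod (A $ i $ j))\<^sup>2)"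
  by (simp add: norm_vec_def L2_set_def sum_nonneg real_sqrt_pow2)

lemma hinner_self: "hinner x x = complex_of_real ((norm x)\<^sup>2)"
proof -
  have "hinner x x = (\<Sum>i\<in>UNIV. complex_of_real ((cmod (x $ i))\<^sup>2))"
    unfolding hinner_def by (intro sum.cong refl) (simp only: complex_norm_square mult.commute)
  also have "\<dots> = complex_of_real ((norm x)\<^sup>2)"
    by (simp add: norm_vec_def L2_set_def sum_nonneg real_sqrt_pow2)
  finally show ?thesis .
qed

lemma hinner_cnj: "hinner y x = cnj (hinner x y)"
  by (simp add: hinner_def mult.commute)

lemma norm_line_projector_diff:
  assumes "norm x = 1" "norm y = 1"
  shows "(norm (line_projector x - line_projector y))\<^sup>2 = 2 * (1 - (cmod (hinner x y))\<^sup>2)"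
proof -
  let ?s = "\<lambda>a b. hinner a b * cnj (hinner a b)"
  have prod: "(\<Sum>i\<in>UNIV. \<Sum>j\<in>UNIV. (cnj (a $ i) * b $ i) * cnj (cnj (a $ j) * b $ j)) = ?s a b"
    for a b :: "complex ^ 'd"
    by (simp only: hinner_def cnj_sum sum_product)
  have "complex_of_real ((norm (line_projector x - line_projector y))\<^sup>2)
    = (\<Sum>i\<in>UNIV. \<Sum>j\<in>UNIV. (x $ i * cnj (x $ j) - y $ i * cnj (y $ j))
         * cnj (x $ i * cnj (x $ j) - y $ i * cnj (y $ j)))"
    by (simp only: norm_matrix_sq of_real_sum complex_norm_square line_projector_def
        vector_minus_component vec_lambda_beta)
  also have "\<dots> = (\<Sum>i\<in>UNIV. \<Sum>j\<in>UNIV.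
        (cnj (x $ i) * x $ i) * cnj (cnj (x $ j) * x $ j)
      + (cnj (y $ i) * y $ i) * cnj (cnj (y $ j) * y $ j)
      - (cnj (x $ i) * y $ i) * cnj (cnj (x $ j) * y $ j)
      - (cnj (y $ i) * x $ i) * cnj (cnj (y $ j) * x $ j))"
    by (intro sum.cong refl) (simp add: algebra_simps)
  also have "\<dots> = ?s x x + ?s y y - ?s x y - ?s y x"
    by (simp only: sum.distrib sum_subtractf prod)
  also have "\<dots> = complex_of_real (2 * (1 - (cmod (hinner x y))\<^sup>2))"
    using assms by (simp add: hinner_self hinner_cnj[of y x] complex_norm_square[symmetric]
        mult.commute[of "cnj _"] del: of_real_power)
  finally show ?thesis by (simp only: of_real_eq_iff)
qed

lemma line_projector_eq_imp:
  assumes "norm x = 1" "norm y = 1" "line_projector x = line_projector y"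
  shows "proj_class x = proj_class y"
proof -
  have mv: "line_projector z *v w = hinner z w *s z" for z w :: "complex ^ 'd"
    by (simp add: vec_eq_iff line_projector_def matrix_vector_mult_def hinner_def
        sum_distrib_left sum_distrib_right mult_ac)
  have "y = hinner x y *s x"
    using mv[of x y] mv[of y y] assms by (simp add: hinner_self)
  moreover have "x \<noteq> 0" "y \<noteq> 0" using assms by auto
  ultimately show ?thesis using proj_class_eq_iff by blast
qed

instantiation cproj :: (finite) metric_space
begin

definition dist_cproj :: "'a cproj \<Rightarrow> 'a cproj \<Rightarrow> real" where
  "dist_cproj p q = sqrt (1 - (cmod (hinner (unit_rep p) (unit_rep q)))\<^sup>2)"

definition uniformity_cproj :: "('a cproj \<times> 'a cproj) filter" where
  "uniformity_cproj = (INF e\<in>{0<..}. principal {(x, y). dist x y < e})"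

definition open_cproj :: "'a cproj set \<Rightarrow> bool" where
  "open_cproj U \<longleftrightarrow> (\<forall>x\<in>U. eventually (\<lambda>(x', y). x' = x \<longrightarrow> y \<in> U) uniformity)"

instance
proof
  fix p q r :: "'a cproj"
  have d: "dist a b = norm (line_projector (unit_rep a) - line_projector (unit_rep b)) / sqrt 2"
    for a b :: "'a cproj"
  proof -
    have "1 - (cmod (hinner (unit_rep a) (unit_rep b)))\<^sup>2
        = (norm (line_projector (unit_rep a) - line_projector (unit_rep b)))\<^sup>2 / 2"
      using norm_line_projector_diff[OF unit_rep(1)[of a] unit_rep(1)[of b]] by simp
    then show ?thesis by (simp only: dist_cproj_def real_sqrt_divide real_sqrt_abs abs_norm_cancel)
  qed
  show "(dist p q = 0) = (p = q)"
    using line_projector_eq_imp[OF unit_rep(1)[of p] unit_rep(1)[of q]]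
    by (auto simp: d unit_rep(2))
  show "dist p q \<le> dist p r + dist q r"
    using dist_triangle2[of "line_projector (unit_rep p)" "line_projector (unit_rep q)"
        "line_projector (unit_rep r)"]
    by (simp add: d dist_norm divide_right_mono flip: add_divide_distrib)
qed (simp_all add: uniformity_cproj_def open_cproj_def)

end

definition holder_continuous :: "('a::metric_space \<Rightarrow> real) \<Rightarrow> bool" where
  "holder_continuous g \<longleftrightarrow>
    (\<exists>\<alpha>\<in>{0<..1}. \<exists>C. \<forall>p q. \<bar>g p - g q\<bar> \<le> C * dist p q powr \<alpha>)"

definition proj_act :: "complex ^ 'd ^ 'd \<Rightarrow> 'd cproj \<Rightarrow> 'd cproj" where
  "proj_act v p = proj_class (v *v unit_rep p)"

text \<open>
  Where \<open>v *v unit_rep p = 0\<close> the weight vanishes, so the unspecified value of \<^const>\<open>proj_act\<close>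
  is irrelevant in the following integrals.
\<close>

definition kernel :: "(complex ^ 'd ^ 'd) measure \<Rightarrow> 'd cproj \<Rightarrow> 'd cproj set \<Rightarrow> ennreal" where
  "kernel \<mu> p S = (\<integral>\<^sup>+ v. indicator S (proj_act v p) * ennreal ((norm (v *v unit_rep p))\<^sup>2) \<partial>\<mu>)"

definition kernel_op ::
  "(complex ^ 'd ^ 'd) measure \<Rightarrow> ('d cproj \<Rightarrow> real) \<Rightarrow> 'd cproj \<Rightarrow> real" where
  "kernel_op \<mu> f p = (\<integral>v. f (proj_act v p) * (norm (v *v unit_rep p))\<^sup>2 \<partial>\<mu>)"

definition proj_prob :: "('d::finite cproj) measure \<Rightarrow> bool" where
  "proj_prob \<nu> \<longleftrightarrow> prob_space \<nu> \<and> sets \<nu> = sets borel"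

definition invariant_prob :: "(complex ^ 'd::finite ^ 'd::finite) measure \<Rightarrow> ('d cproj) measure \<Rightarrow> bool" where
  "invariant_prob \<mu> \<nu> \<longleftrightarrow> proj_prob \<nu> \<and>
    (\<forall>S\<in>sets borel. (\<integral>\<^sup>+ p. kernel \<mu> p S \<partial>\<nu>) = emeasure \<nu> S)"

text \<open>Sequences are indexed from $0$: \<open>\<omega> i\<close> is the matrix $v_{i+1}$.\<close>

primrec W :: "(nat \<Rightarrow> complex ^ 'd ^ 'd) \<Rightarrow> nat \<Rightarrow> complex ^ 'd ^ 'd" where
  "W \<omega> 0 = mat 1"
| "W \<omega> (Suc n) = \<omega> n ** W \<omega> n"

definition path_space :: "('d::finite cproj \<times> (nat \<Rightarrow> complex ^ 'd ^ 'd)) measure" where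
  "path_space = borel \<Otimes>\<^sub>M (\<Pi>\<^sub>M i\<in>UNIV. borel)"

text \<open>
  \<open>is_path_measure \<mu> \<nu> P\<close> says that \<open>P\<close> is the measure $\mathbb{P}_\nu$. The \<open>\<sigma>\<close>-algebra generated
  by the first \<open>n\<close> coordinates consists of the preimages of measurable sets of \<open>n\<close>-tuples.

  No \<open>\<sigma>\<close>-finiteness of \<open>\<mu>\<close> is required: integrability of $\|v\|^2$ makes \<open>\<mu>\<close> \<open>\<sigma>\<close>-finite away from
  the zero matrix, and tuples with a zero entry contribute nothing to the integrals below and
  satisfy the proportionality in \<open>purifying\<close> trivially.
\<close>

definition is_path_measure ::
  "(complex ^ 'd::finite ^ 'd::finite) measure \<Rightarrow> ('d cproj) measure \<Rightarrow>
   ('d cproj \<times> (nat \<Rightarrow> complex ^ 'd ^ 'd)) measure \<Rightarrow> bool" where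
  "is_path_measure \<mu> \<nu> P \<longleftrightarrow> prob_space P \<and> sets P = sets path_space \<and>
    (\<forall>n. \<forall>S\<in>sets borel. \<forall>A\<in>sets (\<Pi>\<^sub>M i\<in>{..<n}. borel).
      emeasure P (S \<times> {\<omega>. restrict \<omega> {..<n} \<in> A}) =
      (\<integral>\<^sup>+ p\<in>S. (\<integral>\<^sup>+ \<omega>\<in>A. ennreal ((norm (W \<omega> n *v unit_rep p))\<^sup>2) \<partial>(\<Pi>\<^sub>M i\<in>{..<n}. \<mu>)) \<partial>\<nu>))"

definition chain :: "nat \<Rightarrow> 'd cproj \<times> (nat \<Rightarrow> complex ^ 'd ^ 'd) \<Rightarrow> 'd cproj" where
  "chain n = (\<lambda>(p, \<omega>). proj_act (W \<omega> n) p)"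

definition birkhoff_sum ::
  "('d cproj \<Rightarrow> real) \<Rightarrow> nat \<Rightarrow> 'd cproj \<times> (nat \<Rightarrow> complex ^ 'd ^ 'd) \<Rightarrow> real" where
  "birkhoff_sum g n z = (\<Sum>k<n. g (chain k z))"

definition purifying :: "(complex ^ 'd ^ 'd) measure \<Rightarrow> bool" where
  "purifying \<mu> \<longleftrightarrow>
    (\<forall>\<pi>. \<pi> \<noteq> 0 \<and> orthogonal_projector \<pi> \<and>
      (\<forall>n. AE \<omega> in (\<Pi>\<^sub>M i\<in>{..<n}. \<mu>). proportional_to (\<pi> ** adj (W \<omega> n) ** W \<omega> n ** \<pi>) \<pi>)
      \<longrightarrow> rank \<pi> = 1)"

definition msupport :: "'a::topological_space measure \<Rightarrow> 'a set" where
  "msupport M = {x. \<forall>U. open U \<and> x \<in> U \<longrightarrow> emeasure M U > 0}"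

definition invariant_subspace ::
  "(complex ^ 'd ^ 'd) measure \<Rightarrow> (complex ^ 'd) set \<Rightarrow> bool" where
  "invariant_subspace \<mu> E \<longleftrightarrow>
    vec.subspace E \<and> E \<noteq> {0} \<and> (\<forall>v\<in>msupport \<mu>. (*v) v ` E \<subseteq> E)"

definition ergodic_measure :: "(complex ^ 'd ^ 'd) measure \<Rightarrow> bool" where
  "ergodic_measure \<mu> \<longleftrightarrow>
    (\<exists>!E. invariant_subspace \<mu> E \<and> (\<forall>F. invariant_subspace \<mu> F \<and> F \<subseteq> E \<longrightarrow> F = E))"

end

theory Submission
  imports Defs "HOL-Real_Asymp.Real_Asymp"
begin

text \<open>
  The statement is deduced from exponential moments of \<open>S_n(g)\<close> that are uniform in the starting point.
  Let \<open>h = gt\<^sup>2 - (\<Pi> gt)\<^sup>2\<close> and let \<open>u\<close> satisfy \<open>h + \<Pi> u - u \<approx> \<gamma>\<^sup>2\<close> uniformly. By the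
  Poisson equation and a third-order expansion, \<open>H_t = exp (t gt + t\<^sup>2 u / 2)\<close> satisfies
  \<open>exp (t g) \<Pi> H_t \<approx> exp (t\<^sup>2 \<gamma>\<^sup>2 / 2) H_t\<close> for small \<open>t\<close>, so that
  \<open>exp (t S_n(g)) H_t(x_n)\<close> is nearly a multiplicative martingale. This gives the maximal inequality and
  Borel--Cantelli for the upper bound, and a conditional lower bound for the tails of block increments
  for the lower bound; no other property of the process is used.

  The function \<open>u\<close> exists once the Cesaro averages of \<open>\<Pi>\<^sup>k h\<close> converge uniformly. The purification
  assumption makes a long product \<open>W_m\<close> nearly of rank one, weighted by \<open>\<parallel>W_m\<parallel>\<^sup>2\<close>: the functional
  \<open>\<parallel>w\<^sup>* w\<parallel>\<^sup>2 / \<parallel>w\<parallel>\<^sup>2\<close> increases on average under left multiplication, strictly unless the law of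
  \<open>w\<^sup>* v\<^sup>* v w\<close> is concentrated on multiples of \<open>w\<^sup>* w\<close>. Hence \<open>\<Pi>\<^sup>m h\<close> is uniformly close to a quadratic
  form, and on quadratic forms the Cesaro averages converge to a constant, because the vectors at which
  an invariant quadratic form attains its maximum or its minimum on the sphere span invariant subspaces.
\<close>

section \<open>The law of the iterated logarithm from uniform exponential moments\<close>

text \<open>The initial law is arbitrary and the lower bound is conditional on the past, so every
  estimate has to be uniform over projective space; convergence in mean under the invariant law
  would not do. The conditional variance \<open>\<Pi>(gt^2) - (\<Pi> gt)^2\<close> of the martingale
  increments is neither constant nor obviously continuous. Subtracting \<open>gt^2\<close> from the
  corrector replaces it by \<open>h\<close>, which is continuous because the Poisson equation gives
  \<open>\<Pi> gt = gt - g\<close>; a second corrector, built from finitely many powers of \<Pi>,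
  then levels \<open>h\<close>. The tilt \<open>H_t\<close> is bounded above and below independently
  of \<open>t\<close> and of the number of steps, so it costs a constant factor, negligible against
  exponents of size log log n. Finally, product measures call for sigma-finiteness, which can fail
  only through an atom of infinite mass at the zero matrix; this atom is removed at the very
  end.\<close>

lemma measurable_mono_sets:
  "\<lbrakk>f \<in> measurable N K; space N = space N'; sets N \<subseteq> sets N'\<rbrakk> \<Longrightarrow> f \<in> measurable N' K"
  by (auto simp: measurable_def)

text \<open>Testing against bounded nonnegative \<open>G\<close> stands for conditioning on
  \<open>F n\<close>: the conditional expectation of \<open>exp (t g_n) H_(n+1)\<close> lies between
  \<open>exp (t^2 a / 2) H_n\<close> and \<open>exp (t^2 b / 2) H_n\<close>. The two-sided bound by
  \<open>C\<close> lets \<open>H\<close> be inserted and removed at a cost that does not grow with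
  the number of steps.\<close>

definition tilting ::
  "'a measure \<Rightarrow> (nat \<Rightarrow> 'a measure) \<Rightarrow> (nat \<Rightarrow> 'a \<Rightarrow> real) \<Rightarrow> real \<Rightarrow> real \<Rightarrow> real \<Rightarrow> real \<Rightarrow> (nat \<Rightarrow> 'a \<Rightarrow> real) \<Rightarrow> bool"
  where "tilting M F g t a b C H \<longleftrightarrow>
    (\<forall>n. H n \<in> borel_measurable (F n)) \<and> (\<forall>n x. 1 / C \<le> H n x \<and> H n x \<le> C) \<and>
    (\<forall>n G. G \<in> borel_measurable (F n) \<longrightarrow> (\<forall>x. 0 \<le> G x) \<longrightarrow> (\<exists>c. \<forall>x. G x \<le> c) \<longrightarrow>
       exp (t\<^sup>2 * a / 2) * (\<integral>x. G x * H n x \<partial>M) \<le> (\<integral>x. G x * (exp (t * g n x) * H (Suc n) x) \<partial>M) \<and>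
       (\<integral>x. G x * (exp (t * g n x) * H (Suc n) x) \<partial>M) \<le> exp (t\<^sup>2 * b / 2) * (\<integral>x. G x * H n x \<partial>M))"

text \<open>The order of quantifiers in \<open>mgf_bounds\<close> matters: \<open>t0\<close> and
  \<open>C\<close> depend on \<open>\<epsilon>\<close> alone, while \<open>H\<close> may change with
  \<open>t\<close>. The iterated logarithm uses \<open>t\<close> of order sqrt (log log n / n), and
  the constant has to stay fixed as \<open>t\<close> tends to 0.\<close>

locale log_mgf_process = prob_space M for M :: "'a measure" +
  fixes F :: "nat \<Rightarrow> 'a measure" and g :: "nat \<Rightarrow> 'a \<Rightarrow> real" and s :: real
  assumes space_F: "space (F n) = space M"
    and sets_F: "sets (F n) \<subseteq> sets M"
    and sets_F_Suc: "sets (F n) \<subseteq> sets (F (Suc n))"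
    and g_meas: "g n \<in> borel_measurable (F n)"
    and g_bdd: "\<exists>K. \<forall>n x. \<bar>g n x\<bar> \<le> K"
    and s_pos: "s > 0"
    and mgf_bounds: "\<epsilon> > 0 \<Longrightarrow> \<exists>t0>0. \<exists>C\<ge>1. \<forall>t. \<bar>t\<bar> \<le> t0 \<longrightarrow>
      (\<exists>H. tilting M F g t (s - \<epsilon>) (s + \<epsilon>) C H)"
begin

section \<open>Partial sums and their conditional exponential moments\<close>

definition S :: "nat \<Rightarrow> 'a \<Rightarrow> real" where "S n x = (\<Sum>k<n. g k x)"

lemma S_0 [simp]: "S 0 x = 0" and S_Suc: "S (Suc n) x = S n x + g n x"
  by (simp_all add: S_def)

lemma sets_F_mono: "m \<le> n \<Longrightarrow> sets (F m) \<subseteq> sets (F n)"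
  by (rule lift_Suc_mono_le[of "\<lambda>n. sets (F n)"]) (use sets_F_Suc in auto)

lemma meas_F_mono: "f \<in> borel_measurable (F m) \<Longrightarrow> m \<le> n \<Longrightarrow> f \<in> borel_measurable (F n)"
  by (rule measurable_mono_sets[of f "F m"]) (auto simp: space_F dest: sets_F_mono)

lemma meas_F_M: "f \<in> borel_measurable (F m) \<Longrightarrow> f \<in> borel_measurable M"
  by (rule measurable_mono_sets[of f "F m"]) (use sets_F in \<open>auto simp: space_F\<close>)

lemma sets_F_M: "A \<in> sets (F m) \<Longrightarrow> A \<in> sets M"
  using sets_F by auto

lemma S_meas_F: "n \<le> m \<Longrightarrow> S n \<in> borel_measurable (F m)"
  unfolding S_def[abs_def] by (intro borel_measurable_sum meas_F_mono[OF g_meas]) auto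

lemma S_meas [measurable]: "S n \<in> borel_measurable M"
  using S_meas_F[of n n] meas_F_M by blast

lemma g_meas_M [measurable]: "g n \<in> borel_measurable M"
  using g_meas meas_F_M by blast

lemma g_bound: obtains K where "K \<ge> 0" "\<And>n x. \<bar>g n x\<bar> \<le> K"
proof -
  obtain K where K: "\<And>n x. \<bar>g n x\<bar> \<le> K" using g_bdd by blast
  have "0 \<le> K" using K[of 0 undefined] by linarith
  with K that show ?thesis by blast
qed

lemma S_diff_bdd: "\<exists>c. \<forall>x. \<bar>S (n + m) x - S n x\<bar> \<le> c"
proof -
  obtain K where K: "K \<ge> 0" "\<And>n x. \<bar>g n x\<bar> \<le> K" using g_bound by blast
  have "\<bar>S (n + m) x - S n x\<bar> \<le> K * m" for x
  proof (induction m)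
    case (Suc m)
    then show ?case using K(2)[of "n + m" x] by (simp add: S_Suc algebra_simps)
  qed simp
  then show ?thesis by blast
qed

lemma exp_S_diff_bdd: "\<exists>c. \<forall>x. exp (t * (S (n + m) x - S n x)) \<le> c"
proof -
  obtain c where c: "\<And>x. \<bar>S (n + m) x - S n x\<bar> \<le> c" using S_diff_bdd by blast
  have "t * (S (n + m) x - S n x) \<le> \<bar>t\<bar> * c" for x
  proof -
    have "t * (S (n + m) x - S n x) \<le> \<bar>t * (S (n + m) x - S n x)\<bar>" by (rule abs_ge_self)
    also have "\<dots> \<le> \<bar>t\<bar> * c" using c[of x] by (simp add: abs_mult mult_left_mono)
    finally show ?thesis .
  qed
  then show ?thesis by (intro exI[of _ "exp (\<bar>t\<bar> * c)"]) auto
qed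

lemma integrable_bdd:
  assumes "f \<in> borel_measurable M" "\<And>x. 0 \<le> f x" "\<exists>c. \<forall>x. f x \<le> (c::real)"
  shows "integrable M f"
proof -
  obtain c where "\<And>x. f x \<le> c" using assms(3) by blast
  then show ?thesis using assms by (intro integrable_const_bound[of _ c]) auto
qed

lemma mult_bdd:
  assumes "\<And>x. (0::real) \<le> f x" "\<exists>c. \<forall>x. f x \<le> c" "\<And>x. 0 \<le> h x" "\<exists>c. \<forall>x. h x \<le> c"
  shows "\<exists>c. \<forall>x. f x * h x \<le> (c::real)"
proof -
  obtain c d where "\<And>x. f x \<le> c" "\<And>x. h x \<le> d" using assms by blast
  then have "f x * h x \<le> c * d" for x
    using assms(1,3)[of x] by (intro mult_mono) (auto intro: order_trans)
  then show ?thesis by blast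
qed

lemma integrable_indicator_exp:
  assumes "B \<in> sets M"
  shows "integrable M (\<lambda>x. indicator B x * exp (t * (S (n + m) x - S n x)))"
proof (rule integrable_bdd)
  have [measurable]: "B \<in> sets M" by fact
  show "(\<lambda>x. indicator B x * exp (t * (S (n + m) x - S n x))) \<in> borel_measurable M" by measurable
  show "\<exists>c. \<forall>x. indicator B x * exp (t * (S (n + m) x - S n x)) \<le> c"
    by (intro mult_bdd exp_S_diff_bdd) (auto intro!: exI[of _ 1] simp: indicator_def)
qed auto

text \<open>Iterating the tilting inequality over \<open>m\<close> steps produces the exponential
  factors; one factor \<open>C\<close> is paid for inserting \<open>H\<close> at time
  \<open>n\<close> and one for removing it at time \<open>n + m\<close>. The maximal bound is the
  same computation stopped at the first passage over \<open>a\<close>.\<close>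

lemma conditional_mgf:
  assumes "\<epsilon> > 0"
  obtains t0 C :: real where "t0 > 0" "C \<ge> 1"
    "\<And>(t::real) n m B. \<bar>t\<bar> \<le> t0 \<Longrightarrow> B \<in> sets (F n) \<Longrightarrow>
      prob B * exp (m * t\<^sup>2 * (s - \<epsilon>) / 2) / C\<^sup>2
        \<le> expectation (\<lambda>x. indicator B x * exp (t * (S (n + m) x - S n x)))"
    "\<And>(t::real) n m B. \<bar>t\<bar> \<le> t0 \<Longrightarrow> B \<in> sets (F n) \<Longrightarrow>
      expectation (\<lambda>x. indicator B x * exp (t * (S (n + m) x - S n x)))
        \<le> prob B * C\<^sup>2 * exp (m * t\<^sup>2 * (s + \<epsilon>) / 2)"
    "\<And>(t::real) (a::real) (N::nat). 0 < t \<Longrightarrow> t \<le> t0 \<Longrightarrow> 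
       prob {x \<in> space M. \<exists>n\<le>N. S n x \<ge> a} \<le> C\<^sup>2 * exp (N * t\<^sup>2 * (s + \<epsilon>) / 2 - t * a)"
proof -
  obtain t0 C where l0: "t0 > 0" and C: "C \<ge> 1"
    and ex: "\<And>t. \<bar>t\<bar> \<le> t0 \<Longrightarrow> \<exists>H. tilting M F g t (s - \<epsilon>) (s + \<epsilon>) C H"
    using mgf_bounds[OF assms] by blast
  have C0: "C > 0" using C by simp
  have block: "prob B * exp (m * t\<^sup>2 * (s - \<epsilon>) / 2) / C\<^sup>2
        \<le> expectation (\<lambda>x. indicator B x * exp (t * (S (n + m) x - S n x))) \<and>
      expectation (\<lambda>x. indicator B x * exp (t * (S (n + m) x - S n x)))
        \<le> prob B * C\<^sup>2 * exp (m * t\<^sup>2 * (s + \<epsilon>) / 2)"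
    if l: "\<bar>t\<bar> \<le> t0" and B: "B \<in> sets (F n)" for t n m B
  proof -
    obtain H where "tilting M F g t (s - \<epsilon>) (s + \<epsilon>) C H" using ex[OF l] by blast
    note H' = this[unfolded tilting_def]
    have Hm: "\<And>n. H n \<in> borel_measurable (F n)" and H: "\<And>n x. 1 / C \<le> H n x" "\<And>n x. H n x \<le> C"
      using H' by auto
    have step: "exp (t\<^sup>2 * (s - \<epsilon>) / 2) * expectation (\<lambda>x. G x * H n x)
           \<le> expectation (\<lambda>x. G x * (exp (t * g n x) * H (Suc n) x)) \<and>
         expectation (\<lambda>x. G x * (exp (t * g n x) * H (Suc n) x))
           \<le> exp (t\<^sup>2 * (s + \<epsilon>) / 2) * expectation (\<lambda>x. G x * H n x)"
      if "G \<in> borel_measurable (F n)" "\<And>x. 0 \<le> G x" "\<exists>c. \<forall>x. G x \<le> c" for n G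
      using H' that by blast
    have H0: "0 \<le> H n x" for n x using order_trans[OF _ H(1)[of n x]] C0 by simp
    have [measurable]: "B \<in> sets M" using B sets_F_M by auto
    have [measurable]: "H n \<in> borel_measurable M" for n using Hm meas_F_M by auto
    define E where "E m x = indicator B x * exp (t * (S (n + m) x - S n x))" for m x
    have Em: "E m \<in> borel_measurable (F (n + m))" for m
    proof -
      have [measurable]: "B \<in> sets (F (n + m))" using B sets_F_mono[of n "n + m"] by auto
      have [measurable]: "S (n + m) \<in> borel_measurable (F (n + m))" "S n \<in> borel_measurable (F (n + m))"
        by (auto intro: S_meas_F)
      show ?thesis unfolding E_def[abs_def] by measurable
    qed
    have E0: "0 \<le> E m x" for m x by (auto simp: E_def)
    have Eb: "\<exists>c. \<forall>x. E m x \<le> c" for m unfolding E_def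
      by (intro mult_bdd exp_S_diff_bdd) (auto intro!: exI[of _ 1] simp: indicator_def)
    have EH: "E (Suc m) x * H (n + Suc m) x = E m x * (exp (t * g (n + m) x) * H (Suc (n + m)) x)" for m x
      by (simp add: E_def S_Suc exp_add[symmetric] algebra_simps)
    \<comment> \<open>With \<open>H\<close> inserted, one more step of time multiplies
      \<open>I\<close> by a factor between the two exponentials. Without \<open>H\<close>, each step
      would lose a constant.\<close>
    define I where "I m = expectation (\<lambda>x. E m x * H (n + m) x)" for m
    have iE: "integrable M (E m)" for m
      by (rule integrable_bdd) (use Em[THEN meas_F_M] E0 Eb in auto)
    have iEH: "integrable M (\<lambda>x. E m x * H (n + m) x)" for m
    proof (rule integrable_bdd)
      show "(\<lambda>x. E m x * H (n + m) x) \<in> borel_measurable M"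
        using Em[THEN meas_F_M] by measurable
      show "\<exists>c. \<forall>x. E m x * H (n + m) x \<le> c"
        by (intro mult_bdd E0 Eb H0) (use H(2) in blast)
    qed (use E0 H0 in auto)
    have I: "exp (t\<^sup>2 * (s - \<epsilon>) / 2) * I m \<le> I (Suc m) \<and> I (Suc m) \<le> exp (t\<^sup>2 * (s + \<epsilon>) / 2) * I m" for m
      unfolding I_def EH using step[OF Em E0 Eb, of m] by simp
    have Im: "exp (m * t\<^sup>2 * (s - \<epsilon>) / 2) * I 0 \<le> I m \<and> I m \<le> exp (m * t\<^sup>2 * (s + \<epsilon>) / 2) * I 0" for m :: nat
    proof (induction m)
      case (Suc m)
      have "exp (Suc m * t\<^sup>2 * (s - \<epsilon>) / 2) * I 0 = exp (t\<^sup>2 * (s - \<epsilon>) / 2) * (exp (m * t\<^sup>2 * (s - \<epsilon>) / 2) * I 0)"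
        by (simp add: exp_add[symmetric] field_simps)
      also have "\<dots> \<le> exp (t\<^sup>2 * (s - \<epsilon>) / 2) * I m" using Suc by (intro mult_left_mono) auto
      also have "\<dots> \<le> I (Suc m)" using I by auto
      finally have 1: "exp (Suc m * t\<^sup>2 * (s - \<epsilon>) / 2) * I 0 \<le> I (Suc m)" .
      have "I (Suc m) \<le> exp (t\<^sup>2 * (s + \<epsilon>) / 2) * I m" using I by auto
      also have "\<dots> \<le> exp (t\<^sup>2 * (s + \<epsilon>) / 2) * (exp (m * t\<^sup>2 * (s + \<epsilon>) / 2) * I 0)" 
        using Suc by (intro mult_left_mono) auto
      also have "\<dots> = exp (Suc m * t\<^sup>2 * (s + \<epsilon>) / 2) * I 0"
        by (simp add: exp_add[symmetric] field_simps)
      finally show ?case using 1 by blast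
    qed simp
    have pB: "expectation (\<lambda>x. E 0 x) = prob B"
      by (simp add: E_def)
    have lo: "expectation (E m) / C \<le> I m" for m
    proof -
      have "expectation (\<lambda>x. E m x * (1 / C)) \<le> I m" unfolding I_def
        by (intro integral_mono iEH) (use iE H E0 in \<open>auto intro!: mult_left_mono simp del: times_divide_eq_right\<close>)
      then show ?thesis by simp
    qed
    have hi: "I m \<le> expectation (E m) * C" for m
    proof -
      have "I m \<le> expectation (\<lambda>x. E m x * C)" unfolding I_def
        by (intro integral_mono iEH) (use iE H E0 in \<open>auto intro!: mult_left_mono\<close>)
      then show ?thesis by simp
    qed
    have "prob B * exp (m * t\<^sup>2 * (s - \<epsilon>) / 2) / C\<^sup>2 = exp (m * t\<^sup>2 * (s - \<epsilon>) / 2) * (prob B / C) / C"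
      by (simp add: power2_eq_square)
    also have "\<dots> \<le> exp (m * t\<^sup>2 * (s - \<epsilon>) / 2) * I 0 / C"
      using lo[of 0] pB C0 by (intro divide_right_mono mult_left_mono) auto
    also have "\<dots> \<le> I m / C" using Im[of m] C0 by (intro divide_right_mono) auto
    also have "\<dots> \<le> expectation (E m)" using hi[of m] C0 by (simp add: field_simps)
    finally have 1: "prob B * exp (m * t\<^sup>2 * (s - \<epsilon>) / 2) / C\<^sup>2 \<le> expectation (E m)" .
    have "expectation (E m) \<le> C * I m" using lo[of m] C0 by (simp add: field_simps)
    also have "\<dots> \<le> C * (exp (m * t\<^sup>2 * (s + \<epsilon>) / 2) * I 0)" using Im[of m] C0 by (intro mult_left_mono) auto
    also have "\<dots> \<le> C * (exp (m * t\<^sup>2 * (s + \<epsilon>) / 2) * (prob B * C))"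
      using hi[of 0] pB C0 by (intro mult_left_mono) auto
    also have "\<dots> = prob B * C\<^sup>2 * exp (m * t\<^sup>2 * (s + \<epsilon>) / 2)" by (simp add: power2_eq_square)
    finally show ?thesis using 1 by (simp add: E_def[abs_def])
  qed
  have maximal: "prob {x \<in> space M. \<exists>n\<le>N. S n x \<ge> a} \<le> C\<^sup>2 * exp (N * t\<^sup>2 * (s + \<epsilon>) / 2 - t * a)"
    if l: "0 < t" "t \<le> t0" for t a :: real and N :: nat
  proof -
    obtain H where "tilting M F g t (s - \<epsilon>) (s + \<epsilon>) C H" using ex[of t] l by auto
    note H' = this[unfolded tilting_def]
    have Hm: "\<And>n. H n \<in> borel_measurable (F n)" and H: "\<And>n x. 1 / C \<le> H n x" "\<And>n x. H n x \<le> C"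
      using H' by auto
    have step: "exp (t\<^sup>2 * (s - \<epsilon>) / 2) * expectation (\<lambda>x. G x * H n x)
           \<le> expectation (\<lambda>x. G x * (exp (t * g n x) * H (Suc n) x)) \<and>
         expectation (\<lambda>x. G x * (exp (t * g n x) * H (Suc n) x))
           \<le> exp (t\<^sup>2 * (s + \<epsilon>) / 2) * expectation (\<lambda>x. G x * H n x)"
      if "G \<in> borel_measurable (F n)" "\<And>x. 0 \<le> G x" "\<exists>c. \<forall>x. G x \<le> c" for n G
      using H' that by blast
    have H0: "0 \<le> H n x" for n x using order_trans[OF _ H(1)[of n x]] C0 by simp
    have [measurable]: "H n \<in> borel_measurable M" for n using Hm meas_F_M by auto
    have Hb: "\<exists>c. \<forall>x. H n x \<le> c" for n using H(2) by blast
    have indb: "\<exists>c. \<forall>x. indicator B x \<le> (c::real)" for B :: "'a set"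
      by (intro exI[of _ 1]) (simp add: indicator_def)
    \<comment> \<open>The growth rate of the upper tilting bound; discounting by
      \<open>exp (- n r)\<close> turns the tilted exponential into a supermartingale.\<close>
    define r where "r = t\<^sup>2 * (s + \<epsilon>) / 2"
    have r0: "r \<ge> 0" using s_pos assms by (simp add: r_def)
    define A where "A n = {x \<in> space M. \<forall>k\<le>n. S k x < a}" for n
    have Am: "A n \<in> sets (F m)" if "n \<le> m" for n m
    proof -
      have [measurable]: "S k \<in> borel_measurable (F m)" if "k \<in> {..n}" for k
        using S_meas_F that \<open>n \<le> m\<close> by auto
      have "A n = {x \<in> space (F m). \<forall>k\<in>{..n}. S k x < a}" by (auto simp: A_def space_F)
      also have "\<dots> \<in> sets (F m)"
        by (rule sets.sets_Collect_finite_All') (auto intro!: measurable_sets_Collect borel_measurable_less S_meas_F simp: that \<open>n \<le> m\<close> intro: order_trans)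
      finally show ?thesis .
    qed
    define Z where "Z n x = exp (t * S n x - n * r) * H n x" for n x
    have expS: "\<exists>c. \<forall>x. exp (t * S n x - n * r) \<le> c" for n
    proof -
      obtain c where "\<And>x. exp (t * S n x) \<le> c" using exp_S_diff_bdd[of t 0 n] by auto
      then have "exp (t * S n x - n * r) \<le> c" for x
        using r0 order_trans[of "exp (t * S n x - n * r)" "exp (t * S n x)" c] by simp
      then show ?thesis by blast
    qed
    have indI: "integrable M (indicator B :: 'a \<Rightarrow> real)" if "B \<in> sets M" for B
      using that by (simp add: integrable_indicator_iff emeasure_eq_measure)
    have iZ: "integrable M (\<lambda>x. indicator B x * Z n x)" if [measurable]: "B \<in> sets M" for B n
    proof (rule integrable_bdd)
      show "(\<lambda>x. indicator B x * Z n x) \<in> borel_measurable M" unfolding Z_def by measurable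
      show "\<exists>c. \<forall>x. indicator B x * Z n x \<le> c" unfolding Z_def
        by (intro mult_bdd expS Hb indb) (use H0 in auto)
    qed (use H0 in \<open>auto simp: Z_def\<close>)
    have super: "expectation (\<lambda>x. indicator (A n) x * Z (Suc n) x) \<le> expectation (\<lambda>x. indicator (A n) x * Z n x)" for n
    proof -
      let ?G = "\<lambda>x. indicator (A n) x * exp (t * S n x - Suc n * r)"
      have e: "exp (t * S n x - n * r) = exp r * exp (t * S n x - Suc n * r)" for x
        by (simp add: exp_add[symmetric] algebra_simps)
      have "?G \<in> borel_measurable (F n)"
      proof -
        have [measurable]: "A n \<in> sets (F n)" "S n \<in> borel_measurable (F n)" using Am S_meas_F by auto
        show ?thesis by measurable
      qed
      moreover have "\<exists>c. \<forall>x. ?G x \<le> c"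
      proof -
        obtain c where "\<And>x. exp (t * S n x - n * r) \<le> c" using expS[of n] by auto
        moreover have "?G x \<le> exp (t * S n x - n * r)" for x using r0
          by (simp add: indicator_def algebra_simps)
        ultimately have "?G x \<le> c" for x by (rule order_trans[rotated])
        then show ?thesis by blast
      qed
      ultimately have "expectation (\<lambda>x. ?G x * (exp (t * g n x) * H (Suc n) x)) \<le> exp r * expectation (\<lambda>x. ?G x * H n x)"
        using step[of ?G n] unfolding r_def[symmetric] by simp
      also have "\<dots> = expectation (\<lambda>x. indicator (A n) x * Z n x)"
        unfolding integral_mult_right_zero[symmetric] Z_def e
        by (intro Bochner_Integration.integral_cong) (auto simp: mult_ac)
      also have "(\<lambda>x. ?G x * (exp (t * g n x) * H (Suc n) x)) = (\<lambda>x. indicator (A n) x * Z (Suc n) x)"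
        by (auto simp: Z_def S_Suc exp_add[symmetric] algebra_simps)
      finally show ?thesis .
    qed
    \<comment> \<open>A lower bound for \<open>Z\<close> at any time up to \<open>N\<close> at which
      \<open>S\<close> has reached \<open>a\<close>; since \<open>r \<ge> 0\<close>, the discount is
      strongest at time \<open>N\<close>.\<close>
    define b where "b = exp (t * a - N * r) / C"
    have b0: "b > 0" using C0 by (simp add: b_def)
    have Zb: "b \<le> Z n x" if "S n x \<ge> a" "n \<le> N" for n x
    proof -
      have "real n * r \<le> real N * r" using that r0 by (intro mult_right_mono) auto
      then have "exp (t * a - N * r) \<le> exp (t * S n x - n * r)" using that l(1)
        by (auto intro!: diff_mono)
      then show ?thesis using H(1)[of n x] C0 unfolding b_def Z_def
        by (metis exp_ge_zero mult_mono H0 divide_inverse inverse_eq_divide divide_nonneg_nonneg less_eq_real_def zero_le_one)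
    qed
    \<comment> \<open>Optional stopping by induction: paths that have left \<open>A n\<close> are
      frozen at the value \<open>b\<close>, the others carry \<open>Z n\<close>, and the total never
      exceeds its initial bound \<open>C\<close>.\<close>
    have ville: "b * prob (space M - A n) + expectation (\<lambda>x. indicator (A n) x * Z n x) \<le> C" if "n \<le> N" for n
      using that
    proof (induction n)
      case 0
      have [measurable]: "A 0 \<in> sets M" using Am[of 0 0] sets_F_M by auto
      have "b * prob (space M - A 0) + expectation (\<lambda>x. indicator (A 0) x * Z 0 x) =
         expectation (\<lambda>x. b * indicator (space M - A 0) x + indicator (A 0) x * Z 0 x)"
        by (subst Bochner_Integration.integral_add) (auto intro!: iZ integrable_mult_right indI)
      also have "\<dots> \<le> expectation (\<lambda>x. indicator (space M) x * Z 0 x)"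
        by (intro integral_mono Bochner_Integration.integrable_add iZ integrable_mult_right indI)
           (use Zb[of 0] in \<open>auto simp: indicator_def A_def\<close>)
      also have "\<dots> \<le> expectation (\<lambda>x. C)"
        using iZ[of "space M" 0] H(2)[of 0] C0 by (intro integral_mono) (auto simp: Z_def indicator_def)
      finally show ?case by (simp add: prob_space)
    next
      case (Suc n)
      have [measurable]: "A n \<in> sets M" "A (Suc n) \<in> sets M" using Am[of n n] Am[of "Suc n" "Suc n"] sets_F_M by auto
      have sub: "A (Suc n) \<subseteq> A n" by (auto simp: A_def)
      have "prob (space M - A (Suc n)) = prob (space M - A n) + prob (A n - A (Suc n))"
        using sub sets.sets_into_space[of "A n" M]
        by (subst finite_measure_Union[symmetric]) (auto intro!: arg_cong[of _ _ prob])
      moreover have "b * prob (A n - A (Suc n)) + expectation (\<lambda>x. indicator (A (Suc n)) x * Z (Suc n) x)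
          \<le> expectation (\<lambda>x. indicator (A n) x * Z (Suc n) x)"
      proof -
        have "b * prob (A n - A (Suc n)) + expectation (\<lambda>x. indicator (A (Suc n)) x * Z (Suc n) x) =
          expectation (\<lambda>x. b * indicator (A n - A (Suc n)) x + indicator (A (Suc n)) x * Z (Suc n) x)"
          by (subst Bochner_Integration.integral_add) (auto intro!: iZ integrable_mult_right indI)
        also have "\<dots> \<le> expectation (\<lambda>x. indicator (A n) x * Z (Suc n) x)"
        proof (intro integral_mono Bochner_Integration.integrable_add iZ integrable_mult_right indI)
          fix x assume "x \<in> space M"
          have "S (Suc n) x \<ge> a" if "x \<in> A n - A (Suc n)"
            using that by (auto simp: A_def le_Suc_eq not_less)
          then show "b * indicator (A n - A (Suc n)) x + indicator (A (Suc n)) x * Z (Suc n) x \<le> indicator (A n) x * Z (Suc n) x"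
            using Zb[of "Suc n" x] Suc.prems sub by (auto simp: indicator_def)
        qed auto
        finally show ?thesis .
      qed
      moreover have "b * prob (space M - A n) + expectation (\<lambda>x. indicator (A n) x * Z n x) \<le> C"
        using Suc by simp
      ultimately show ?case using super[of n] by (simp add: algebra_simps)
    qed
    have "expectation (\<lambda>x. indicator (A N) x * Z N x) \<ge> 0"
      using H0 by (intro integral_nonneg_AE) (auto simp: Z_def)
    then have "b * prob (space M - A N) \<le> C" using ville[of N] by simp
    then have "prob (space M - A N) \<le> C / b" using b0 by (simp add: field_simps)
    also have "C / b = C\<^sup>2 * exp (N * r - t * a)"
      by (simp add: b_def power2_eq_square exp_diff field_simps)
    also have "space M - A N = {x \<in> space M. \<exists>n\<le>N. S n x \<ge> a}"
      by (auto simp: A_def not_less)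
    finally show ?thesis by (simp add: r_def mult.assoc)
  qed
  show ?thesis
    by (rule that[OF l0 C conjunct1[OF block] conjunct2[OF block] maximal])
qed

end

section \<open>Almost sure bounds on the scale of the iterated logarithm\<close>

definition lil_scale :: "real \<Rightarrow> nat \<Rightarrow> real" where
  "lil_scale s n = sqrt (2 * real n * s * ln (ln (real n)))"

lemma ln_ln_nonneg: "n \<ge> 3 \<Longrightarrow> ln (ln (real n)) \<ge> 0"
proof -
  assume "n \<ge> 3"
  then have "exp 1 \<le> real n" using exp_le by linarith
  then have "1 \<le> ln (real n)" using \<open>n \<ge> 3\<close> by (subst ln_ge_iff) auto
  then show ?thesis by simp
qed

lemma ln_ln_mono: "3 \<le> m \<Longrightarrow> m \<le> n \<Longrightarrow> ln (ln (real m)) \<le> ln (ln (real n))"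
  by (intro ln_mono) auto

lemma lil_scale_mono: "s > 0 \<Longrightarrow> 3 \<le> m \<Longrightarrow> m \<le> n \<Longrightarrow> lil_scale s m \<le> lil_scale s n"
  unfolding lil_scale_def
  by (intro real_sqrt_le_mono mult_mono ln_ln_mono ln_ln_nonneg) auto

context log_mgf_process begin

text \<open>Borel-Cantelli along the geometric times \<open>N k\<close>: the maximal inequality
  covers all times up to \<open>N (Suc k)\<close>, with the level taken at the start of the block.
  The resulting probabilities are of order \<open>k powr -(1 + \<delta>)\<close>.\<close>

lemma eventually_S_le:
  assumes \<delta>: "\<delta> > 0"
  shows "AE x in M. \<forall>\<^sub>F n in sequentially. S n x \<le> (1 + \<delta>) * lil_scale s n"
proof -
  \<comment> \<open>The margin \<open>1 + \<delta>\<close> is split into two factors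
    \<open>r\<close>: one is spent on the variance \<open>s + \<epsilon> = s * r\<close>, the other
    on the ratio of consecutive block ends. Taking \<open>\<theta> = sqrt r\<close> leaves room for
    rounding \<open>\<theta> ^ k\<close> up to an integer.\<close>
  define r where "r = sqrt (1 + \<delta>)"
  define \<theta> where "\<theta> = sqrt r"
  have r1: "r > 1" using \<delta> by (simp add: r_def)
  have th1: "\<theta> > 1" using r1 by (simp add: \<theta>_def)
  have rr: "r * r = 1 + \<delta>" using \<delta> by (simp add: r_def)
  have tt: "\<theta> * \<theta> = r" using r1 by (simp add: \<theta>_def)
  define \<epsilon> where "\<epsilon> = s * (r - 1)"
  have eps: "\<epsilon> > 0" "s + \<epsilon> = s * r" using s_pos r1 by (auto simp: \<epsilon>_def algebra_simps)
  obtain t0 C :: real where t0: "t0 > 0" and C: "C \<ge> 1"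
    and maxi: "\<And>(t::real) (a::real) (N::nat). 0 < t \<Longrightarrow> t \<le> t0 \<Longrightarrow>
      prob {x \<in> space M. \<exists>n\<le>N. S n x \<ge> a} \<le> C\<^sup>2 * exp (N * t\<^sup>2 * (s + \<epsilon>) / 2 - t * a)"
    by (rule conditional_mgf[OF eps(1)]) (rule that; assumption)
  define N where "N k = nat \<lceil>\<theta> ^ k\<rceil>" for k
  have N: "real (N k) \<ge> \<theta> ^ k" "real (N k) \<le> \<theta> ^ k + 1" "N k \<ge> 1" for k
  proof -
    have "\<theta> ^ k \<ge> 1" using th1 by simp
    then show "real (N k) \<ge> \<theta> ^ k" "real (N k) \<le> \<theta> ^ k + 1" "N k \<ge> 1"
      unfolding N_def by (auto simp: of_nat_nat) linarith+
  qed
  have ev_pow: "\<forall>\<^sub>F k in sequentially. \<theta> ^ k \<ge> c" for c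
    using th1 by real_asymp
  have N_top: "filterlim N at_top sequentially"
  proof (rule filterlim_at_top[THEN iffD2], rule allI)
    fix Z show "\<forall>\<^sub>F k in sequentially. Z \<le> N k"
      using ev_pow[of "real Z"] 
    proof eventually_elim
      case (elim k)
      then have "real Z \<le> real (N k)" using N(1)[of k] by linarith
      then show ?case by simp
    qed
  qed
  define E where "E k = {x \<in> space M. \<exists>n\<le>N (Suc k). S n x \<ge> (1 + \<delta>) * lil_scale s (N k)}" for k
  have E_meas: "E k \<in> sets M" for k
    unfolding E_def by measurable
  \<comment> \<open>The optimal \<open>t\<close> below must lie in the range of the moment bounds;
    it tends to 0 like sqrt (log log n / n).\<close>
  have small: "\<forall>\<^sub>F n in sequentially. (1 + \<delta>) * lil_scale s n / (real n * s) \<le> t0"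
  proof -
    have "(\<lambda>n. (1 + \<delta>) * lil_scale s n / (real n * s)) \<longlonglongrightarrow> 0"
      unfolding lil_scale_def using s_pos by real_asymp
    from order_tendstoD(2)[OF this t0] show ?thesis by (rule eventually_mono) simp
  qed
  have ratio: "\<forall>\<^sub>F k in sequentially. real (N (Suc k)) \<le> r * real (N k)"
    using ev_pow[of "1 / (r - \<theta>)"]
  proof eventually_elim
    case (elim k)
    have "r - \<theta> > 0" using tt[symmetric] th1 by (simp add: mult_less_cancel_left1)
    then have "1 \<le> (r - \<theta>) * \<theta> ^ k" using elim by (simp add: field_simps)
    have "real (N (Suc k)) \<le> \<theta> * \<theta> ^ k + 1" using N(2)[of "Suc k"] by simp
    also have "\<dots> \<le> r * \<theta> ^ k" using \<open>1 \<le> (r - \<theta>) * \<theta> ^ k\<close> by (simp add: algebra_simps)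
    also have "\<dots> \<le> r * real (N k)" using N(1)[of k] r1 by (intro mult_left_mono) auto
    finally show ?case .
  qed
  have "\<forall>\<^sub>F k in sequentially. norm (prob (E k)) \<le> C\<^sup>2 * ln \<theta> powr (-(1 + \<delta>)) * real k powr (-(1 + \<delta>))"
    using ratio N_top[THEN eventually_compose_filterlim[OF small]]
      N_top[THEN eventually_compose_filterlim[OF eventually_ge_at_top[of 16]]]
      eventually_gt_at_top[of 0]
  proof eventually_elim
    case (elim k)
    define l where "l = ln (ln (real (N k)))"
    have lnln: "l > 0"
    proof -
      have "exp 1 < real (N k)" using elim(3) exp_le by linarith
      then have "ln (exp 1) < ln (real (N k))" using N(3)[of k] by (subst ln_less_cancel_iff) auto
      then have "1 < ln (real (N k))" by simp
      then show ?thesis by (simp add: l_def)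
    qed
    define a where "a = (1 + \<delta>) * lil_scale s (N k)"
    define n where "n = N (Suc k)"
    have n1: "real n \<ge> 1" using N(3)[of "Suc k"] by (simp add: n_def)
    have scale2: "(lil_scale s (N k))\<^sup>2 = 2 * real (N k) * s * l"
      unfolding lil_scale_def l_def[symmetric] using lnln s_pos by simp
    have scale_pos: "lil_scale s (N k) > 0"
      unfolding lil_scale_def l_def[symmetric] using lnln s_pos N(3)[of k] by simp
    have a0: "a > 0" using scale_pos \<delta> by (simp add: a_def)
    \<comment> \<open>The minimiser of \<open>n * t^2 * (s * r) / 2 - t * a\<close>.\<close>
    define t where "t = a / (real n * (s * r))"
    have tpos: "t > 0" using a0 n1 s_pos r1 by (simp add: t_def)
    have Nkn: "N k \<le> n"
      unfolding n_def N_def using th1 by (intro nat_mono ceiling_mono power_increasing) auto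
    have "t \<le> a / (real (N k) * s)" unfolding t_def
      using a0 s_pos r1 N(3)[of k] n1 Nkn
      by (intro divide_left_mono mult_mono mult_pos_pos) (auto simp: mult_le_cancel_left1)
    also have "\<dots> \<le> t0" using elim(2) by (simp add: a_def)
    finally have tle: "t \<le> t0" .
    have "n * t\<^sup>2 * (s + \<epsilon>) / 2 - t * a = - (a\<^sup>2 / (2 * real n * (s * r)))"
      unfolding eps(2) t_def using n1 s_pos r1 by (simp add: field_simps power2_eq_square)
    also have "\<dots> \<le> - ((1 + \<delta>) * l)"
    proof -
      have "(1 + \<delta>) * l * (2 * real n * (s * r)) \<le> (1 + \<delta>) * l * (2 * (r * real (N k)) * (s * r))"
        using elim(1) lnln \<delta> s_pos r1 by (intro mult_left_mono mult_right_mono) (auto simp: n_def)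
      also have "\<dots> = (1 + \<delta>) * (r * r) * (2 * real (N k) * s * l)" by (simp add: algebra_simps)
      also have "\<dots> = a\<^sup>2" unfolding a_def power_mult_distrib scale2 rr by (simp add: power2_eq_square)
      finally show ?thesis using n1 s_pos r1 by (simp add: field_simps)
    qed
    finally have expo: "n * t\<^sup>2 * (s + \<epsilon>) / 2 - t * a \<le> - ((1 + \<delta>) * l)" .
    have "ln (ln \<theta> * real k) \<le> l"
    proof -
      have "ln (\<theta> ^ k) \<le> ln (real (N k))" using N(1)[of k] th1 by (intro ln_mono) auto
      then have "ln \<theta> * real k \<le> ln (real (N k))" using th1 by (simp add: ln_realpow mult.commute)
      then show ?thesis unfolding l_def using th1 elim(4) by (intro ln_mono) auto
    qed
    then have "- ((1 + \<delta>) * l) \<le> - ((1 + \<delta>) * ln (ln \<theta> * real k))" using \<delta> by simp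
    then have "exp (n * t\<^sup>2 * (s + \<epsilon>) / 2 - t * a) \<le> exp (- ((1 + \<delta>) * ln (ln \<theta> * real k)))"
      using expo by simp
    also have "\<dots> = (ln \<theta> * real k) powr (-(1 + \<delta>))"
      using th1 elim(4) by (simp add: powr_def left_diff_distrib distrib_right)
    also have "\<dots> = ln \<theta> powr (-(1 + \<delta>)) * real k powr (-(1 + \<delta>))"
      using th1 by (simp add: powr_mult)
    finally have ex: "exp (n * t\<^sup>2 * (s + \<epsilon>) / 2 - t * a) \<le> ln \<theta> powr (-(1 + \<delta>)) * real k powr (-(1 + \<delta>))" .
    have "prob (E k) \<le> C\<^sup>2 * exp (n * t\<^sup>2 * (s + \<epsilon>) / 2 - t * a)"
      using maxi[OF tpos tle, of n a] by (simp add: E_def n_def a_def)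
    also have "\<dots> \<le> C\<^sup>2 * (ln \<theta> powr (-(1 + \<delta>)) * real k powr (-(1 + \<delta>)))"
      by (intro mult_left_mono ex) simp
    finally show ?case by (simp add: mult.assoc)
  qed
  then have "summable (\<lambda>k. prob (E k))"
    by (rule summable_comparison_test_ev)
       (use \<delta> in \<open>intro summable_mult, simp add: summable_real_powr_iff\<close>)
  then have "AE x in M. \<forall>\<^sub>F k in sequentially. x \<in> space M - E k"
    by (intro borel_cantelli_AE1 E_meas) (auto simp: emeasure_eq_measure)
  then show ?thesis
  proof (eventually_elim)
    case (elim x)
    \<comment> \<open>The block containing \<open>n\<close>:
      \<open>N (k n) \<le> n \<le> N (Suc (k n))\<close>.\<close>
    define k where "k n = nat \<lfloor>log \<theta> (real n)\<rfloor>" for n :: nat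
    have k_top: "filterlim k at_top sequentially"
      unfolding k_def[abs_def] using th1 by real_asymp
    show ?case
      using k_top[THEN eventually_compose_filterlim[OF elim]] eventually_gt_at_top[of 0]
       k_top[THEN eventually_compose_filterlim[OF N_top[THEN eventually_compose_filterlim[OF eventually_ge_at_top[of 3]]]]]
    proof eventually_elim
      case (elim n)
      have lg: "log \<theta> (real n) \<ge> 0" using th1 elim(2) by simp
      have k1: "real (k n) \<le> log \<theta> (real n)" and k2: "log \<theta> (real n) \<le> real (Suc (k n))"
        using lg real_of_int_floor_add_one_ge[of "log \<theta> (real n)"] by (auto simp: k_def of_nat_nat add.commute)
      have "\<theta> ^ k n \<le> real n"
        using k1 th1 elim(2) by (simp add: le_log_iff powr_realpow)
      then have 1: "N (k n) \<le> n" unfolding N_def by (simp add: nat_le_iff ceiling_le_iff)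
      have "real n \<le> \<theta> ^ Suc (k n)"
        using k2 th1 elim(2) by (subst (asm) log_le_iff) (auto simp: powr_realpow simp del: power_Suc of_nat_Suc)
      then have 2: "n \<le> N (Suc (k n))" using N(1)[of "Suc (k n)"] by linarith
      have "S n x < (1 + \<delta>) * lil_scale s (N (k n))"
        using elim(1) 2 by (auto simp: E_def not_le dest!: spec[of _ n])
      also have "\<dots> \<le> (1 + \<delta>) * lil_scale s n"
        using \<delta> 1 elim(3) s_pos by (intro mult_left_mono lil_scale_mono) auto
      finally show ?case by simp
    qed
  qed
qed

text \<open>A Cramer-type lower bound given the past. Under the exponential tilt by \<open>t\<close>
  the increment concentrates near \<open>a = m s t\<close>, because tilting further to
  \<open>(1 + \<eta>) t\<close> or back to \<open>(1 - \<eta>) t\<close> bounds the mass on either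
  side. On the remaining window the tilt is at most \<open>exp ((1 + \<eta>) L)\<close> with
  \<open>L = t a\<close>, while the total is about \<open>exp (L / 2)\<close>.\<close>

lemma conditional_tail_lower_bound:
  assumes \<eta>: "0 < \<eta>" "\<eta> < 1"
  obtains t0 c L0 :: real where "t0 > 0" "c > 0"
    "\<And>(n::nat) (m::nat) B L. B \<in> sets (F n) \<Longrightarrow> m > 0 \<Longrightarrow> L \<ge> L0 \<Longrightarrow> L > 0 \<Longrightarrow> L \<le> t0 * real m \<Longrightarrow>
       prob B * (c * exp (- (L * (1/2 + 2 * \<eta>))))
         \<le> prob (B \<inter> {x \<in> space M. S (n + m) x - S n x \<ge> (1 - \<eta>) * sqrt (L * real m * s)})"
proof -
  \<comment> \<open>Shifting the tilt by a factor \<open>1 + \<eta>\<close> or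
    \<open>1 - \<eta>\<close> gains \<open>\<eta>^2 / 2\<close> in the exponent, per unit of
    \<open>L\<close>. The variance error \<open>e\<close> costs at most \<open>5 * e / 2\<close>
    there, so this choice leaves \<open>\<eta>^2 / 4\<close>.\<close>
  define e where "e = \<eta>\<^sup>2 / 10"
  have e: "0 < e" "e \<le> \<eta>" using \<eta> mult_left_le[of \<eta> \<eta>] by (auto simp: e_def power2_eq_square)
  have e5: "e * 5 = \<eta>\<^sup>2 / 2" by (simp add: e_def)
  have "s * e > 0" using s_pos e by simp
  obtain t1 C :: real where t1: "t1 > 0" and C: "C \<ge> 1"
    and lo: "\<And>(t::real) n m B. \<bar>t\<bar> \<le> t1 \<Longrightarrow> B \<in> sets (F n) \<Longrightarrow>
      prob B * exp (real m * t\<^sup>2 * (s - s * e) / 2) / C\<^sup>2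
        \<le> expectation (\<lambda>x. indicator B x * exp (t * (S (n + m) x - S n x)))"
    and hi: "\<And>(t::real) n m B. \<bar>t\<bar> \<le> t1 \<Longrightarrow> B \<in> sets (F n) \<Longrightarrow>
      expectation (\<lambda>x. indicator B x * exp (t * (S (n + m) x - S n x)))
        \<le> prob B * C\<^sup>2 * exp (real m * t\<^sup>2 * (s + s * e) / 2)"
    by (rule conditional_mgf[OF \<open>s * e > 0\<close>]) (rule that; assumption)
  have C0: "C > 0" using C by simp
  \<comment> \<open>Ensures \<open>t \<le> t1 / 2\<close>, so that even the tilt
    \<open>(1 + \<eta>) * t\<close> is admissible.\<close>
  define t0 where "t0 = s * (t1 / 2)\<^sup>2"
  define c where "c = 1 / (2 * C\<^sup>2)"
  \<comment> \<open>From here on each of the two outer parts is at most a quarter of the lower bound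
    for the whole, which leaves one half: hence the 2 in \<open>c\<close>.\<close>
  define L0 where "L0 = 4 * ln (4 * C ^ 4) / \<eta>\<^sup>2"
  have main: "prob B * (c * exp (- (L * (1/2 + 2 * \<eta>))))
         \<le> prob (B \<inter> {x \<in> space M. S (n + m) x - S n x \<ge> (1 - \<eta>) * sqrt (L * real m * s)})"
    if B: "B \<in> sets (F n)" and m: "m > 0" and L: "L \<ge> L0" "L > 0" "L \<le> t0 * real m" for n m B L
  proof -
    define t where "t = sqrt (L / (real m * s))"
    define a where "a = sqrt (L * real m * s)"
    have t2: "real m * t\<^sup>2 * s = L" using L(2) m s_pos by (simp add: t_def)
    have t0': "t > 0" using L(2) m s_pos by (simp add: t_def)
    have ta: "t * a = L"
    proof -
      have "t * a = sqrt (L\<^sup>2)" unfolding t_def a_def real_sqrt_mult[symmetric]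
        using m s_pos by (intro arg_cong[where f = sqrt]) (simp add: field_simps power2_eq_square)
      then show ?thesis using L(2) by simp
    qed
    have "L / (real m * s) \<le> (t1 / 2)\<^sup>2" using L(3) m s_pos by (simp add: t0_def field_simps)
    then have "t \<le> t1 / 2" unfolding t_def using t1 by (intro real_le_lsqrt) auto
    moreover have "(1 + \<eta>) * t \<le> 2 * t" using t0' \<eta> by (intro mult_right_mono) auto
    ultimately have tb: "(1 + \<eta>) * t \<le> t1" by linarith
    have tb': "\<bar>(1 + \<eta>) * t\<bar> \<le> t1" "\<bar>(1 - \<eta>) * t\<bar> \<le> t1" "\<bar>t\<bar> \<le> t1"
    proof -
      show "\<bar>(1 + \<eta>) * t\<bar> \<le> t1" using tb t0' \<eta> by simp
      have "(1 - \<eta>) * t \<le> (1 + \<eta>) * t" "1 * t \<le> (1 + \<eta>) * t"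
        using t0' \<eta> by (intro mult_right_mono; simp)+
      then have "(1 - \<eta>) * t \<le> t1" "t \<le> t1" using tb by linarith+
      then show "\<bar>(1 - \<eta>) * t\<bar> \<le> t1" "\<bar>t\<bar> \<le> t1" using t0' \<eta> by auto
    qed
    define T where "T x = S (n + m) x - S n x" for x
    define A where "A = B \<inter> {x \<in> space M. T x \<ge> (1 - \<eta>) * a}"
    have BM [measurable]: "B \<in> sets M" using B sets_F_M by blast
    have AM [measurable]: "A \<in> sets M" unfolding A_def T_def by measurable
    define E where "E r = expectation (\<lambda>x. indicator B x * exp (r * T x))" for r
    have iE: "integrable M (\<lambda>x. indicator B x * exp (r * T x))" for r
      unfolding T_def by (rule integrable_indicator_exp[OF BM])
    have iA: "integrable M (indicator A :: _ \<Rightarrow> real)"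
      by (simp add: integrable_indicator_iff emeasure_eq_measure)
    let ?u = "exp (- (\<eta> * (1 + \<eta>) * L))" and ?v = "exp (\<eta> * (1 - \<eta>) * L)"
    \<comment> \<open>Chebyshev bounds with exponent \<open>(1 - \<eta>) t\<close> below the window
      and \<open>(1 + \<eta>) t\<close> above it; inside the window, the largest value of the
      exponential.\<close>
    have pw: "indicator B x * exp (t * T x) \<le> exp ((1 + \<eta>) * L) * indicator A x
       + ?u * (indicator B x * exp (((1 + \<eta>) * t) * T x)) + ?v * (indicator B x * exp (((1 - \<eta>) * t) * T x))"
      if "x \<in> space M" for x
    proof (cases "x \<in> B")
      case True
      have nn: "0 \<le> exp ((1 + \<eta>) * L) * indicator A x" "0 \<le> ?u * exp (((1 + \<eta>) * t) * T x)"
        "0 \<le> ?v * exp (((1 - \<eta>) * t) * T x)" by simp_all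
      have B1: "indicator B x = (1::real)" using True by simp
      consider "T x < (1 - \<eta>) * a" | "T x > (1 + \<eta>) * a" | "(1 - \<eta>) * a \<le> T x" "T x \<le> (1 + \<eta>) * a"
        by linarith
      then show ?thesis
      proof cases
        case 1
        have "exp (t * T x) \<le> ?v * exp (((1 - \<eta>) * t) * T x)"
        proof -
          have "\<eta> * t * T x \<le> \<eta> * t * ((1 - \<eta>) * a)"
            using 1 \<eta> t0' by (intro mult_left_mono) auto
          also have "\<dots> = \<eta> * (1 - \<eta>) * L" using ta[symmetric] by (simp add: algebra_simps)
          finally have "t * T x \<le> \<eta> * (1 - \<eta>) * L + ((1 - \<eta>) * t) * T x" by (simp add: algebra_simps)
          then show ?thesis by (simp add: exp_add[symmetric])
        qed
        then show ?thesis using nn unfolding B1 mult_1 by linarith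
      next
        case 2
        have "exp (t * T x) \<le> ?u * exp (((1 + \<eta>) * t) * T x)"
        proof -
          have "\<eta> * t * T x \<ge> \<eta> * t * ((1 + \<eta>) * a)"
            using 2 \<eta> t0' by (intro mult_left_mono) auto
          also have "\<eta> * t * ((1 + \<eta>) * a) = \<eta> * (1 + \<eta>) * L" using ta[symmetric] by (simp add: algebra_simps)
          finally have "t * T x \<le> - (\<eta> * (1 + \<eta>) * L) + ((1 + \<eta>) * t) * T x" by (simp add: algebra_simps)
          then show ?thesis by (simp add: exp_add[symmetric])
        qed
        then show ?thesis using nn unfolding B1 mult_1 by linarith
      next
        case 3
        have "t * T x \<le> t * ((1 + \<eta>) * a)" using 3 t0' by (intro mult_left_mono) auto
        also have "\<dots> = (1 + \<eta>) * L" using ta[symmetric] by (simp add: algebra_simps)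
        finally have "exp (t * T x) \<le> exp ((1 + \<eta>) * L)" by simp
        moreover have "x \<in> A" using 3 True that by (simp add: A_def)
        then have A1: "indicator A x = (1::real)" by simp
        ultimately show ?thesis using nn unfolding B1 A1 mult_1 mult_1_right by linarith
      qed
    qed (simp add: indicator_def)
    have "E t \<le> expectation (\<lambda>x. exp ((1 + \<eta>) * L) * indicator A x
       + ?u * (indicator B x * exp (((1 + \<eta>) * t) * T x)) + ?v * (indicator B x * exp (((1 - \<eta>) * t) * T x)))"
      unfolding E_def by (intro integral_mono pw Bochner_Integration.integrable_add integrable_mult_right iE iA)
    also have "\<dots> = exp ((1 + \<eta>) * L) * prob A + ?u * E ((1 + \<eta>) * t) + ?v * E ((1 - \<eta>) * t)"
      unfolding E_def using iA iE by simp
    finally have Et: "E t \<le> exp ((1 + \<eta>) * L) * prob A + ?u * E ((1 + \<eta>) * t) + ?v * E ((1 - \<eta>) * t)" .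
    let ?w = "exp (L * (1 - e) / 2)"
    have Elo: "prob B * ?w / C\<^sup>2 \<le> E t"
    proof -
      have "real m * t\<^sup>2 * (s - s * e) / 2 = (real m * t\<^sup>2 * s) * (1 - e) / 2" by (simp add: algebra_simps)
      then have "real m * t\<^sup>2 * (s - s * e) / 2 = L * (1 - e) / 2" unfolding t2 .
      then show ?thesis using lo[OF tb'(3) B, of m] by (simp add: E_def T_def)
    qed
    have Ehi: "E (r * t) \<le> prob B * C\<^sup>2 * exp (L * r\<^sup>2 * (1 + e) / 2)" if "\<bar>r * t\<bar> \<le> t1" for r
    proof -
      have "real m * (r * t)\<^sup>2 * (s + s * e) / 2 = (real m * t\<^sup>2 * s) * r\<^sup>2 * (1 + e) / 2"
        by (simp add: algebra_simps power_mult_distrib)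
      then have "real m * (r * t)\<^sup>2 * (s + s * e) / 2 = L * r\<^sup>2 * (1 + e) / 2" unfolding t2 .
      then show ?thesis using hi[OF that B, of m] by (simp add: E_def T_def)
    qed
    let ?q = "exp (- (L * \<eta>\<^sup>2 / 4))"
    have sq: "\<eta>\<^sup>2 \<le> 1" using \<eta> by (simp add: power2_eq_square mult_le_one)
    have ex1: "- (\<eta> * (1 + \<eta>) * L) + L * (1 + \<eta>)\<^sup>2 * (1 + e) / 2 \<le> L * (1 - e) / 2 - L * \<eta>\<^sup>2 / 4"
    proof -
      have "(1 + \<eta>)\<^sup>2 + 1 \<le> 5" using \<eta> sq by (simp add: power2_sum)
      then have "e * ((1 + \<eta>)\<^sup>2 + 1) \<le> e * 5" using e by (intro mult_left_mono) auto
      then have "- (\<eta> * (1 + \<eta>)) + (1 + \<eta>)\<^sup>2 * (1 + e) / 2 \<le> (1 - e) / 2 - \<eta>\<^sup>2 / 4"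
        using e5 by (simp add: power2_eq_square field_simps)
      from mult_left_mono[OF this, of L] show ?thesis using L(2) by (simp add: algebra_simps)
    qed
    have ex2: "\<eta> * (1 - \<eta>) * L + L * (1 - \<eta>)\<^sup>2 * (1 + e) / 2 \<le> L * (1 - e) / 2 - L * \<eta>\<^sup>2 / 4"
    proof -
      have "(1 - \<eta>)\<^sup>2 + 1 \<le> 5" using \<eta> sq by (simp add: power2_diff)
      then have "e * ((1 - \<eta>)\<^sup>2 + 1) \<le> e * 5" using e by (intro mult_left_mono) auto
      then have "\<eta> * (1 - \<eta>) + (1 - \<eta>)\<^sup>2 * (1 + e) / 2 \<le> (1 - e) / 2 - \<eta>\<^sup>2 / 4"
        using e5 by (simp add: power2_eq_square field_simps)
      from mult_left_mono[OF this, of L] show ?thesis using L(2) by (simp add: algebra_simps)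
    qed
    have pBC: "prob B * C\<^sup>2 \<ge> 0" by simp
    have u: "?u * E ((1 + \<eta>) * t) \<le> prob B * C\<^sup>2 * (?w * ?q)"
    proof -
      have "?u * E ((1 + \<eta>) * t) \<le> ?u * (prob B * C\<^sup>2 * exp (L * (1 + \<eta>)\<^sup>2 * (1 + e) / 2))"
        by (intro mult_left_mono Ehi tb') auto
      also have "\<dots> = prob B * C\<^sup>2 * exp (- (\<eta> * (1 + \<eta>) * L) + L * (1 + \<eta>)\<^sup>2 * (1 + e) / 2)"
        by (simp only: exp_add mult_ac)
      also have "\<dots> \<le> prob B * C\<^sup>2 * exp (L * (1 - e) / 2 - L * \<eta>\<^sup>2 / 4)"
        using ex1 by (intro mult_left_mono pBC) auto
      finally show ?thesis by (simp add: exp_add[symmetric])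
    qed
    have v: "?v * E ((1 - \<eta>) * t) \<le> prob B * C\<^sup>2 * (?w * ?q)"
    proof -
      have "?v * E ((1 - \<eta>) * t) \<le> ?v * (prob B * C\<^sup>2 * exp (L * (1 - \<eta>)\<^sup>2 * (1 + e) / 2))"
        by (intro mult_left_mono Ehi tb') auto
      also have "\<dots> = prob B * C\<^sup>2 * exp (\<eta> * (1 - \<eta>) * L + L * (1 - \<eta>)\<^sup>2 * (1 + e) / 2)"
        by (simp only: exp_add mult_ac)
      also have "\<dots> \<le> prob B * C\<^sup>2 * exp (L * (1 - e) / 2 - L * \<eta>\<^sup>2 / 4)"
        using ex2 by (intro mult_left_mono pBC) auto
      finally show ?thesis by (simp add: exp_add[symmetric])
    qed
    have q: "4 * C ^ 4 * ?q \<le> 1"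
    proof -
      have "4 * ln (4 * C ^ 4) \<le> L * \<eta>\<^sup>2" using L(1) \<eta> by (simp add: L0_def field_simps)
      then have "ln (4 * C ^ 4) \<le> L * \<eta>\<^sup>2 / 4" by simp
      then have "exp (ln (4 * C ^ 4)) \<le> exp (L * \<eta>\<^sup>2 / 4)" by simp
      then have "4 * C ^ 4 \<le> exp (L * \<eta>\<^sup>2 / 4)" using C0 by simp
      then show ?thesis by (simp add: exp_minus field_simps)
    qed
    have "C\<^sup>2 * (?w * ?q) \<le> ?w / (4 * C\<^sup>2)"
    proof -
      have "?w * (4 * C ^ 4 * ?q) \<le> ?w * 1" by (intro mult_left_mono q) auto
      then show ?thesis using C0 by (simp add: field_simps power_numeral_reduce)
    qed
    then have "prob B * (C\<^sup>2 * (?w * ?q)) \<le> prob B * (?w / (4 * C\<^sup>2))" by (intro mult_left_mono) auto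
    then have "prob B * ?w / C\<^sup>2 \<le> exp ((1 + \<eta>) * L) * prob A + 2 * (prob B * (?w / (4 * C\<^sup>2)))"
      using Elo Et u v by (simp add: mult.assoc)
    then have "prob B * c * ?w \<le> exp ((1 + \<eta>) * L) * prob A"
      by (simp add: c_def field_simps)
    then have *: "exp (- ((1 + \<eta>) * L)) * (prob B * c * ?w) \<le> exp (- ((1 + \<eta>) * L)) * (exp ((1 + \<eta>) * L) * prob A)"
      by (intro mult_left_mono) auto
    have "prob B * c * exp (L * (1 - e) / 2 - (1 + \<eta>) * L) = exp (- ((1 + \<eta>) * L)) * (prob B * c * ?w)"
      by (simp only: diff_conv_add_uminus exp_add mult_ac)
    also note *
    also have "exp (- ((1 + \<eta>) * L)) * (exp ((1 + \<eta>) * L) * prob A) = prob A" by (simp add: exp_minus)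
    finally have "prob B * c * exp (L * (1 - e) / 2 - (1 + \<eta>) * L) \<le> prob A" .
    moreover have "- (L * (1/2 + 2 * \<eta>)) \<le> L * (1 - e) / 2 - (1 + \<eta>) * L"
    proof -
      have "L * (e / 2) \<le> L * \<eta>" using e L(2) by (intro mult_left_mono) auto
      then show ?thesis by (simp add: algebra_simps)
    qed
    then have "prob B * c * exp (- (L * (1/2 + 2 * \<eta>))) \<le> prob B * c * exp (L * (1 - e) / 2 - (1 + \<eta>) * L)"
      by (intro mult_left_mono) (auto simp: c_def)
    ultimately show ?thesis by (simp add: A_def a_def T_def mult.assoc)
  qed
  have "t0 > 0" "c > 0" using s_pos t1 C0 by (auto simp: t0_def c_def)
  from that[OF this main] show ?thesis .
qed

text \<open>The moment bounds are even in \<open>t\<close>. This serves twice: for the minus sign in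
  the theorem, and in \<open>frequently_S_ge\<close> to limit how negative the sum can be at the
  start of a block.\<close>

lemma log_mgf_process_uminus: "log_mgf_process M F (\<lambda>n x. - g n x) s"
proof unfold_locales
  fix \<epsilon> :: real assume "\<epsilon> > 0"
  then obtain t0 C where t0: "t0 > 0" and C: "C \<ge> 1"
    and ex: "\<And>t. \<bar>t\<bar> \<le> t0 \<Longrightarrow> \<exists>H. tilting M F g t (s - \<epsilon>) (s + \<epsilon>) C H"
    using mgf_bounds by blast
  have "\<exists>H. tilting M F (\<lambda>n x. - g n x) t (s - \<epsilon>) (s + \<epsilon>) C H" if "\<bar>t\<bar> \<le> t0" for t
    using ex[of "- t"] that by (simp add: tilting_def)
  then show "\<exists>t0>0. \<exists>C\<ge>1. \<forall>t. \<bar>t\<bar> \<le> t0 \<longrightarrow>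
      (\<exists>H. tilting M F (\<lambda>n x. - g n x) t (s - \<epsilon>) (s + \<epsilon>) C H)" using t0 C by blast
qed (use space_F sets_F sets_F_Suc g_meas g_bdd s_pos in auto)

text \<open>A conditional second Borel-Cantelli argument in place of independence: whatever happened
  before block \<open>k\<close>, it is large with probability at least \<open>p k\<close>, and the
  \<open>p k\<close> have a divergent sum.\<close>

lemma frequently_block_large:
  assumes \<eta>: "0 < \<eta>" "\<eta> < 1/4" and \<theta>: "\<theta> \<ge> (2::nat)"
  shows "AE x in M. \<exists>\<^sub>F k in sequentially. S (\<theta> ^ Suc k) x - S (\<theta> ^ k) x \<ge>
     (1 - \<eta>) * sqrt ((1 - 4 * \<eta>) * (1 - 1 / real \<theta>)) * lil_scale s (\<theta> ^ Suc k)"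
proof -
  have "\<eta> < 1" using \<eta> by simp
  obtain t0 c L0 :: real where t0: "t0 > 0" and c: "c > 0" and
    low: "\<And>(n::nat) (m::nat) B L. B \<in> sets (F n) \<Longrightarrow> m > 0 \<Longrightarrow> L \<ge> L0 \<Longrightarrow> L > 0 \<Longrightarrow> L \<le> t0 * real m \<Longrightarrow>
       prob B * (c * exp (- (L * (1/2 + 2 * \<eta>))))
         \<le> prob (B \<inter> {x \<in> space M. S (n + m) x - S n x \<ge> (1 - \<eta>) * sqrt (L * real m * s)})"
    by (rule conditional_tail_lower_bound[OF \<eta>(1) \<open>\<eta> < 1\<close>]) (rule that; assumption)
  define \<rho> where "\<rho> = (1 - \<eta>) * sqrt ((1 - 4 * \<eta>) * (1 - 1 / real \<theta>))"
  define A where "A k = {x \<in> space M. S (\<theta> ^ Suc k) x - S (\<theta> ^ k) x \<ge> \<rho> * lil_scale s (\<theta> ^ Suc k)}" for k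
  define l where "l k = ln (ln (real (\<theta> ^ Suc k)))" for k
  define m where "m k = \<theta> ^ Suc k - \<theta> ^ k" for k
  \<comment> \<open>For \<open>L = 2 * (1 - 4 * \<eta>) * l k\<close> the exponent
    \<open>L * (1/2 + 2 * \<eta>)\<close> of the tail bound equals \<open>q * l k\<close>. As
    \<open>q = 1 - 16 * \<eta>^2 < 1\<close>, \<open>p k\<close> decays like
    \<open>k powr -q\<close>, too slowly to be summable.\<close>
  define q where "q = (1 - 4 * \<eta>) * (1 + 4 * \<eta>)"
  define p where "p k = c * exp (- (q * l k))" for k
  have q: "0 < q" "q < 1" using \<eta> mult_strict_mono[of "4 * \<eta>" 1 "4 * \<eta>" 1]
    by (auto simp: q_def algebra_simps)
  have l_eq: "l k = ln (real (Suc k) * ln (real \<theta>))" for k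
  proof -
    have "ln (real \<theta> ^ Suc k) = real (Suc k) * ln (real \<theta>)" using \<theta> by (subst ln_realpow) auto
    then show ?thesis by (simp only: l_def of_nat_power)
  qed
  have lth: "ln (real \<theta>) > 0" using \<theta> by simp
  have m_eq: "real (m k) = (1 - 1 / real \<theta>) * real (\<theta> ^ Suc k)" for k
  proof -
    have "\<theta> ^ k \<le> \<theta> ^ Suc k" using \<theta> by simp
    then show ?thesis using \<theta> by (simp add: m_def of_nat_diff field_simps)
  qed
  have m_pos: "m k > 0" for k
    using \<theta> by (simp add: m_def)
  have p_eq: "p k = c * ln (real \<theta>) powr (- q) * real (Suc k) powr (- q)" for k
    unfolding p_def l_eq using lth by (simp add: powr_def ln_mult exp_add[symmetric] algebra_simps del: of_nat_Suc)
  have "\<forall>\<^sub>F k in sequentially. l k > max 0 (L0 / (2 * (1 - 4 * \<eta>)))"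
  proof -
    have "filterlim l at_top sequentially" unfolding l_eq[abs_def] using lth by real_asymp
    then show ?thesis unfolding filterlim_at_top_dense by blast
  qed
  moreover have "\<forall>\<^sub>F k in sequentially. 2 * (1 - 4 * \<eta>) * l k \<le> t0 * ((1 - 1 / real \<theta>) * real \<theta> ^ Suc k)"
  proof -
    have r: "1 < real \<theta>" using \<theta> by simp
    have "((\<lambda>k. 2 * (1 - 4 * \<eta>) * l k / real \<theta> ^ Suc k) \<longlongrightarrow> 0) sequentially"
      unfolding l_eq using lth r by real_asymp
    moreover have "t0 * (1 - 1 / real \<theta>) > 0" using t0 r by simp
    ultimately have "\<forall>\<^sub>F k in sequentially. 2 * (1 - 4 * \<eta>) * l k / real \<theta> ^ Suc k < t0 * (1 - 1 / real \<theta>)"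
      by (rule order_tendstoD(2))
    then show ?thesis
    proof eventually_elim
      case (elim k)
      have "0 < real \<theta> ^ Suc k" using r by simp
      with elim show ?case by (simp add: pos_divide_less_eq mult.assoc)
    qed
  qed
  ultimately have "\<forall>\<^sub>F k in sequentially. \<forall>B\<in>sets (F (\<theta> ^ k)). prob (B - A k) \<le> prob B * (1 - p k)"
  proof eventually_elim
    case (elim k)
    show ?case
    proof
      fix B assume B: "B \<in> sets (F (\<theta> ^ k))"
      define L where "L = 2 * (1 - 4 * \<eta>) * l k"
      have "\<theta> ^ k \<le> \<theta> ^ Suc k" using \<theta> by simp
      then have nm: "\<theta> ^ k + m k = \<theta> ^ Suc k" by (simp add: m_def)
      have eta4: "1 - 4 * \<eta> > 0" using \<eta> by simp
      have "L0 < L" using elim(1) eta4 by (simp add: L_def field_simps)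
      have L0: "L > 0" using elim(1) eta4 by (simp add: L_def)
      have LT: "L \<le> t0 * real (m k)" using elim(2) unfolding L_def m_eq by simp
      have e1: "L * (1/2 + 2 * \<eta>) = q * l k" by (simp add: L_def q_def algebra_simps)
      have e2: "(1 - \<eta>) * sqrt (L * real (m k) * s) = \<rho> * lil_scale s (\<theta> ^ Suc k)"
        unfolding \<rho>_def L_def m_eq lil_scale_def l_def[symmetric] mult.assoc real_sqrt_mult[symmetric]
        by (simp only: mult_ac)
      have AM: "A k \<in> sets M" unfolding A_def by measurable
      have "prob B * p k \<le> prob (B \<inter> A k)"
        using low[OF B m_pos less_imp_le[OF \<open>L0 < L\<close>] L0 LT] unfolding e1 e2 nm by (simp add: p_def A_def)
      moreover have "prob (B - A k) = prob B - prob (B \<inter> A k)"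
        using sets_F_M[OF B] AM by (rule finite_measure_Diff')
      ultimately show "prob (B - A k) \<le> prob B * (1 - p k)" by (simp add: algebra_simps)
    qed
  qed
  then obtain K0 where K0: "\<And>k B. k \<ge> K0 \<Longrightarrow> B \<in> sets (F (\<theta> ^ k)) \<Longrightarrow> prob (B - A k) \<le> prob B * (1 - p k)"
    unfolding eventually_sequentially by blast
  \<comment> \<open>None of the \<open>j\<close> blocks from \<open>K\<close> on is large; the
    conditional bound makes its probability at most a product of factors \<open>1 - p\<close>, which
    tends to 0.\<close>
  define R where "R K j = {x \<in> space M. \<forall>i<j. x \<notin> A (K + i)}" for K j
  have A_F: "A k \<in> sets (F (\<theta> ^ Suc k))" for k
  proof -
    have "\<theta> ^ k \<le> \<theta> ^ Suc k" using \<theta> by simp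
    then have [measurable]: "S (\<theta> ^ k) \<in> borel_measurable (F (\<theta> ^ Suc k))"
       "S (\<theta> ^ Suc k) \<in> borel_measurable (F (\<theta> ^ Suc k))" by (auto intro: S_meas_F)
    show ?thesis unfolding A_def space_F[of "\<theta> ^ Suc k", symmetric] by measurable
  qed
  have R_Suc: "R K (Suc j) = R K j - A (K + j)" for K j
    by (auto simp: R_def less_Suc_eq)
  have R_F: "R K j \<in> sets (F (\<theta> ^ (K + j)))" for K j
  proof (induction j)
    case 0
    have "R K 0 = space (F (\<theta> ^ (K + 0)))" by (simp add: R_def space_F)
    then show ?case by simp
  next
    case (Suc j)
    have "\<theta> ^ (K + j) \<le> \<theta> ^ (K + Suc j)" using \<theta> by simp
    then have "R K j \<in> sets (F (\<theta> ^ (K + Suc j)))" using Suc sets_F_mono by blast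
    moreover have "A (K + j) \<in> sets (F (\<theta> ^ (K + Suc j)))" using A_F[of "K + j"] by simp
    ultimately show ?case unfolding R_Suc by blast
  qed
  have R_prob: "prob (R K j) \<le> exp (- (\<Sum>i<j. p (K + i)))" if "K \<ge> K0" for K j
  proof (induction j)
    case (Suc j)
    have "prob (R K (Suc j)) \<le> prob (R K j) * (1 - p (K + j))"
      unfolding R_Suc using that by (intro K0 R_F) auto
    also have "\<dots> \<le> prob (R K j) * exp (- p (K + j))"
      using exp_ge_add_one_self[of "- p (K + j)"] by (intro mult_left_mono) auto
    also have "\<dots> \<le> exp (- (\<Sum>i<j. p (K + i))) * exp (- p (K + j))"
      by (intro mult_right_mono Suc) auto
    finally show ?case by (simp add: exp_add[symmetric])
  qed simp
  have div: "filterlim (\<lambda>j. \<Sum>i<j. p (K + i)) at_top sequentially" for K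
  proof -
    have ns: "\<not> summable (\<lambda>i. p (i + K))"
    proof
      assume "summable (\<lambda>i. p (i + K))"
      then have "summable p" by (simp only: summable_iff_shift)
      then have "summable (\<lambda>k. (c * ln (real \<theta>) powr (- q)) * real (Suc k) powr (- q))" by (simp add: p_eq[abs_def])
      then have "summable (\<lambda>k. real (Suc k) powr (- q))"
        by (subst (asm) summable_cmult_iff) (use c lth in auto)
      then have "summable (\<lambda>k. real k powr (- q))" by (subst (asm) summable_Suc_iff)
      then show False using q by (simp add: summable_real_powr_iff)
    qed
    have p0: "p i \<ge> 0" for i using c by (simp add: p_def)
    have unb: "\<exists>j. (\<Sum>i<j. p (K + i)) > Z" for Z
    proof (rule ccontr)
      assume "\<not> (\<exists>j. (\<Sum>i<j. p (K + i)) > Z)"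
      then have *: "(\<Sum>i<j. p (i + K)) \<le> Z" for j by (simp add: not_less add.commute)

      then have "summable (\<lambda>i. p (i + K))"
        using p0 by (intro bounded_imp_summable[of _ Z]) (simp_all only: lessThan_Suc_atMost[symmetric] *)
      with ns show False by blast
    qed
    show ?thesis unfolding filterlim_at_top
    proof
      fix Z
      obtain j where j: "(\<Sum>i<j. p (K + i)) > Z" using unb by blast
      show "\<forall>\<^sub>F j in sequentially. Z \<le> (\<Sum>i<j. p (K + i))"
        using eventually_ge_at_top[of j]
      proof eventually_elim
        case (elim j')
        have "(\<Sum>i<j. p (K + i)) \<le> (\<Sum>i<j'. p (K + i))"
          using elim p0 by (intro sum_mono2) auto
        then show ?case using j by simp
      qed
    qed
  qed
  have null: "AE x in M. \<exists>i. x \<in> A (K + i)" if K: "K \<ge> K0" for K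
  proof (rule AE_I[where N = "\<Inter>j. R K j"])
    have RM: "R K j \<in> sets M" for j using R_F sets_F_M by blast
    show "{x \<in> space M. \<not> (\<exists>i. x \<in> A (K + i))} \<subseteq> (\<Inter>j. R K j)" by (auto simp: R_def)
    show "(\<Inter>j. R K j) \<in> sets M" using RM by auto
    have "prob (\<Inter>j. R K j) \<le> exp (- (\<Sum>i<j. p (K + i)))" for j
      by (rule order_trans[OF finite_measure_mono R_prob[OF K]]) (use RM in auto)
    moreover have "(\<lambda>j. exp (- (\<Sum>i<j. p (K + i)))) \<longlonglongrightarrow> 0"
      using div[of K] by (intro filterlim_compose[OF exp_at_bot] filterlim_compose[OF filterlim_uminus_at_bot_at_top])
    ultimately have "prob (\<Inter>j. R K j) \<le> 0"
      by (intro LIMSEQ_le_const) auto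
    then show "emeasure M (\<Inter>j. R K j) = 0"
      by (simp add: emeasure_eq_measure measure_le_0_iff)
  qed
  have "AE x in M. \<forall>K\<ge>K0. \<exists>i. x \<in> A (K + i)"
    unfolding AE_all_countable using null by auto
  then show ?thesis
  proof eventually_elim
    case (elim x)
    show ?case unfolding frequently_sequentially
    proof
      fix K
      obtain i where "x \<in> A (max K K0 + i)" using elim[rule_format, of "max K K0"] by auto
      then show "\<exists>k\<ge>K. (1 - \<eta>) * sqrt ((1 - 4 * \<eta>) * (1 - 1 / real \<theta>)) * lil_scale s (\<theta> ^ Suc k)
          \<le> S (\<theta> ^ Suc k) x - S (\<theta> ^ k) x"
        by (intro exI[of _ "max K K0 + i"]) (auto simp: A_def \<rho>_def)
    qed
  qed
qed

text \<open>A large block that starts from a value which is not too negative. The upper bound for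
  \<open>- S\<close> controls that value, and for large \<theta> the scale at the start of a block
  is small compared with the scale at its end.\<close>

lemma frequently_S_ge:
  assumes \<delta>: "\<delta> > 0"
  shows "AE x in M. \<exists>\<^sub>F n in sequentially. S n x \<ge> (1 - \<delta>) * lil_scale s n"
proof -
  interpret neg: log_mgf_process M F "\<lambda>n x. - g n x" s by (rule log_mgf_process_uminus)
  have neg_S: "neg.S n x = - S n x" for n x by (simp add: neg.S_def S_def sum_negf)
  \<comment> \<open>All losses are driven by one integer \<open>q\<close>: with
    \<open>\<theta> = q^2\<close> the scale at the start of a block is at most \<open>1 / q\<close>
    times the scale at its end, and the factor 2 is \<open>1 + \<delta>\<close> at
    \<open>\<delta> = 1\<close> in the upper bound for \<open>- S\<close>.\<close>
  have "(\<lambda>q. (1 - 1 / (8 * real q)) * sqrt ((1 - 4 * (1 / (8 * real q))) * (1 - 1 / real (q ^ 2))) - 2 / real q) \<longlonglongrightarrow> 1"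
    by real_asymp
  then have "\<forall>\<^sub>F q in sequentially. (1 - 1 / (8 * real q)) * sqrt ((1 - 4 * (1 / (8 * real q))) * (1 - 1 / real (q ^ 2))) - 2 / real q > 1 - \<delta>"
    by (rule order_tendstoD(1)) (use \<delta> in simp)
  then obtain q where q: "q \<ge> 2" 
    "(1 - 1 / (8 * real q)) * sqrt ((1 - 4 * (1 / (8 * real q))) * (1 - 1 / real (q ^ 2))) - 2 / real q > 1 - \<delta>"
    unfolding eventually_sequentially using that by (meson le_cases)
  define \<eta> \<theta> where "\<eta> = 1 / (8 * real q)" and "\<theta> = q ^ 2"
  define \<rho> where "\<rho> = (1 - \<eta>) * sqrt ((1 - 4 * \<eta>) * (1 - 1 / real \<theta>))"
  have \<rho>: "\<rho> - 2 / real q > 1 - \<delta>" using q by (simp add: \<rho>_def \<eta>_def \<theta>_def)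
  have \<eta>: "0 < \<eta>" "\<eta> < 1/4" using q by (auto simp: \<eta>_def field_simps)
  have \<theta>: "\<theta> \<ge> 2" using q(1) power_increasing[of 1 2 q] by (simp add: \<theta>_def)
  show ?thesis
    using frequently_block_large[OF \<eta> \<theta>] neg.eventually_S_le[OF zero_less_one]
  proof eventually_elim
    case (elim x)
    have top: "filterlim (\<lambda>k. \<theta> ^ k) at_top sequentially"
      using \<theta> by (intro filterlim_at_top_mono[OF filterlim_ident] always_eventually allI) (use power_gt_expt[of \<theta>] in \<open>auto intro: less_imp_le\<close>)
    have ev: "\<forall>\<^sub>F k in sequentially. - S (\<theta> ^ k) x \<le> 2 * lil_scale s (\<theta> ^ k) \<and> 3 \<le> \<theta> ^ k"
      using eventually_compose_filterlim[OF elim(2) top] eventually_compose_filterlim[OF eventually_ge_at_top[of 3] top]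
      by eventually_elim (simp add: neg_S)
    have imp: "(1 - \<delta>) * lil_scale s (\<theta> ^ Suc k) \<le> S (\<theta> ^ Suc k) x"
      if k: "S (\<theta> ^ Suc k) x - S (\<theta> ^ k) x \<ge> \<rho> * lil_scale s (\<theta> ^ Suc k) \<and>
         (- S (\<theta> ^ k) x \<le> 2 * lil_scale s (\<theta> ^ k) \<and> 3 \<le> \<theta> ^ k)" for k
    proof -
      have le: "\<theta> ^ k \<le> \<theta> ^ Suc k" using \<theta> by simp
      have ge3: "3 \<le> \<theta> ^ k" "3 \<le> \<theta> ^ Suc k" using k order_trans[OF _ le] by auto
      have "real q * lil_scale s (\<theta> ^ k) = sqrt (2 * real (\<theta> ^ Suc k) * s * ln (ln (real (\<theta> ^ k))))"
      proof -
        have "real q = sqrt (real \<theta>)" by (simp add: \<theta>_def)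
        then show ?thesis unfolding lil_scale_def by (simp add: real_sqrt_mult[symmetric] mult_ac)
      qed
      also have "\<dots> \<le> lil_scale s (\<theta> ^ Suc k)" unfolding lil_scale_def
        using ge3 le s_pos by (intro real_sqrt_le_mono mult_left_mono ln_ln_mono) (auto simp del: power_Suc)
      finally have "2 * lil_scale s (\<theta> ^ k) \<le> 2 / real q * lil_scale s (\<theta> ^ Suc k)"
        using q(1) by (simp add: field_simps)
      then have "S (\<theta> ^ Suc k) x \<ge> (\<rho> - 2 / real q) * lil_scale s (\<theta> ^ Suc k)"
        using k by (simp add: algebra_simps)
      moreover have "lil_scale s (\<theta> ^ Suc k) \<ge> 0" unfolding lil_scale_def
        using ge3 s_pos by (intro real_sqrt_ge_zero mult_nonneg_nonneg ln_ln_nonneg) (auto simp del: power_Suc)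
      ultimately show ?thesis
        using \<rho> by (meson less_imp_le mult_right_mono order_trans)
    qed
    have "\<exists>\<^sub>F k in sequentially. S (\<theta> ^ Suc k) x \<ge> (1 - \<delta>) * lil_scale s (\<theta> ^ Suc k)"
      by (rule frequently_elim1[OF frequently_eventually_conj[OF elim(1)[folded \<rho>_def] ev]]) (rule imp, blast)
    then show ?case
      using eventually_compose_filterlim[OF _ filterlim_compose[OF top filterlim_Suc]]
      unfolding frequently_def by blast
  qed
qed

text \<open>Only the countably many margins \<open>1 / Suc j\<close> are used, so the exceptional
  sets unite to a null set.\<close>

lemma law_of_iterated_logarithm:
  "AE x in M. limsup (\<lambda>n. ereal (S n x / sqrt (2 * real n * s * ln (ln (real n))))) = 1"
proof -
  have "AE x in M. \<forall>j. \<forall>\<^sub>F n in sequentially. S n x \<le> (1 + 1 / real (Suc j)) * lil_scale s n"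
    unfolding AE_all_countable by (intro allI eventually_S_le) simp
  moreover have "AE x in M. \<forall>j. \<exists>\<^sub>F n in sequentially. S n x \<ge> (1 - 1 / real (Suc j)) * lil_scale s n"
    unfolding AE_all_countable by (intro allI frequently_S_ge) simp
  ultimately show ?thesis
  proof eventually_elim
    case (elim x)
    have pos: "\<forall>\<^sub>F n in sequentially. lil_scale s n > 0"
      unfolding lil_scale_def using s_pos by real_asymp
    let ?f = "\<lambda>n. ereal (S n x / lil_scale s n)"
    have "limsup ?f \<le> ereal (1 + 1 / real (Suc j))" for j
    proof (rule Limsup_bounded)
      show "\<forall>\<^sub>F n in sequentially. ?f n \<le> ereal (1 + 1 / real (Suc j))"
        using elim(1)[rule_format, of j] pos
        by eventually_elim (simp add: pos_divide_le_eq del: of_nat_Suc)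
    qed
    moreover have "(\<lambda>j. ereal (1 + 1 / real (Suc j))) \<longlonglongrightarrow> ereal 1"
      by (intro tendsto_ereal) real_asymp
    ultimately have le: "limsup ?f \<le> ereal 1"
      using LIMSEQ_le_const[of "\<lambda>j. ereal (1 + 1 / real (Suc j))" "ereal 1" "limsup ?f"] by blast
    have "limsup ?f \<ge> ereal (1 - 1 / real (Suc j))" for j
    proof (rule ccontr)
      assume "\<not> limsup ?f \<ge> ereal (1 - 1 / real (Suc j))"
      then have "\<forall>\<^sub>F n in sequentially. ?f n < ereal (1 - 1 / real (Suc j))"
        by (intro Limsup_lessD) auto
      with pos have "\<forall>\<^sub>F n in sequentially. \<not> (S n x \<ge> (1 - 1 / real (Suc j)) * lil_scale s n)"
        by eventually_elim (simp add: pos_divide_less_eq del: of_nat_Suc)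
      then show False using elim(2)[rule_format, of j] by (simp add: frequently_def)
    qed
    moreover have "(\<lambda>j. ereal (1 - 1 / real (Suc j))) \<longlonglongrightarrow> ereal 1"
      by (intro tendsto_ereal) real_asymp
    ultimately have "limsup ?f \<ge> ereal 1"
      using LIMSEQ_le_const2[of "\<lambda>j. ereal (1 - 1 / real (Suc j))" "ereal 1" "limsup ?f"] by blast
    with le have "limsup ?f = 1" by (simp add: one_ereal_def)
    then show ?case by (simp add: lil_scale_def)
  qed
qed

end

section \<open>Projective space\<close>

abbreviation line_of :: "'d::finite cproj \<Rightarrow> complex ^ 'd ^ 'd" where
  "line_of p \<equiv> line_projector (unit_rep p)"

text \<open>\<open>line_of\<close> does not see the phase of the chosen representative and embeds
  projective space into matrices; continuity and measurability are reduced to it.\<close>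

lemma dist_cproj_line_of: "dist p q = norm (line_of p - line_of q) / sqrt 2"
proof -
  have "1 - (cmod (hinner (unit_rep p) (unit_rep q)))\<^sup>2 = (norm (line_of p - line_of q))\<^sup>2 / 2"
    using norm_line_projector_diff[OF unit_rep(1)[of p] unit_rep(1)[of q]] by simp
  then show ?thesis by (simp only: dist_cproj_def real_sqrt_divide real_sqrt_abs abs_norm_cancel)
qed

lemma continuous_on_line_of: "continuous_on S line_of"
  unfolding continuous_on_iff
proof (intro ballI allI impI)
  fix p :: "'a cproj" and e :: real assume "e > 0"
  then show "\<exists>d>0. \<forall>q\<in>S. dist q p < d \<longrightarrow> dist (line_of q) (line_of p) < e"
    by (intro exI[of _ "e / sqrt 2"]) (auto simp: dist_cproj_line_of dist_norm divide_less_cancel)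
qed

lemma line_projector_smult: "line_projector (c *s x) = (cmod c)\<^sup>2 *\<^sub>R line_projector x"
proof -
  have "c * x $ i * cnj (c * x $ j) = (cmod c)\<^sup>2 *\<^sub>R (x $ i * cnj (x $ j))" for i j
    unfolding scaleR_conv_of_real complex_norm_square by (simp add: mult_ac)
  then show ?thesis by (simp add: vec_eq_iff line_projector_def)
qed

lemma unit_rep_proj_class:
  assumes "x \<noteq> 0"
  obtains c where "x = c *s unit_rep (proj_class x)" "cmod c = norm x"
proof -
  have "unit_rep (proj_class x) \<noteq> 0" using unit_rep(1)[of "proj_class x"] by auto
  then obtain c where c: "x = c *s unit_rep (proj_class x)"
    using proj_class_eq_iff[of "unit_rep (proj_class x)" x] assms unit_rep(2) by metis
  moreover have "cmod c = norm x"
    using arg_cong[OF c, of norm] by (simp add: norm_smult_vec unit_rep)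
  ultimately show ?thesis using that by blast
qed

lemma line_of_proj_class: "x \<noteq> 0 \<Longrightarrow> line_of (proj_class x) = (1 / (norm x)\<^sup>2) *\<^sub>R line_projector x"
proof -
  assume x: "x \<noteq> 0"
  obtain c where "x = c *s unit_rep (proj_class x)" "cmod c = norm x" using unit_rep_proj_class[OF x] .
  then have "line_projector x = (norm x)\<^sup>2 *\<^sub>R line_of (proj_class x)"
    using line_projector_smult[of c "unit_rep (proj_class x)"] by simp
  then show ?thesis using x by simp
qed

text \<open>For arbitrary nonzero vectors: up to the squared norms, the squared distance is the Gram
  determinant of \<open>x\<close> and \<open>y\<close>. In this form distances between lines are
  later summed over the columns of a matrix.\<close>

lemma dist_proj_class:
  assumes "x \<noteq> 0" "y \<noteq> 0"
  shows "(dist (proj_class x) (proj_class y))\<^sup>2 = 1 - (cmod (hinner x y))\<^sup>2 / ((norm x)\<^sup>2 * (norm y)\<^sup>2)"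
proof -
  define u w where "u = unit_rep (proj_class x)" and "w = unit_rep (proj_class y)"
  obtain a where a: "x = a *s u" "cmod a = norm x" using unit_rep_proj_class[OF assms(1)] unfolding u_def .
  obtain b where b: "y = b *s w" "cmod b = norm y" using unit_rep_proj_class[OF assms(2)] unfolding w_def .
  have "hinner x y = cnj a * b * hinner u w"
    unfolding a(1) b(1) by (simp add: hinner_def sum_distrib_left mult_ac)
  then have "cmod (hinner x y) = norm x * norm y * cmod (hinner u w)"
    by (simp add: norm_mult a(2) b(2))
  then have "(cmod (hinner x y))\<^sup>2 / ((norm x)\<^sup>2 * (norm y)\<^sup>2) = (cmod (hinner u w))\<^sup>2"
    using assms by (simp add: power_mult_distrib)
  moreover have "(dist (proj_class x) (proj_class y))\<^sup>2 = 1 - (cmod (hinner u w))\<^sup>2"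
  proof -
    have "2 * (1 - (cmod (hinner u w))\<^sup>2) \<ge> 0"
      using norm_line_projector_diff[of u w] unit_rep(1) by (metis u_def w_def zero_le_power2)
    then show ?thesis unfolding dist_cproj_def u_def w_def by simp
  qed
  ultimately show ?thesis by simp
qed

lemma continuous_on_line_projector: "continuous_on S line_projector"
  unfolding line_projector_def by (intro continuous_intros)

lemma continuous_on_proj_class: "continuous_on (- {0}) proj_class"
proof -
  have c: "continuous_on (- {0}) (\<lambda>x :: complex ^ 'a. (1 / (norm x)\<^sup>2) *\<^sub>R line_projector x)"
    by (intro continuous_intros continuous_on_line_projector) auto
  show ?thesis unfolding continuous_on_iff
  proof (intro ballI allI impI)
    fix x :: "complex ^ 'a" and e :: real assume x: "x \<in> - {0}" and "e > 0"
    then have "e * sqrt 2 > 0" by simp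
    then obtain d where d: "d > 0" "\<And>y. y \<in> - {0} \<Longrightarrow> dist y x < d \<Longrightarrow>
       dist ((1 / (norm y)\<^sup>2) *\<^sub>R line_projector y) ((1 / (norm x)\<^sup>2) *\<^sub>R line_projector x) < e * sqrt 2"
      using c x unfolding continuous_on_iff by meson
    have "dist (proj_class y) (proj_class x) < e" if "y \<in> - {0}" "dist y x < d" for y
      using d(2)[OF that] that x
      by (simp add: dist_cproj_line_of line_of_proj_class dist_norm pos_divide_less_eq)
    then show "\<exists>d>0. \<forall>x'\<in>- {0}. dist x' x < d \<longrightarrow> dist (proj_class x') (proj_class x) < e"
      using d(1) by blast
  qed
qed

lemma compact_cproj: "compact (UNIV :: 'd::finite cproj set)"
proof -
  have "compact (proj_class ` sphere (0 :: complex ^ 'd) 1)"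
    by (intro compact_continuous_image continuous_on_subset[OF continuous_on_proj_class]) auto
  moreover have "p \<in> proj_class ` sphere (0 :: complex ^ 'd) 1" for p
    using unit_rep[of p] by (intro image_eqI[of _ _ "unit_rep p"]) auto
  then have "proj_class ` sphere (0 :: complex ^ 'd) 1 = UNIV" by auto
  ultimately show ?thesis by simp
qed

text \<open>Every open set of lines is the preimage under \<open>line_of\<close> of an open set of
  matrices, since the two metrics differ by the factor sqrt 2.\<close>

lemma borel_measurable_cprojI:
  assumes "(\<lambda>x. line_of (f x)) \<in> borel_measurable M"
  shows "f \<in> borel_measurable M"
proof (rule borel_measurableI)
  fix U :: "'b cproj set" assume U: "open U"
  have "\<forall>p\<in>U. \<exists>e>0. ball p e \<subseteq> U" using U by (simp add: open_contains_ball)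
  then obtain e where e: "\<And>p. p \<in> U \<Longrightarrow> e p > 0" "\<And>p. p \<in> U \<Longrightarrow> ball p (e p) \<subseteq> U" by metis
  define V where "V = (\<Union>p\<in>U. ball (line_of p) (e p * sqrt 2))"
  have V: "q \<in> U \<longleftrightarrow> line_of q \<in> V" for q
  proof
    assume "q \<in> U"
    then show "line_of q \<in> V" using e(1)[of q] by (auto simp: V_def intro!: bexI[of _ q])
  next
    assume "line_of q \<in> V"
    then obtain p where p: "p \<in> U" "dist (line_of p) (line_of q) < e p * sqrt 2" by (auto simp: V_def)
    then have "dist p q < e p" by (simp add: dist_cproj_line_of dist_norm pos_divide_less_eq)
    then show "q \<in> U" using e(2)[OF p(1)] by auto
  qed
  have "open V" unfolding V_def by auto
  then have "(\<lambda>x. line_of (f x)) -` V \<inter> space M \<in> sets M"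
    using assms by (intro measurable_sets) auto
  moreover have "(\<lambda>x. line_of (f x)) -` V \<inter> space M = f -` U \<inter> space M" using V by auto
  ultimately show "f -` U \<inter> space M \<in> sets M" by simp
qed

lemma line_of_measurable [measurable]: "line_of \<in> borel_measurable borel"
  by (intro borel_measurable_continuous_onI continuous_on_line_of)

lemma proj_class_measurable [measurable]: "proj_class \<in> borel_measurable borel"
proof (rule borel_measurable_cprojI)
  have [measurable]: "line_projector \<in> borel_measurable (borel :: (complex ^ 'a) measure)"
    by (intro borel_measurable_continuous_onI continuous_on_line_projector)
  have "(\<lambda>x. line_of (proj_class x)) =
     (\<lambda>x :: complex ^ 'a. if x = 0 then line_of (proj_class 0) else (1 / (norm x)\<^sup>2) *\<^sub>R line_projector x)"
    by (auto simp: line_of_proj_class)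
  also have "\<dots> \<in> borel_measurable borel" by measurable
  finally show "(\<lambda>x. line_of (proj_class x)) \<in> borel_measurable (borel :: (complex ^ 'a) measure)" .
qed

section \<open>Measurability of the action of matrices on lines\<close>

lemma matrix_mult_measurable [measurable (raw)]:
  assumes "f \<in> borel_measurable M" "g \<in> borel_measurable M"
  shows "(\<lambda>x. (f x :: complex ^ 'n::finite ^ 'm::finite) ** (g x :: complex ^ 'k::finite ^ 'n)) \<in> borel_measurable M"
  by (rule borel_measurable_continuous_Pair[OF assms]) (auto simp: matrix_matrix_mult_def intro!: continuous_intros)

lemma matrix_vector_mult_measurable [measurable (raw)]:
  assumes "f \<in> borel_measurable M" "g \<in> borel_measurable M"
  shows "(\<lambda>x. (f x :: complex ^ 'n::finite ^ 'm::finite) *v (g x)) \<in> borel_measurable M"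
  by (rule borel_measurable_continuous_Pair[OF assms]) (auto simp: matrix_vector_mult_def intro!: continuous_intros)

lemma adj_measurable [measurable (raw)]:
  assumes "f \<in> borel_measurable M"
  shows "(\<lambda>x. adj (f x)) \<in> borel_measurable M"
proof -
  have "continuous_on UNIV adj" by (auto simp: adj_def intro!: continuous_intros)
  from borel_measurable_continuous_on[OF this assms] show ?thesis .
qed

lemma vec_nth_measurable [measurable (raw)]:
  fixes f :: "_ \<Rightarrow> 'a :: euclidean_space ^ 'n::finite"
  assumes "f \<in> borel_measurable M"
  shows "(\<lambda>x. f x $ i) \<in> borel_measurable M"
proof -
  have "continuous_on UNIV (\<lambda>x :: 'a ^ 'n. x $ i)" by (intro continuous_intros)
  from borel_measurable_continuous_on[OF this assms] show ?thesis .
qed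

lemma line_projector_mult: "line_projector (v *v x) = v ** line_projector x ** adj v"
proof -
  have "(v *v x) $ i * cnj ((v *v x) $ j) = (v ** line_projector x ** adj v) $ i $ j" for i j
    by (simp add: matrix_vector_mult_def matrix_matrix_mult_def line_projector_def adj_def
        cnj_sum sum_product sum_distrib_left sum_distrib_right mult_ac)
  then show ?thesis by (simp add: vec_eq_iff line_projector_def)
qed

lemma norm_sq_line_projector: "(norm x)\<^sup>2 = Re (\<Sum>i\<in>UNIV. line_projector x $ i $ i)"
proof -
  have "complex_of_real ((norm x)\<^sup>2) = (\<Sum>i\<in>UNIV. line_projector x $ i $ i)"
    using hinner_self[of x] by (simp add: hinner_def line_projector_def mult.commute)
  then show ?thesis by (metis Re_complex_of_real)
qed

text \<open>\<open>unit_rep\<close> comes from a choice and cannot be assumed measurable, so the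
  norm is rewritten as a trace that involves the line through \<open>line_of\<close> alone.\<close>

lemma norm_act_measurable [measurable (raw)]:
  assumes [measurable]: "(f :: _ \<Rightarrow> complex ^ 'd::finite ^ 'd) \<in> borel_measurable M" "h \<in> borel_measurable M"
  shows "(\<lambda>x. norm (f x *v unit_rep (h x))) \<in> borel_measurable M"
proof -
  have "(\<lambda>x. norm (f x *v unit_rep (h x))) =
     (\<lambda>x. sqrt (Re (\<Sum>i\<in>UNIV. (f x ** line_of (h x) ** adj (f x)) $ i $ i)))"
    unfolding line_projector_mult[symmetric] norm_sq_line_projector[symmetric] by simp
  also have "\<dots> \<in> borel_measurable M" by measurable
  finally show ?thesis .
qed

lemma proj_act_measurable [measurable (raw)]:
  assumes [measurable]: "(f :: _ \<Rightarrow> complex ^ 'd::finite ^ 'd) \<in> borel_measurable M" "h \<in> borel_measurable M"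
  shows "(\<lambda>x. proj_act (f x) (h x)) \<in> borel_measurable M"
proof (rule borel_measurable_cprojI)
  have "(\<lambda>x. line_of (proj_act (f x) (h x))) =
    (\<lambda>x. if norm (f x *v unit_rep (h x)) = 0 then line_of (proj_class 0)
         else (1 / (norm (f x *v unit_rep (h x)))\<^sup>2) *\<^sub>R (f x ** line_of (h x) ** adj (f x)))"
    by (auto simp: fun_eq_iff proj_act_def line_of_proj_class line_projector_mult)
  also have "\<dots> \<in> borel_measurable M" by measurable
  finally show "(\<lambda>x. line_of (proj_act (f x) (h x))) \<in> borel_measurable M" .
qed

lemma matrix_vector_mult_smult: "v *v (c *s x) = c *s (v *v (x :: complex ^ 'd))"
  by (simp add: vec_eq_iff matrix_vector_mult_def sum_distrib_left mult_ac)

lemma proj_class_smult: "c \<noteq> 0 \<Longrightarrow> proj_class (c *s x) = proj_class x"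
proof (cases "x = 0")
  case False
  assume c: "c \<noteq> 0"
  then have "c *s x \<noteq> 0" using False by auto
  then show ?thesis using proj_class_eq_iff[OF False] by (metis)
qed simp

text \<open>Action and weight can be evaluated on any nonzero vector of the line, so that iterating
  the kernel becomes multiplying matrices.\<close>

lemma proj_act_proj_class:
  assumes "x \<noteq> 0"
  shows "proj_act v (proj_class x) = proj_class (v *v x)"
    and "norm (v *v unit_rep (proj_class x)) = norm (v *v x) / norm x"
proof -
  obtain c where c: "x = c *s unit_rep (proj_class x)" "cmod c = norm x"
    using unit_rep_proj_class[OF assms] .
  have c0: "c \<noteq> 0" using c assms by auto
  have v: "v *v x = c *s (v *v unit_rep (proj_class x))"
    using arg_cong[OF c(1), of "\<lambda>y. v *v y"] by (simp only: matrix_vector_mult_smult)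
  show "proj_act v (proj_class x) = proj_class (v *v x)"
    unfolding proj_act_def v by (rule proj_class_smult[OF c0, symmetric])
  show "norm (v *v unit_rep (proj_class x)) = norm (v *v x) / norm x"
    using assms unfolding v norm_smult_vec c(2) by simp
qed

section \<open>The kernel and averages of matrices\<close>

lemma hinner_add_right: "hinner x (y + z) = hinner x y + hinner x z"
  by (simp add: hinner_def distrib_left sum.distrib)

lemma hinner_smult_right: "hinner x (c *s y) = c * hinner x y"
  by (simp add: hinner_def sum_distrib_left mult_ac)

lemma hinner_zero [simp]: "hinner x 0 = 0" "hinner 0 x = 0"
  by (simp_all add: hinner_def)

lemma hinner_adj: "hinner (A *v x) y = hinner x (adj A *v y)"
  by (simp add: hinner_def adj_def matrix_vector_mult_def cnj_sum sum_distrib_left sum_distrib_right mult_ac)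
     (rule sum.swap)

lemma hinner_cauchy_schwarz: "cmod (hinner x y) \<le> norm x * norm y"
proof (cases "x = 0 \<or> y = 0")
  case False
  then have "(cmod (hinner x y))\<^sup>2 / ((norm x)\<^sup>2 * (norm y)\<^sup>2) \<le> 1"
    using dist_proj_class[of x y] zero_le_power2[of "dist (proj_class x) (proj_class y)"] by auto
  then have "(cmod (hinner x y))\<^sup>2 \<le> (norm x * norm y)\<^sup>2"
    using False by (simp add: divide_le_eq power_mult_distrib)
  then show ?thesis by (rule power2_le_imp_le) simp
qed auto

lemma norm_sq_rows: "(norm (A :: complex ^ 'n::finite ^ 'm::finite))\<^sup>2 = (\<Sum>i\<in>UNIV. (norm (A $ i))\<^sup>2)"
  by (simp add: norm_vec_def[of A] L2_set_def sum_nonneg)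

lemma norm_sq_vec: "(norm (x :: complex ^ 'n::finite))\<^sup>2 = (\<Sum>i\<in>UNIV. (cmod (x $ i))\<^sup>2)"
  by (simp add: norm_vec_def L2_set_def sum_nonneg)

lemma norm_sq_columns:
  "(norm (A :: complex ^ 'd::finite ^ 'd))\<^sup>2 = (\<Sum>j\<in>UNIV. (norm (column j A))\<^sup>2)"
  unfolding norm_matrix_sq norm_sq_vec column_def by (subst sum.swap) simp

lemma column_mult: "column j (A ** B) = A *v column j B"
  by (simp add: vec_eq_iff column_def matrix_matrix_mult_def matrix_vector_mult_def)

lemma norm_matrix_vector_le: "norm (A *v x) \<le> norm A * norm (x :: complex ^ 'd::finite)"
  for A :: "complex ^ 'd ^ 'd"
proof -
  have "(cmod ((A *v x) $ i))\<^sup>2 \<le> (norm (A $ i))\<^sup>2 * (norm x)\<^sup>2" for i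
  proof -
    have "(A *v x) $ i = hinner (\<chi> j. cnj (A $ i $ j)) x"
      by (simp add: hinner_def matrix_vector_mult_def)
    moreover have "norm (\<chi> j. cnj (A $ i $ j)) = norm (A $ i)" by (simp add: norm_vec_def)
    ultimately have "cmod ((A *v x) $ i) \<le> norm (A $ i) * norm x"
      using hinner_cauchy_schwarz by metis
    then show ?thesis unfolding power_mult_distrib[symmetric] by (intro power_mono) auto
  qed
  then have "(norm (A *v x))\<^sup>2 \<le> (norm A * norm x)\<^sup>2"
    unfolding norm_sq_vec[of "A *v x"] power_mult_distrib norm_sq_rows[of A] sum_distrib_right
    by (intro sum_mono)
  then show ?thesis by (rule power2_le_imp_le) simp
qed

lemma norm_matrix_mult_le: "norm (A ** B) \<le> norm A * norm B"
  for A B :: "complex ^ 'd::finite ^ 'd"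
proof -
  have "(norm (A ** B))\<^sup>2 = (\<Sum>j\<in>UNIV. (norm (A *v column j B))\<^sup>2)"
    unfolding norm_sq_columns column_mult ..
  also have "\<dots> \<le> (\<Sum>j\<in>UNIV. (norm A)\<^sup>2 * (norm (column j B))\<^sup>2)"
    by (intro sum_mono) (simp add: power_mult_distrib[symmetric] power_mono norm_matrix_vector_le)
  also have "\<dots> = (norm A * norm B)\<^sup>2"
    by (simp add: sum_distrib_left[symmetric] norm_sq_columns[of B] power_mult_distrib)
  finally show ?thesis by (rule power2_le_imp_le) simp
qed

lemma norm_adj [simp]: "norm (adj A) = norm (A :: complex ^ 'd::finite ^ 'd)"
proof -
  have "(norm (adj A))\<^sup>2 = (norm A)\<^sup>2"
    unfolding norm_matrix_sq adj_def by (subst sum.swap) simp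
  then show ?thesis by (simp add: power2_eq_iff_nonneg)
qed

definition bounded_borel :: "('d::finite cproj \<Rightarrow> real) \<Rightarrow> bool" where
  "bounded_borel f \<longleftrightarrow> f \<in> borel_measurable borel \<and> (\<exists>K. \<forall>p. \<bar>f p\<bar> \<le> K)"

lemma bounded_borelD [measurable_dest]: "bounded_borel f \<Longrightarrow> f \<in> borel_measurable borel"
  by (simp add: bounded_borel_def)

lemma bounded_borelE:
  assumes "bounded_borel f"
  obtains K where "K \<ge> 0" "\<And>p. \<bar>f p\<bar> \<le> K"
proof -
  obtain K where "\<And>p. \<bar>f p\<bar> \<le> K" using assms by (auto simp: bounded_borel_def)
  moreover from this[of undefined] have "K \<ge> 0" by linarith
  ultimately show ?thesis using that by blast
qed

lemma bounded_borel_const: "bounded_borel (\<lambda>_. c)"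
  by (auto simp: bounded_borel_def)

lemma bounded_borel_add: "bounded_borel f \<Longrightarrow> bounded_borel h \<Longrightarrow> bounded_borel (\<lambda>p. f p + h p)"
proof -
  assume f: "bounded_borel f" and h: "bounded_borel h"
  obtain K L where "\<And>p. \<bar>f p\<bar> \<le> K" "\<And>p. \<bar>h p\<bar> \<le> L" using f h by (auto simp: bounded_borel_def)
  then have "\<bar>f p + h p\<bar> \<le> K + L" for p by (meson abs_triangle_ineq add_mono order_trans)
  then show ?thesis using f h by (auto simp: bounded_borel_def)
qed

lemma bounded_borel_mult: "bounded_borel f \<Longrightarrow> bounded_borel h \<Longrightarrow> bounded_borel (\<lambda>p. f p * h p)"
proof -
  assume f: "bounded_borel f" and h: "bounded_borel h"
  obtain K L where "K \<ge> 0" "\<And>p. \<bar>f p\<bar> \<le> K" "\<And>p. \<bar>h p\<bar> \<le> L" 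
    using bounded_borelE[OF f] bounded_borelE[OF h] by metis
  then have "\<bar>f p * h p\<bar> \<le> K * L" for p by (simp add: abs_mult mult_mono)
  then show ?thesis using f h by (auto simp: bounded_borel_def)
qed

lemma bounded_borel_cmult: "bounded_borel f \<Longrightarrow> bounded_borel (\<lambda>p. c * f p)"
  by (rule bounded_borel_mult[OF bounded_borel_const])

lemma bounded_borel_diff: "bounded_borel f \<Longrightarrow> bounded_borel h \<Longrightarrow> bounded_borel (\<lambda>p. f p - h p)"
  using bounded_borel_add[OF _ bounded_borel_cmult[of h "-1"], of f] by simp

lemma bounded_borel_sum: "(\<And>i. i \<in> I \<Longrightarrow> bounded_borel (f i)) \<Longrightarrow> bounded_borel (\<lambda>p. \<Sum>i\<in>I. f i p)"
  by (induction I rule: infinite_finite_induct) (auto intro: bounded_borel_add bounded_borel_const)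

lemma bounded_borel_continuous: "continuous_on UNIV f \<Longrightarrow> bounded_borel f"
proof -
  assume f: "continuous_on UNIV f"
  then have "compact (range f)" by (intro compact_continuous_image compact_cproj)
  then have "bounded (range f)" by (rule compact_imp_bounded)
  then show ?thesis unfolding bounded_borel_def bounded_iff
    using borel_measurable_continuous_onI[OF f] by auto
qed

text \<open>Sigma-finiteness serves Fubini and the finite products; the measure of the theorem
  enters this locale through \<open>nonzero_part\<close>. The condition \<open>unital\<close> is
  what makes the kernel a Markov kernel.\<close>

locale kraus_measure = sigma_finite_measure \<mu> for \<mu> :: "(complex ^ 'd::finite ^ 'd) measure" +
  assumes sets_mu [measurable_cong]: "sets \<mu> = sets borel"
    and unital: "has_bochner_integral \<mu> (\<lambda>v. adj v ** v) (mat 1)"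
begin

lemma space_mu [simp]: "space \<mu> = UNIV"
  using sets_eq_imp_space_eq[OF sets_mu] by simp

lemma integral_hinner: "has_bochner_integral \<mu> (\<lambda>v. hinner (v *v x) (v *v y)) (hinner x y)"
proof -
  have "linear (\<lambda>A. hinner x (A *v y))"
    by (intro linearI) (simp_all add: hinner_def matrix_vector_mult_def algebra_simps sum.distrib
        scaleR_sum_right sum_distrib_left sum_distrib_right)
  then have "bounded_linear (\<lambda>A. hinner x (A *v y))" by (simp add: linear_conv_bounded_linear)
  from has_bochner_integral_bounded_linear[OF this unital] show ?thesis
    by (simp add: hinner_adj matrix_vector_mul_assoc)
qed

lemma integral_norm_sq: "has_bochner_integral \<mu> (\<lambda>v. (norm (v *v x))\<^sup>2) ((norm x)\<^sup>2)"
  using has_bochner_integral_bounded_linear[OF bounded_linear_Re integral_hinner[of x x]]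
  by (simp add: hinner_self)

lemma integral_norm_sq_matrix:
  fixes w :: "complex ^ 'd ^ 'd"
  shows "has_bochner_integral \<mu> (\<lambda>v. (norm (v ** w))\<^sup>2) ((norm w)\<^sup>2)"
  unfolding norm_sq_columns column_mult by (intro has_bochner_integral_sum integral_norm_sq)

lemma integrable_norm_sq: "integrable \<mu> (\<lambda>v. (norm v)\<^sup>2)"
  using integral_norm_sq_matrix[of "mat 1"] by (simp add: has_bochner_integral_iff)

text \<open>The law of the next matrix when the current line is \<open>p\<close>. Against it the
  weighted integrals of the kernel become plain integrals of bounded functions over a probability
  space.\<close>

definition transition :: "'d cproj \<Rightarrow> (complex ^ 'd ^ 'd) measure" where
  "transition p = density \<mu> (\<lambda>v. ennreal ((norm (v *v unit_rep p))\<^sup>2))"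

lemma sets_transition [measurable_cong, simp]: "sets (transition p) = sets borel"
  by (simp add: transition_def sets_mu)

lemma space_transition [simp]: "space (transition p) = UNIV"
  by (simp add: transition_def)

lemma prob_space_transition: "prob_space (transition p)"
proof
  have "emeasure (transition p) (space (transition p)) = (\<integral>\<^sup>+ v. ennreal ((norm (v *v unit_rep p))\<^sup>2) \<partial>\<mu>)"
    unfolding transition_def by (simp add: emeasure_density)
  also have "\<dots> = ennreal 1"
    using integral_norm_sq[of "unit_rep p"]
    by (subst nn_integral_eq_integral) (auto simp: has_bochner_integral_iff unit_rep)
  finally show "emeasure (transition p) (space (transition p)) = 1" by simp
qed

lemma kernel_op_eq:
  assumes [measurable]: "f \<in> borel_measurable borel"
  shows "kernel_op \<mu> f p = (\<integral>v. f (proj_act v p) \<partial>transition p)"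
  unfolding transition_def kernel_op_def by (subst integral_density) (simp_all add: mult.commute)

lemma integrable_transition:
  assumes "bounded_borel f"
  shows "integrable (transition p) (\<lambda>v. f (proj_act v p))"
proof -
  interpret prob_space "transition p" by (rule prob_space_transition)
  note [measurable] = bounded_borelD[OF assms]
  obtain K where "K \<ge> 0" "\<And>p. \<bar>f p\<bar> \<le> K" using bounded_borelE[OF assms] by blast
  then show ?thesis by (intro integrable_const_bound[of _ K]) auto
qed

lemma kernel_op_const [simp]: "kernel_op \<mu> (\<lambda>_. c) p = c"
proof -
  interpret prob_space "transition p" by (rule prob_space_transition)
  show ?thesis by (subst kernel_op_eq) (use prob_space in simp_all)
qed

lemma kernel_op_add:
  "bounded_borel f \<Longrightarrow> bounded_borel h \<Longrightarrow> kernel_op \<mu> (\<lambda>p. f p + h p) p = kernel_op \<mu> f p + kernel_op \<mu> h p"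
  by (simp add: kernel_op_eq bounded_borelD integrable_transition)

lemma kernel_op_cmult: "kernel_op \<mu> (\<lambda>p. c * f p) p = c * kernel_op \<mu> f p"
  by (simp add: kernel_op_def mult.assoc)

lemma kernel_op_diff:
  "bounded_borel f \<Longrightarrow> bounded_borel h \<Longrightarrow> kernel_op \<mu> (\<lambda>p. f p - h p) p = kernel_op \<mu> f p - kernel_op \<mu> h p"
  by (simp add: kernel_op_eq bounded_borelD integrable_transition)

lemma kernel_op_mono:
  "bounded_borel f \<Longrightarrow> bounded_borel h \<Longrightarrow> (\<And>p. f p \<le> h p) \<Longrightarrow> kernel_op \<mu> f p \<le> kernel_op \<mu> h p"
  by (simp add: kernel_op_eq bounded_borelD integrable_transition integral_mono)

lemma kernel_op_abs_le:
  assumes "bounded_borel f" "\<And>p. \<bar>f p\<bar> \<le> K"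
  shows "\<bar>kernel_op \<mu> f p\<bar> \<le> K"
proof -
  have "f p \<le> K" "- K \<le> f p" for p using assms(2)[of p] by auto
  then show ?thesis
    using kernel_op_mono[OF assms(1) bounded_borel_const[of K], of p]
      kernel_op_mono[OF bounded_borel_const[of "-K"] assms(1), of p]
    by simp
qed

lemma bounded_borel_kernel_op:
  assumes "bounded_borel f"
  shows "bounded_borel (kernel_op \<mu> f)"
proof -
  obtain K where "\<And>p. \<bar>f p\<bar> \<le> K" using bounded_borelE[OF assms] by metis
  moreover have "kernel_op \<mu> f \<in> borel_measurable borel"
    unfolding kernel_op_def using bounded_borelD[OF assms] by measurable
  ultimately show ?thesis unfolding bounded_borel_def using kernel_op_abs_le[OF assms] by blast
qed

abbreviation kernel_pow :: "nat \<Rightarrow> ('d cproj \<Rightarrow> real) \<Rightarrow> 'd cproj \<Rightarrow> real" where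
  "kernel_pow n \<equiv> kernel_op \<mu> ^^ n"

lemma bounded_borel_kernel_pow: "bounded_borel f \<Longrightarrow> bounded_borel (kernel_pow n f)"
  by (induction n) (auto intro: bounded_borel_kernel_op)

lemma kernel_pow_abs_le: "bounded_borel f \<Longrightarrow> (\<And>p. \<bar>f p\<bar> \<le> K) \<Longrightarrow> \<bar>kernel_pow n f p\<bar> \<le> K"
  by (induction n arbitrary: p) (auto intro!: kernel_op_abs_le bounded_borel_kernel_pow)

lemma kernel_pow_diff:
  "bounded_borel f \<Longrightarrow> bounded_borel h \<Longrightarrow> kernel_pow n (\<lambda>p. f p - h p) = (\<lambda>p. kernel_pow n f p - kernel_pow n h p)"
proof (induction n)
  case (Suc n)
  then show ?case by (auto simp: kernel_op_diff bounded_borel_kernel_pow)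
qed simp

end

section \<open>Quadratic forms and ergodicity\<close>

definition qform :: "complex ^ 'd ^ 'd \<Rightarrow> complex ^ 'd::finite \<Rightarrow> real" where
  "qform B x = Re (hinner x (B *v x))"

lemma qform_smult: "qform B (c *s x) = (cmod c)\<^sup>2 * qform B x"
proof -
  have "hinner (c *s x) (B *v (c *s x)) = (c * cnj c) * hinner x (B *v x)"
    by (simp add: hinner_def matrix_vector_mult_def sum_distrib_left mult_ac)
  then show ?thesis by (simp add: qform_def complex_norm_square[symmetric])
qed

lemma qform_zero [simp]: "qform B 0 = 0"
  by (simp add: qform_def)

lemma qform_parallelogram: "qform B (x + y) + qform B (x - y) = 2 * qform B x + 2 * qform B y"
  by (simp add: qform_def hinner_def matrix_vector_mult_def algebra_simps sum.distrib sum_subtractf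
      sum_distrib_left sum_distrib_right)

lemma continuous_on_qform: "continuous_on S (qform B)"
  unfolding qform_def hinner_def matrix_vector_mult_def by (auto intro!: continuous_intros)

lemma qform_unit_rep:
  assumes "x \<noteq> 0"
  shows "qform B (unit_rep (proj_class x)) * (norm x)\<^sup>2 = qform B x"
proof -
  obtain c where c: "x = c *s unit_rep (proj_class x)" "cmod c = norm x"
    by (rule unit_rep_proj_class[OF assms])
  show ?thesis using arg_cong[OF c(1), of "qform B"] by (simp add: qform_smult c(2))
qed

lemma qform_diff: "qform (A - B) x = qform A x - qform B x"
  by (simp add: qform_def hinner_def matrix_vector_mult_def algebra_simps sum_subtractf sum_distrib_left)

lemma qform_mat_1: "qform (mat 1) x = (norm x)\<^sup>2"
  by (simp add: qform_def hinner_self)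

lemma qform_scaleR: "qform (c *\<^sub>R B) x = c * qform B x"
proof -
  have "hinner x ((c *\<^sub>R B) *v x) = c *\<^sub>R hinner x (B *v x)"
    by (simp add: hinner_def matrix_vector_mult_def sum_distrib_left scaleR_sum_right)
  then show ?thesis by (simp add: qform_def)
qed

lemma abs_qform_le: "\<bar>qform B x\<bar> \<le> norm B * (norm x)\<^sup>2"
proof -
  have "\<bar>qform B x\<bar> \<le> cmod (hinner x (B *v x))" unfolding qform_def by (rule abs_Re_le_cmod)
  also have "\<dots> \<le> norm x * (norm B * norm x)"
    by (intro order_trans[OF hinner_cauchy_schwarz] mult_left_mono norm_matrix_vector_le) simp
  finally show ?thesis by (simp add: power2_eq_square mult_ac)
qed

lemma qform_sum: "qform (\<Sum>i\<in>I. A i) x = (\<Sum>i\<in>I. qform (A i) x)"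
proof -
  have "qform 0 x = 0" by (simp add: qform_def hinner_def matrix_vector_mult_def)
  moreover have "qform (A + B) x = qform A x + qform B x" for A B
    using qform_diff[of "A + B" B x] by simp
  ultimately show ?thesis by (induction I rule: infinite_finite_induct) auto
qed

text \<open>The set is the zero set of the nonnegative form of \<open>l Id - B\<close>. For two
  zeros the parallelogram law gives values at sum and difference that add up to 0, so both
  vanish.\<close>

lemma subspace_qform_max:
  assumes "\<And>x. qform B x \<le> l * (norm x)\<^sup>2"
  shows "vec.subspace {x. qform B x = l * (norm x)\<^sup>2}"
proof -
  define A where "A = l *\<^sub>R mat 1 - B"
  have A: "qform A x = l * (norm x)\<^sup>2 - qform B x" for x
    by (simp add: A_def qform_diff qform_scaleR qform_mat_1)
  have A0: "qform A x \<ge> 0" for x using assms[of x] by (simp add: A)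
  have eq: "{x. qform B x = l * (norm x)\<^sup>2} = {x. qform A x = 0}" by (auto simp: A)
  show ?thesis unfolding eq
  proof (rule vec.subspaceI)
    fix x y assume "x \<in> {x. qform A x = 0}" "y \<in> {x. qform A x = 0}"
    then show "x + y \<in> {x. qform A x = 0}"
      using qform_parallelogram[of A x y] A0[of "x + y"] A0[of "x - y"] by simp
  qed (auto simp: qform_smult)
qed

text \<open>In finite dimension a candidate of least dimension is minimal for inclusion.\<close>

lemma invariant_subspace_minimal:
  assumes "invariant_subspace \<mu> F"
  obtains E where "invariant_subspace \<mu> E" "E \<subseteq> F" "\<And>G. invariant_subspace \<mu> G \<Longrightarrow> G \<subseteq> E \<Longrightarrow> G = E"
proof -
  define P where "P E \<longleftrightarrow> invariant_subspace \<mu> E \<and> E \<subseteq> F" for E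
  have "P F" using assms by (simp add: P_def)
  define E where "E = arg_min vec.dim P"
  have E: "P E" "\<And>G. P G \<Longrightarrow> vec.dim E \<le> vec.dim G"
    using arg_min_nat_lemma[of P F vec.dim] \<open>P F\<close> by (auto simp: E_def)
  have "G = E" if G: "invariant_subspace \<mu> G" "G \<subseteq> E" for G
  proof -
    have "P G" using G E(1) by (auto simp: P_def)
    then have "vec.dim E \<le> vec.dim G" by (rule E(2))
    moreover have "vec.subspace G" "vec.subspace E" using G E(1) by (auto simp: P_def invariant_subspace_def)
    ultimately show ?thesis using G(2) by (intro vec.subspace_dim_equal) auto
  qed
  then show ?thesis using that E(1) by (auto simp: P_def)
qed

text \<open>Each of the two contains a minimal invariant subspace, and there is only one of
  those.\<close>

lemma ergodic_measure_unique:
  assumes "ergodic_measure \<mu>" "invariant_subspace \<mu> F" "invariant_subspace \<mu> G"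
  shows "F \<inter> G \<noteq> {0}"
proof
  assume 0: "F \<inter> G = {0}"
  obtain E where E: "invariant_subspace \<mu> E" "E \<subseteq> F" "\<And>G. invariant_subspace \<mu> G \<Longrightarrow> G \<subseteq> E \<Longrightarrow> G = E"
    using invariant_subspace_minimal[OF assms(2)] by blast
  obtain E' where E': "invariant_subspace \<mu> E'" "E' \<subseteq> G" "\<And>G. invariant_subspace \<mu> G \<Longrightarrow> G \<subseteq> E' \<Longrightarrow> G = E'"
    using invariant_subspace_minimal[OF assms(3)] by blast
  have "E = E'" using assms(1) E E' unfolding ergodic_measure_def by (elim ex1E) metis
  then have "E \<subseteq> {0}" using 0 E(2) E'(2) by auto
  moreover have "0 \<in> E" using E(1) vec.subspace_0 by (auto simp: invariant_subspace_def)
  ultimately show False using E(1) by (auto simp: invariant_subspace_def)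
qed

text \<open>Upgrades an almost sure identity that is continuous in \<open>v\<close> to all
  \<open>v\<close> in the support, where invariance of subspaces is tested.\<close>

lemma AE_closed_imp_msupport:
  fixes M :: "'a::topological_space measure"
  assumes "AE x in M. x \<in> C" "closed C" "sets M = sets borel"
  shows "msupport M \<subseteq> C"
proof
  fix x assume x: "x \<in> msupport M"
  show "x \<in> C"
  proof (rule ccontr)
    assume "x \<notin> C"
    then have "emeasure M (- C) > 0" using x assms(2) by (auto simp: msupport_def)
    moreover have "- C \<in> sets M" using assms(2,3) by auto
    then have "(AE x in M. x \<in> C) \<longleftrightarrow> emeasure M (- C) = 0"
      by (rule AE_iff_measurable) (use sets_eq_imp_space_eq[OF assms(3)] in auto)
    then have "emeasure M (- C) = 0" using assms(1) by simp
    ultimately show False by simp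
  qed
qed

section \<open>The dual channel and its fixed points\<close>

context kraus_measure begin

text \<open>The quantum channel of \<open>\<mu>\<close> in the Heisenberg picture; on quadratic
  forms evaluated at unit vectors it represents \<open>kernel_op\<close> by a linear map in finite
  dimension.\<close>

definition dual_channel :: "complex ^ 'd ^ 'd \<Rightarrow> complex ^ 'd ^ 'd" where
  "dual_channel B = (\<integral>v. adj v ** B ** v \<partial>\<mu>)"

lemma integrable_dual_channel: "integrable \<mu> (\<lambda>v. adj v ** B ** v)"
proof (rule Bochner_Integration.integrable_bound)
  show "integrable \<mu> (\<lambda>v. norm B * (norm v)\<^sup>2)" using integrable_norm_sq by simp
  have "norm (adj v ** B ** v) \<le> norm B * (norm v)\<^sup>2" for v :: "complex ^ 'd ^ 'd"
  proof -
    have "norm (adj v ** B ** v) \<le> norm (adj v) * norm B * norm v"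
      by (intro order_trans[OF norm_matrix_mult_le] mult_right_mono norm_matrix_mult_le) simp
    then show ?thesis by (simp add: power2_eq_square mult_ac)
  qed
  then show "AE v in \<mu>. norm (adj v ** B ** v) \<le> norm (norm B * (norm v)\<^sup>2)" by simp
qed measurable

lemma linear_dual_channel: "linear dual_channel"
proof (rule linearI)
  fix A B :: "complex ^ 'd ^ 'd" and c :: real
  have "adj v ** (A + B) ** v = adj v ** A ** v + adj v ** B ** v" for v :: "complex ^ 'd ^ 'd"
    by (simp add: matrix_add_ldistrib matrix_matrix_mult_def vec_eq_iff distrib_right sum.distrib distrib_left)
  then show "dual_channel (A + B) = dual_channel A + dual_channel B"
    by (simp add: dual_channel_def integrable_dual_channel)
  have "adj v ** (c *\<^sub>R A) ** v = c *\<^sub>R (adj v ** A ** v)" for v :: "complex ^ 'd ^ 'd"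
    by (simp add: matrix_matrix_mult_def vec_eq_iff scaleR_sum_right sum_distrib_right)
  then show "dual_channel (c *\<^sub>R A) = c *\<^sub>R dual_channel A"
    by (simp add: dual_channel_def)
qed

lemma hinner_dual_channel:
  "has_bochner_integral \<mu> (\<lambda>v. hinner (v *v x) (B *v (v *v y))) (hinner x (dual_channel B *v y))"
proof -
  have "linear (\<lambda>A. hinner x (A *v y))"
    by (intro linearI) (simp_all add: hinner_def matrix_vector_mult_def algebra_simps sum.distrib
        scaleR_sum_right sum_distrib_left sum_distrib_right)
  then have bl: "bounded_linear (\<lambda>A. hinner x (A *v y))" by (simp add: linear_conv_bounded_linear)
  have "has_bochner_integral \<mu> (\<lambda>v. adj v ** B ** v) (dual_channel B)"
    unfolding dual_channel_def by (rule has_bochner_integral_integrable[OF integrable_dual_channel])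
  from has_bochner_integral_bounded_linear[OF bl this] show ?thesis
    by (simp add: hinner_adj matrix_vector_mul_assoc matrix_mul_assoc)
qed

lemma qform_dual_channel: "has_bochner_integral \<mu> (\<lambda>v. qform B (v *v x)) (qform (dual_channel B) x)"
  unfolding qform_def by (rule has_bochner_integral_bounded_linear[OF bounded_linear_Re hinner_dual_channel])

lemma kernel_op_qform: "kernel_op \<mu> (\<lambda>p. qform B (unit_rep p)) p = qform (dual_channel B) (unit_rep p)"
proof -
  have "qform B (unit_rep (proj_act v p)) * (norm (v *v unit_rep p))\<^sup>2 = qform B (v *v unit_rep p)" for v
    unfolding proj_act_def by (cases "v *v unit_rep p = 0") (simp_all add: qform_unit_rep)
  then show ?thesis
    using qform_dual_channel[of B "unit_rep p"] by (simp add: kernel_op_def has_bochner_integral_iff)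
qed

lemma kernel_pow_qform:
  "kernel_pow n (\<lambda>p. qform B (unit_rep p)) = (\<lambda>p. qform ((dual_channel ^^ n) B) (unit_rep p))"
  by (induction n) (auto simp: kernel_op_qform)

text \<open>The channel does not increase the operator norm: the product of
  \<open>norm (v *v x)\<close> and \<open>norm (v *v y)\<close> is split by the arithmetic-geometric
  inequality into squares whose integrals are known.\<close>

lemma dual_channel_bound:
  assumes c: "c \<ge> 0" and B: "\<And>x y. cmod (hinner x (B *v y)) \<le> c * norm x * norm y"
  shows "cmod (hinner x (dual_channel B *v y)) \<le> c * norm x * norm y"
proof (cases "x = 0 \<or> y = 0")
  case False
  \<comment> \<open>The weight for which the two integrated squares are equal, so that the bound
    after integration is again the product of the norms.\<close>
  define r where "r = norm y / norm x"
  have r: "r > 0" using False by (simp add: r_def)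
  have "cmod (hinner x (dual_channel B *v y)) = cmod (\<integral>v. hinner (v *v x) (B *v (v *v y)) \<partial>\<mu>)"
    using hinner_dual_channel[of x B y] by (simp add: has_bochner_integral_iff)
  also have "\<dots> \<le> (\<integral>v. c * (r * (norm (v *v x))\<^sup>2 + (norm (v *v y))\<^sup>2 / r) / 2 \<partial>\<mu>)"
  proof (rule Bochner_Integration.integral_norm_bound_integral)
    show "integrable \<mu> (\<lambda>v. hinner (v *v x) (B *v (v *v y)))"
      using hinner_dual_channel[of x B y] by (simp add: has_bochner_integral_iff)
    show "integrable \<mu> (\<lambda>v. c * (r * (norm (v *v x))\<^sup>2 + (norm (v *v y))\<^sup>2 / r) / 2)"
      using integral_norm_sq by (auto simp: has_bochner_integral_iff intro!: Bochner_Integration.integrable_add)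
    fix v :: "complex ^ 'd ^ 'd"
    let ?a = "norm (v *v x)" and ?b = "norm (v *v y)"
    have "0 \<le> (r * ?a - ?b)\<^sup>2 / r" using r by simp
    then have "?a * ?b \<le> (r * ?a\<^sup>2 + ?b\<^sup>2 / r) / 2"
      using r by (simp add: power2_eq_square field_simps)
    then have "c * (?a * ?b) \<le> c * ((r * ?a\<^sup>2 + ?b\<^sup>2 / r) / 2)" using c by (rule mult_left_mono)
    then show "cmod (hinner (v *v x) (B *v (v *v y))) \<le> c * (r * ?a\<^sup>2 + ?b\<^sup>2 / r) / 2"
      using B[of "v *v x" "v *v y"] by (simp add: mult.assoc)
  qed
  also have "\<dots> = c * (r * (norm x)\<^sup>2 + (norm y)\<^sup>2 / r) / 2"
    using integral_norm_sq[of x] integral_norm_sq[of y] by (simp add: has_bochner_integral_iff)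
  also have "\<dots> = c * norm x * norm y"
    using False by (simp add: r_def power2_eq_square field_simps)
  finally show ?thesis .
qed (auto simp: matrix_vector_mult_def hinner_def)

lemma dual_channel_pow_bounded: "\<exists>K. \<forall>n. norm ((dual_channel ^^ n) B) \<le> K"
proof -
  have bd: "cmod (hinner x ((dual_channel ^^ n) B *v y)) \<le> norm B * norm x * norm y" for n x y
  proof (induction n arbitrary: x y)
    case 0
    have "cmod (hinner x (B *v y)) \<le> norm x * (norm B * norm y)"
      by (intro order_trans[OF hinner_cauchy_schwarz] mult_left_mono norm_matrix_vector_le) simp
    then show ?case by (simp add: mult_ac)
  next
    case (Suc n)
    show ?case unfolding funpow.simps o_apply by (rule dual_channel_bound) (use Suc in auto)
  qed
  have entry: "hinner (axis i 1) (A *v axis j 1) = A $ i $ j" for A :: "complex ^ 'd ^ 'd" and i j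
    by (simp add: hinner_def matrix_vector_mult_def axis_def if_distrib if_distribR cong: if_cong)
  have "cmod ((dual_channel ^^ n) B $ i $ j) \<le> norm B" for n i j
    using bd[of "axis i 1" n "axis j 1"] by (simp add: entry)
  then have "(norm ((dual_channel ^^ n) B))\<^sup>2 \<le> (\<Sum>i\<in>(UNIV::'d set). \<Sum>j\<in>(UNIV::'d set). (norm B)\<^sup>2)" for n
    unfolding norm_matrix_sq[of "(dual_channel ^^ n) B"] by (intro sum_mono power_mono) auto
  then have "norm ((dual_channel ^^ n) B) \<le> sqrt (\<Sum>i\<in>(UNIV::'d set). \<Sum>j\<in>(UNIV::'d set). (norm B)\<^sup>2)" for n
    by (rule real_le_rsqrt)
  then show ?thesis by blast
qed

text \<open>At a maximising vector the nonnegative difference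
  \<open>l * (norm (v *v x))^2 - qform X (v *v x)\<close> has integral 0, hence vanishes almost
  surely and, being continuous in \<open>v\<close>, on the whole support.\<close>

lemma qform_extremal_invariant:
  assumes fix_X: "dual_channel X = X" and le: "\<And>x. qform X x \<le> l * (norm x)\<^sup>2"
    and x0: "x0 \<noteq> 0" "qform X x0 = l * (norm x0)\<^sup>2"
  shows "invariant_subspace \<mu> {x. qform X x = l * (norm x)\<^sup>2}"
  unfolding invariant_subspace_def
proof (intro conjI ballI subspace_qform_max le)
  show "{x. qform X x = l * (norm x)\<^sup>2} \<noteq> {0}" using x0 by auto
  fix v assume v: "v \<in> msupport \<mu>"
  show "(*v) v ` {x. qform X x = l * (norm x)\<^sup>2} \<subseteq> {x. qform X x = l * (norm x)\<^sup>2}"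
  proof clarify
    fix x assume x: "qform X x = l * (norm x)\<^sup>2"
    let ?r = "\<lambda>v. l * (norm (v *v x))\<^sup>2 - qform X (v *v x)"
    have "has_bochner_integral \<mu> ?r (l * (norm x)\<^sup>2 - qform X x)"
      using qform_dual_channel[of X x] fix_X
      by (intro has_bochner_integral_diff has_bochner_integral_mult_right integral_norm_sq) simp_all
    then have "AE v in \<mu>. ?r v = 0"
      using x le by (subst integral_nonneg_eq_0_iff_AE[symmetric]) (auto simp: has_bochner_integral_iff)
    then have "AE v in \<mu>. v \<in> {v. ?r v = 0}" by simp
    moreover have "continuous_on UNIV (\<lambda>v :: complex ^ 'd ^ 'd. v *v x)"
      by (auto simp: matrix_vector_mult_def intro!: continuous_intros)
    then have "continuous_on UNIV ?r"
      by (intro continuous_intros continuous_on_compose2[OF continuous_on_qform[of UNIV]]) auto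
    then have "closed {v. ?r v = 0}"
      by (intro closed_Collect_eq) (auto intro: continuous_on_const)
    ultimately have "v \<in> {v. ?r v = 0}" using AE_closed_imp_msupport[OF _ _ sets_mu] v by blast
    then show "qform X (v *v x) = l * (norm (v *v x))\<^sup>2" by simp
  qed
qed

text \<open>The vectors attaining the maximum and those attaining the minimum form two invariant
  subspaces. They share a nonzero vector, so the two extreme values coincide.\<close>

lemma ergodic_fixed_point:
  assumes erg: "ergodic_measure \<mu>" and X: "dual_channel X = X"
  obtains c where "\<And>x. qform X x = c * (norm x)\<^sup>2"
proof -
  have ext: "\<exists>x0\<in>sphere 0 1. \<forall>x. qform Y x \<le> qform Y x0 * (norm x)\<^sup>2" for Y :: "complex ^ 'd ^ 'd"
  proof -
    have "\<exists>x0\<in>sphere 0 1. \<forall>x\<in>sphere 0 1. qform Y x \<le> qform Y x0"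
    proof (rule continuous_attains_sup)
      have "axis undefined 1 \<in> sphere (0 :: complex ^ 'd) 1" by simp
      then show "sphere (0 :: complex ^ 'd) 1 \<noteq> {}" by blast
    qed (auto intro: continuous_on_qform)
    then obtain x0 where x0: "x0 \<in> sphere 0 1" "\<And>x. x \<in> sphere 0 1 \<Longrightarrow> qform Y x \<le> qform Y x0" by blast
    have "qform Y x \<le> qform Y x0 * (norm x)\<^sup>2" for x
    proof (cases "x = 0")
      case False
      have "qform Y (unit_rep (proj_class x)) \<le> qform Y x0" by (rule x0(2)) (simp add: unit_rep)
      then have "qform Y (unit_rep (proj_class x)) * (norm x)\<^sup>2 \<le> qform Y x0 * (norm x)\<^sup>2"
        by (rule mult_right_mono) simp
      then show ?thesis by (simp add: qform_unit_rep[OF False])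
    qed simp
    then show ?thesis using x0(1) by blast
  qed
  obtain a where a: "a \<in> sphere 0 1" "\<And>x. qform X x \<le> qform X a * (norm x)\<^sup>2" using ext[of X] by blast
  obtain b where b: "b \<in> sphere 0 1" "\<And>x. qform (- X) x \<le> qform (- X) b * (norm x)\<^sup>2" using ext[of "- X"] by blast
  have neg: "qform (- X) x = - qform X x" for x using qform_scaleR[of "-1" X x] by simp
  have mX: "dual_channel (- X) = - X" using linear_neg[OF linear_dual_channel, of X] X by simp
  have inv1: "invariant_subspace \<mu> {x. qform X x = qform X a * (norm x)\<^sup>2}"
    by (rule qform_extremal_invariant[OF X a(2), of a]) (use a(1) in auto)
  have inv2: "invariant_subspace \<mu> {x. qform (- X) x = qform (- X) b * (norm x)\<^sup>2}"
    by (rule qform_extremal_invariant[OF mX b(2), of b]) (use b(1) in auto)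
  have "0 \<in> {x. qform X x = qform X a * (norm x)\<^sup>2} \<inter> {x. qform (- X) x = qform (- X) b * (norm x)\<^sup>2}" by simp
  then obtain x where x: "x \<noteq> 0" "qform X x = qform X a * (norm x)\<^sup>2" "qform (- X) x = qform (- X) b * (norm x)\<^sup>2"
    using ergodic_measure_unique[OF erg inv1 inv2] by auto
  then have "qform X a = qform X b" by (simp add: neg)
  then have "qform X y = qform X a * (norm y)\<^sup>2" for y
    using a(2)[of y] b(2)[of y] by (simp add: neg)
  then show ?thesis using that by blast
qed

text \<open>Every limit point of the Cesaro averages of a bounded orbit is fixed by the channel,
  hence constant on the sphere. Compactness yields only a subsequence, so closeness to
  \<open>c\<close> is claimed for some arbitrarily large \<open>n\<close>; a single such
  \<open>n\<close> is what is used later.\<close>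

lemma ergodic_cesaro_qform:
  assumes erg: "ergodic_measure \<mu>"
  obtains c where "\<And>\<epsilon> N. \<epsilon> > 0 \<Longrightarrow> \<exists>n\<ge>N. n > 0 \<and>
    (\<forall>x. norm x = 1 \<longrightarrow> \<bar>(\<Sum>k<n. qform ((dual_channel ^^ k) B) x) / real n - c\<bar> \<le> \<epsilon>)"
proof -
  define A where "A n = (1 / real (Suc n)) *\<^sub>R (\<Sum>k<Suc n. (dual_channel ^^ k) B)" for n
  obtain K where K: "\<And>n. norm ((dual_channel ^^ n) B) \<le> K" using dual_channel_pow_bounded by blast
  have "norm (A n) \<le> K" for n
  proof -
    have "norm (\<Sum>k<Suc n. (dual_channel ^^ k) B) \<le> (\<Sum>k<Suc n. K)" by (intro sum_norm_le K)
    then show ?thesis unfolding A_def norm_scaleR by (simp add: field_simps del: sum.lessThan_Suc)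
  qed
  then have "bounded (range A)" by (auto simp: bounded_iff)
  then obtain X r where r: "strict_mono r" and lim: "(A \<circ> r) \<longlonglongrightarrow> X"
    using bounded_imp_convergent_subsequence by blast
  have bl: "bounded_linear dual_channel" using linear_dual_channel by (simp add: linear_conv_bounded_linear)
  have diff: "dual_channel (A n) - A n = (1 / real (Suc n)) *\<^sub>R ((dual_channel ^^ Suc n) B - B)" for n
  proof -
    have "dual_channel (A n) = (1 / real (Suc n)) *\<^sub>R (\<Sum>k<Suc n. (dual_channel ^^ Suc k) B)"
      unfolding A_def by (simp add: linear_scale[OF linear_dual_channel] linear_sum[OF linear_dual_channel] linear_add[OF linear_dual_channel] del: of_nat_Suc)
    then have "dual_channel (A n) - A n =
       (1 / real (Suc n)) *\<^sub>R (\<Sum>k<Suc n. (dual_channel ^^ Suc k) B - (dual_channel ^^ k) B)"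
      by (simp add: A_def sum_subtractf scaleR_diff_right del: of_nat_Suc sum.lessThan_Suc funpow.simps)
    then show ?thesis
      using sum_lessThan_telescope[of "\<lambda>k. (dual_channel ^^ k) B" "Suc n"] by (simp only: funpow_0)
  qed
  have "(\<lambda>n. dual_channel (A n) - A n) \<longlonglongrightarrow> 0"
  proof (rule Lim_null_comparison)
    have "norm (dual_channel (A n) - A n) \<le> 2 * K / real (Suc n)" for n
    proof -
      have "norm ((dual_channel ^^ Suc n) B - B) \<le> K + K"
        using K[of "Suc n"] K[of 0] by (intro order_trans[OF norm_triangle_ineq4] add_mono) simp_all
      then show ?thesis unfolding diff by (simp add: divide_right_mono del: of_nat_Suc funpow.simps)
    qed
    then show "\<forall>\<^sub>F n in sequentially. norm (dual_channel (A n) - A n) \<le> 2 * K / real (Suc n)" by simp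
    show "(\<lambda>n. 2 * K / real (Suc n)) \<longlonglongrightarrow> 0"
      by (rule LIMSEQ_Suc[OF lim_const_over_n])
  qed
  then have "(\<lambda>n. dual_channel ((A \<circ> r) n) - (A \<circ> r) n) \<longlonglongrightarrow> 0"
    using LIMSEQ_subseq_LIMSEQ[OF _ r] by (fastforce simp: o_def)
  moreover have "(\<lambda>n. dual_channel ((A \<circ> r) n) - (A \<circ> r) n) \<longlonglongrightarrow> dual_channel X - X"
    by (intro tendsto_diff bounded_linear.tendsto[OF bl] lim)
  ultimately have "dual_channel X = X" using LIMSEQ_unique by fastforce
  then obtain c where c: "\<And>x. qform X x = c * (norm x)\<^sup>2" 
    using ergodic_fixed_point[OF erg] by blast
  show ?thesis
  proof (rule that[of c])
    fix \<epsilon> :: real and N :: nat assume "\<epsilon> > 0"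
    then obtain n0 where n0: "\<And>n. n \<ge> n0 \<Longrightarrow> norm (A (r n) - X) < \<epsilon>"
      using lim[unfolded LIMSEQ_iff] by auto
    define n where "n = max n0 N"
    have "norm (A (r n) - X) < \<epsilon>" by (rule n0) (simp add: n_def)
    have "\<bar>(\<Sum>k<Suc (r n). qform ((dual_channel ^^ k) B) x) / real (Suc (r n)) - c\<bar> \<le> \<epsilon>" if "norm x = 1" for x
    proof -
      have "(\<Sum>k<Suc (r n). qform ((dual_channel ^^ k) B) x) / real (Suc (r n)) = qform (A (r n)) x"
        unfolding A_def qform_scaleR qform_sum by simp
      moreover have "\<bar>qform (A (r n) - X) x\<bar> \<le> \<epsilon>"
        using abs_qform_le[of "A (r n) - X" x] \<open>norm (A (r n) - X) < \<epsilon>\<close> that by simp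
      ultimately show ?thesis by (simp only: qform_diff c that) simp
    qed
    moreover have "N \<le> Suc (r n)" using seq_suble[OF r, of n] by (simp add: n_def)
    ultimately show "\<exists>n\<ge>N. n > 0 \<and> (\<forall>x. norm x = 1 \<longrightarrow> \<bar>(\<Sum>k<n. qform ((dual_channel ^^ k) B) x) / real n - c\<bar> \<le> \<epsilon>)"
      by (intro exI[of _ "Suc (r n)"]) auto
  qed
qed

end

section \<open>Purification\<close>

text \<open>The growth condition that is preserved by averaging over left multiplication, since
  \<open>(norm w)^2\<close> averages to itself.\<close>

definition quad_bounded :: "real \<Rightarrow> (complex ^ 'd::finite ^ 'd \<Rightarrow> 'b::euclidean_space) \<Rightarrow> bool" where
  "quad_bounded C F \<longleftrightarrow> F \<in> borel_measurable borel \<and> (\<forall>w. norm (F w) \<le> C * (norm w)\<^sup>2)"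

lemma quad_boundedD:
  "quad_bounded C F \<Longrightarrow> F \<in> borel_measurable borel" "quad_bounded C F \<Longrightarrow> norm (F w) \<le> C * (norm w)\<^sup>2"
  by (auto simp: quad_bounded_def)

lemma quad_bounded_add:
  "quad_bounded C F \<Longrightarrow> quad_bounded D G \<Longrightarrow> quad_bounded (C + D) (\<lambda>w. F w + G w)"
  by (auto simp: quad_bounded_def distrib_right intro: order_trans[OF norm_triangle_ineq] add_mono)

lemma quad_bounded_scaleR:
  assumes "quad_bounded C F" shows "quad_bounded (\<bar>c\<bar> * C) (\<lambda>w. c *\<^sub>R F w)"
  using assms by (auto simp: quad_bounded_def mult.assoc mult_left_mono)

lemma quad_bounded_mult:
  fixes F :: "complex ^ 'd::finite ^ 'd \<Rightarrow> real"
  shows "quad_bounded C F \<Longrightarrow> quad_bounded (\<bar>c\<bar> * C) (\<lambda>w. c * F w)"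
  using quad_bounded_scaleR[of C F c] by simp

lemma quad_bounded_diff:
  "quad_bounded C F \<Longrightarrow> quad_bounded D G \<Longrightarrow> quad_bounded (C + D) (\<lambda>w. F w - G w)"
  using quad_bounded_add[of C F D "\<lambda>w. - G w"] by (simp add: quad_bounded_def)

lemma quad_bounded_norm_sq: "quad_bounded 1 (\<lambda>w. (norm w)\<^sup>2)"
  by (auto simp: quad_bounded_def)

lemma quad_bounded_linear:
  assumes "bounded_linear L" "quad_bounded C F"
  obtains K where "quad_bounded K (\<lambda>w. L (F w))"
proof -
  interpret bounded_linear L by fact
  obtain K where K: "K > 0" "\<And>x. norm (L x) \<le> norm x * K" using pos_bounded by blast
  have "norm (L (F w)) \<le> (C * K) * (norm w)\<^sup>2" for w
    using order_trans[OF K(2)[of "F w"] mult_right_mono[OF quad_boundedD(2)[OF assms(2), of w]]] K(1)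
    by (simp add: mult_ac)
  moreover have "(\<lambda>w. L (F w)) \<in> borel_measurable borel"
    using borel_measurable_continuous_on[OF linear_continuous_on[OF assms(1), of UNIV] quad_boundedD(1)[OF assms(2)]] .
  ultimately show ?thesis using that by (auto simp: quad_bounded_def)
qed

text \<open>The sum of the fourth powers of the singular values of \<open>w\<close> divided by the
  sum of their squares, \<open>norm\<close> being the Hilbert-Schmidt norm. For nonzero
  \<open>w\<close> it reaches its bound \<open>(norm w)^2\<close> exactly at rank one. At 0 the
  division convention gives 0, which is also the limit.\<close>

definition purity :: "complex ^ 'd::finite ^ 'd \<Rightarrow> real" where
  "purity w = (norm (adj w ** w))\<^sup>2 / (norm w)\<^sup>2"

lemma purity_nonneg: "purity w \<ge> 0"
  by (simp add: purity_def)

lemma purity_le: "purity w \<le> (norm w)\<^sup>2"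
proof -
  have "norm (adj w ** w) \<le> (norm w)\<^sup>2"
    using norm_matrix_mult_le[of "adj w" w] by (simp add: power2_eq_square)
  then have "(norm (adj w ** w))\<^sup>2 \<le> ((norm w)\<^sup>2)\<^sup>2" by (intro power_mono) auto
  then show ?thesis by (cases "w = 0") (simp_all add: purity_def divide_le_eq power2_eq_square)
qed

lemma purity_measurable [measurable]: "purity \<in> borel_measurable borel"
  unfolding purity_def by measurable

lemma quad_bounded_purity: "quad_bounded 1 purity"
  by (simp add: quad_bounded_def purity_le purity_nonneg)

lemma continuous_on_gram: "continuous_on S (\<lambda>w :: complex ^ 'd::finite ^ 'd. adj w ** w)"
  by (auto simp: adj_def matrix_matrix_mult_def intro!: continuous_intros)

lemma continuous_on_purity: "continuous_on UNIV purity"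
proof (rule continuous_at_imp_continuous_on, rule ballI)
  fix w :: "complex ^ 'a ^ 'a"
  show "isCont purity w"
  proof (cases "w = 0")
    case True
    have "(purity \<longlongrightarrow> 0) (at (0 :: complex ^ 'a ^ 'a))"
    proof (rule Lim_null_comparison)
      show "\<forall>\<^sub>F x in at (0 :: complex ^ 'a ^ 'a). norm (purity x) \<le> (norm x)\<^sup>2" by (simp add: purity_le purity_nonneg)
      show "((\<lambda>x :: complex ^ 'a ^ 'a. (norm x)\<^sup>2) \<longlongrightarrow> 0) (at (0 :: complex ^ 'a ^ 'a))"
        by (rule tendsto_eq_intros refl)+ simp
    qed
    then show ?thesis using True by (simp add: isCont_def purity_def)
  next
    case False
    have "continuous_on (- {0}) (purity :: complex ^ 'a ^ 'a \<Rightarrow> real)"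
      unfolding purity_def by (intro continuous_intros continuous_on_gram) auto
    then show ?thesis using False by (simp add: continuous_on_eq_continuous_at open_Compl)
  qed
qed

text \<open>The square is expanded so that, apart from \<open>purity u\<close>, only terms linear in
  \<open>Z\<close> and in \<open>(norm u)^2\<close> remain, with coefficients depending on
  \<open>w\<close>. Left multiplication leaves both unchanged on average.\<close>

lemma norm_gram_diff:
  fixes u w :: "complex ^ 'd::finite ^ 'd"
  assumes "w \<noteq> 0"
  defines "R \<equiv> adj w ** w" and "Z \<equiv> adj u ** u"
  shows "purity u - 2 / (norm w)\<^sup>2 * (Z \<bullet> R) + (norm R)\<^sup>2 / (norm w) ^ 4 * (norm u)\<^sup>2
    = (norm u)\<^sup>2 * (norm ((1 / (norm u)\<^sup>2) *\<^sub>R Z - (1 / (norm w)\<^sup>2) *\<^sub>R R))\<^sup>2"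
proof (cases "u = 0")
  case True
  then have "Z = 0" by (simp add: Z_def matrix_matrix_mult_def vec_eq_iff)
  then show ?thesis using True by (simp add: purity_def)
next
  case False
  define a b where "a = (norm u)\<^sup>2" and "b = (norm w)\<^sup>2"
  have ab: "a > 0" "b > 0" using assms False by (auto simp: a_def b_def)
  have p: "purity u = (Z \<bullet> Z) / a" by (simp add: purity_def Z_def a_def power2_norm_eq_inner)
  have b4: "(norm w) ^ 4 = b\<^sup>2" by (simp add: b_def)
  show ?thesis unfolding b4 p a_def[symmetric] b_def[symmetric] power2_norm_eq_inner[of R]
      power2_norm_eq_inner[of "_ - _"]
    using ab by (simp add: inner_diff_left inner_diff_right inner_commute[of R Z] field_simps power2_eq_square)
qed

lemma W_measurable:
  assumes "{..<m} \<subseteq> I" "\<And>i. i \<in> I \<Longrightarrow> sets (M i) = sets borel"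
  shows "(\<lambda>\<omega>. W \<omega> m) \<in> borel_measurable (PiM I M)"
  using assms(1)
proof (induction m)
  case (Suc m)
  have "m \<in> I" using Suc by auto
  then have "(\<lambda>\<omega>. \<omega> m) \<in> measurable (PiM I M) (M m)" by (rule measurable_component_singleton)
  then have "(\<lambda>\<omega>. \<omega> m) \<in> borel_measurable (PiM I M)"
    using measurable_cong_sets[OF refl assms(2)[OF \<open>m \<in> I\<close>]] by blast
  moreover have "(\<lambda>\<omega>. W \<omega> m) \<in> borel_measurable (PiM I M)"
  proof (rule Suc.IH)
    show "{..<m} \<subseteq> I" using Suc.prems by auto
  qed
  ultimately show ?case by (simp add: matrix_mult_measurable)
qed simp

lemma W_cong: "(\<And>i. i < m \<Longrightarrow> \<omega> i = \<omega>' i) \<Longrightarrow> W \<omega> m = W \<omega>' m"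
  by (induction m) auto

lemma mult_axis: "A *v axis j 1 = column j (A :: complex ^ 'd::finite ^ 'd)"
  by (simp add: matrix_vector_mult_def column_def axis_def vec_eq_iff if_distrib if_distribR cong: if_cong)

lemma rank_one_columns:
  fixes A :: "complex ^ 'd::finite ^ 'd"
  assumes "rank A = 1"
  obtains a b where "\<And>k i. A $ k $ i = a $ k * b $ i"
proof -
  obtain B where B: "B \<subseteq> rows A" "vec.independent B" "rows A \<subseteq> vec.span B" "card B = vec.dim (rows A)"
    by (rule vec.basis_exists)
  then obtain b where b: "B = {b}" using assms by (auto simp: row_rank_def_gen card_1_singleton_iff)
  have "\<exists>c. A $ k = c *s b" for k
  proof -
    have "A $ k \<in> rows A" by (auto simp: rows_def row_def vec_lambda_eta)
    then have "A $ k \<in> vec.span {b}" using B(3) b by auto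
    then show ?thesis by (auto simp: vec.span_singleton)
  qed
  then obtain a where a: "\<And>k. A $ k = a k *s b" by metis
  show ?thesis by (rule that[of "\<chi> k. a k" b]) (simp add: a)
qed

text \<open>Gram-Schmidt over the columns of \<open>w\<close>. The factor \<open>K\<close> is
  recorded because it carries identities for \<open>adj w ** w\<close> over to
  \<open>\<pi>\<close>.\<close>

lemma range_projector:
  fixes w :: "complex ^ 'd::finite ^ 'd"
  obtains \<pi> K where "orthogonal_projector \<pi>" "\<pi> = w ** K" "\<pi> ** w = w"
proof -
  have "\<exists>\<pi> K. orthogonal_projector \<pi> \<and> \<pi> = w ** K \<and> (\<forall>j\<in>J. \<pi> *v column j w = column j w)" if "finite J" for J
    using that
  proof (induction J)
    case empty
    show ?case
      by (rule exI[of _ 0], rule exI[of _ 0])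
        (simp add: orthogonal_projector_def adj_def matrix_matrix_mult_def vec_eq_iff)
  next
    case (insert j J)
    then obtain \<pi> K where \<pi>: "orthogonal_projector \<pi>" "\<pi> = w ** K" "\<And>j. j \<in> J \<Longrightarrow> \<pi> *v column j w = column j w"
      by auto
    have pp: "\<pi> ** \<pi> = \<pi>" and pa: "adj \<pi> = \<pi>" using \<pi>(1) by (auto simp: orthogonal_projector_def)
    define a where "a = column j w"
    define b where "b = a - \<pi> *v a"
    have pb: "\<pi> *v b = 0"
      by (simp add: b_def matrix_vector_mult_diff_distrib matrix_vector_mul_assoc pp)
    show ?case
    proof (cases "b = 0")
      case True
      then have "\<pi> *v column j w = column j w" by (simp add: b_def a_def)
      then show ?thesis using \<pi>(1,3) by (intro exI[of _ \<pi>] exI[of _ K] conjI \<pi>(2)) auto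
    next
      case False
      \<comment> \<open>Here \<open>b\<close> is the part of the new column orthogonal to the range
        of \<open>\<pi>\<close>, and \<open>t\<close> normalises \<open>line_projector b\<close> to
        a projector.\<close>
      define t where "t = 1 / (norm b)\<^sup>2"
      define \<pi>' where "\<pi>' = \<pi> + t *\<^sub>R line_projector b"
      have t: "t * (norm b)\<^sup>2 = 1" using False by (simp add: t_def)
      have lp: "line_projector b *v x = hinner b x *s b" for x
        by (simp add: vec_eq_iff line_projector_def matrix_vector_mult_def hinner_def
            sum_distrib_left sum_distrib_right mult_ac)
      have act: "\<pi>' *v x = \<pi> *v x + (of_real t * hinner b x) *s b" for x
      proof -
        have "((t *\<^sub>R A) *v x) $ i = of_real t * (A *v x) $ i" for A :: "complex ^ 'd ^ 'd" and i
          by (simp add: matrix_vector_mult_def scaleR_conv_of_real[where 'a = complex] sum_distrib_left mult.assoc)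
        then have "(t *\<^sub>R line_projector b) *v x = (of_real t * hinner b x) *s b"
          by (simp add: vec_eq_iff lp mult.assoc)
        then show ?thesis by (simp add: \<pi>'_def matrix_vector_mult_add_rdistrib)
      qed
      have hb: "hinner b (\<pi> *v x) = 0" for x
        using hinner_adj[of \<pi> b x] by (simp add: pa pb)
      have bb: "hinner b b = of_real ((norm b)\<^sup>2)" by (rule hinner_self)
      have "\<pi>' *v (\<pi>' *v x) = \<pi>' *v x" for x
      proof -
        have "\<pi> *v ((of_real t * hinner b x) *s b) = 0" by (simp add: matrix_vector_mult_smult pb)
        moreover have "complex_of_real t * hinner b b = 1"
          unfolding bb of_real_mult[symmetric] t by simp
        moreover have "\<pi> *v (\<pi>' *v x) = \<pi> *v x + \<pi> *v ((of_real t * hinner b x) *s b)"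
          unfolding act matrix_vector_right_distrib by (simp add: matrix_vector_mul_assoc pp)
        moreover have "hinner b (\<pi>' *v x) = of_real t * hinner b x * hinner b b"
          unfolding act hinner_add_right hb hinner_smult_right by simp
        ultimately have "\<pi> *v (\<pi>' *v x) = \<pi> *v x" "of_real t * hinner b (\<pi>' *v x) = of_real t * hinner b x"
          by (auto simp: mult_ac)
        then show ?thesis unfolding act[of "\<pi>' *v x"] by (simp add: act)
      qed
      then have "\<pi>' ** \<pi>' = \<pi>'" unfolding matrix_eq by (simp add: matrix_vector_mul_assoc[symmetric])
      moreover have "adj \<pi>' = \<pi>'"
      proof -
        have "adj (line_projector b) = line_projector b" by (simp add: adj_def line_projector_def vec_eq_iff)
        then show ?thesis using pa by (simp add: \<pi>'_def adj_def vec_eq_iff)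
      qed
      moreover have "\<exists>K. \<pi>' = w ** K"
      proof -
        define y where "y = axis j 1 - K *v a"
        have "b = w *v y"
          by (simp add: b_def y_def \<pi>(2) matrix_vector_mult_diff_distrib matrix_vector_mul_assoc mult_axis a_def)
        then have bi: "b $ i = (\<Sum>l\<in>UNIV. w $ i $ l * y $ l)" for i
          by (simp add: matrix_vector_mult_def)
        have "line_projector b $ i $ k = (w ** (\<chi> i k. y $ i * cnj (b $ k))) $ i $ k" for i k
          by (simp add: line_projector_def matrix_matrix_mult_def sum_distrib_right mult.assoc bi[of i])
        then have "line_projector b = w ** (\<chi> i k. y $ i * cnj (b $ k))" by (simp add: vec_eq_iff)
        then have "\<pi>' = w ** K + t *\<^sub>R (w ** (\<chi> i k. y $ i * cnj (b $ k)))" by (simp add: \<pi>'_def \<pi>(2))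
        also have "\<dots> = w ** (K + t *\<^sub>R (\<chi> i k. y $ i * cnj (b $ k)))"
          by (simp add: matrix_matrix_mult_def vec_eq_iff distrib_left sum.distrib scaleR_sum_right)
        finally show ?thesis by blast
      qed
      moreover have "\<pi>' *v column i w = column i w" if "i \<in> insert j J" for i
      proof (cases "i \<in> J")
        case True
        have "hinner b (column i w) = 0" using hb[of "column i w"] \<pi>(3)[OF True] by simp
        then show ?thesis by (simp add: act \<pi>(3)[OF True])
      next
        case False
        then have i: "column i w = a" using that by (simp add: a_def)
        have "a = b + \<pi> *v a" by (simp add: b_def)
        then have "hinner b a = hinner b b" using hinner_add_right[of b b "\<pi> *v a"] hb[of a] by simp
        then have "complex_of_real t * hinner b a = 1"
          by (simp only: bb of_real_mult[symmetric] t of_real_1)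
        then show ?thesis unfolding i by (simp add: act b_def)
      qed
      ultimately have "\<pi>' ** \<pi>' = \<pi>' \<and> adj \<pi>' = \<pi>'" "\<exists>K. \<pi>' = w ** K" "\<forall>i\<in>insert j J. \<pi>' *v column i w = column i w"
        by (simp_all only: simp_thms) auto
      then show ?thesis unfolding orthogonal_projector_def by (elim exE) (intro exI[of _ \<pi>'] exI conjI; simp)
    qed
  qed
  from this[of UNIV] obtain \<pi> K where \<pi>: "orthogonal_projector \<pi>" "\<pi> = w ** K" "\<And>j. \<pi> *v column j w = column j w"
    by auto
  have "\<pi> ** w = w"
  proof -
    have "column j (\<pi> ** w) = column j w" for j by (simp add: column_mult \<pi>(3))
    then show ?thesis by (simp add: column_def vec_eq_iff)
  qed
  from that[OF \<pi>(1,2) this] show ?thesis .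
qed

lemma adj_mult: "adj (A ** B) = adj B ** adj A"
  by (simp add: adj_def matrix_matrix_mult_def vec_eq_iff cnj_sum mult.commute)

lemma matrix_mult_scaleR:
  fixes A B :: "complex ^ 'd::finite ^ 'd"
  shows "(c *\<^sub>R A) ** B = c *\<^sub>R (A ** B)" "A ** (c *\<^sub>R B) = c *\<^sub>R (A ** B)"
  by (simp_all add: matrix_matrix_mult_def vec_eq_iff scaleR_sum_right)

lemma purity_rank_one:
  fixes w :: "complex ^ 'd::finite ^ 'd"
  assumes "\<And>k i. w $ k $ i = a $ k * b $ i"
  shows "purity w = (norm w)\<^sup>2"
proof -
  have nw: "(norm w)\<^sup>2 = (norm a)\<^sup>2 * (norm b)\<^sup>2"
    unfolding norm_matrix_sq norm_sq_vec assms norm_mult power_mult_distrib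
    by (simp add: sum_product)
  have "(adj w ** w) $ i $ j = hinner a a * (cnj (b $ i) * b $ j)" for i j
    by (simp add: matrix_matrix_mult_def adj_def assms hinner_def sum_distrib_left sum_distrib_right mult_ac)
  then have entry: "(cmod ((adj w ** w) $ i $ j))\<^sup>2 = (norm a) ^ 4 * ((cmod (b $ i))\<^sup>2 * (cmod (b $ j))\<^sup>2)" for i j
    by (simp add: hinner_self norm_mult power_mult_distrib norm_power)
  then have "(norm (adj w ** w))\<^sup>2 = (norm a) ^ 4 * ((norm b)\<^sup>2 * (norm b)\<^sup>2)"
    unfolding norm_matrix_sq[of "adj w ** w"] norm_sq_vec[of b]
    by (simp only: entry sum_product) (simp only: sum_distrib_left)
  also have "\<dots> = (norm w)\<^sup>2 * (norm w)\<^sup>2" unfolding nw by (simp add: power_numeral_reduce)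
  finally have "purity w = (norm w)\<^sup>2 * (norm w)\<^sup>2 / (norm w)\<^sup>2" by (simp only: purity_def)
  then show ?thesis using nonzero_mult_div_cancel_right[of "(norm w)\<^sup>2" "(norm w)\<^sup>2"] by (cases "w = 0") (simp_all only: simp_thms, simp_all)
qed

section \<open>Averages over left multiplication\<close>

context kraus_measure begin

definition avg :: "(complex ^ 'd ^ 'd \<Rightarrow> 'b::euclidean_space) \<Rightarrow> complex ^ 'd ^ 'd \<Rightarrow> 'b" where
  "avg F w = (\<integral>v. F (v ** w) \<partial>\<mu>)"

abbreviation avg_pow :: "nat \<Rightarrow> (complex ^ 'd ^ 'd \<Rightarrow> 'b::euclidean_space) \<Rightarrow> complex ^ 'd ^ 'd \<Rightarrow> 'b" where
  "avg_pow n \<equiv> avg ^^ n"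

lemma integrable_avg:
  assumes "quad_bounded C F"
  shows "integrable \<mu> (\<lambda>v. F (v ** w))"
proof (rule Bochner_Integration.integrable_bound)
  show "integrable \<mu> (\<lambda>v. C * (norm (v ** w))\<^sup>2)"
    using integral_norm_sq_matrix[of w] by (auto simp: has_bochner_integral_iff)
  show "AE v in \<mu>. norm (F (v ** w)) \<le> norm (C * (norm (v ** w))\<^sup>2)"
    using quad_boundedD(2)[OF assms] by (auto intro: order_trans[OF _ abs_ge_self])
  show "(\<lambda>v. F (v ** w)) \<in> borel_measurable \<mu>"
    using quad_boundedD(1)[OF assms] by measurable
qed

lemma quad_bounded_avg:
  assumes "quad_bounded C F"
  shows "quad_bounded C (avg F)"
  unfolding quad_bounded_def
proof (intro conjI allI)
  note [measurable] = quad_boundedD(1)[OF assms]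
  show "avg F \<in> borel_measurable borel" unfolding avg_def by measurable
  fix w
  have "norm (avg F w) \<le> (\<integral>v. C * (norm (v ** w))\<^sup>2 \<partial>\<mu>)" unfolding avg_def
    using integral_norm_sq_matrix[of w] quad_boundedD(2)[OF assms]
    by (intro Bochner_Integration.integral_norm_bound_integral integrable_avg[OF assms])
       (auto simp: has_bochner_integral_iff)
  then show "norm (avg F w) \<le> C * (norm w)\<^sup>2"
    using integral_norm_sq_matrix[of w] by (auto simp: has_bochner_integral_iff)
qed

lemma quad_bounded_avg_pow: "quad_bounded C F \<Longrightarrow> quad_bounded C (avg_pow n F)"
  by (induction n) (auto intro: quad_bounded_avg)

lemma avg_add: "quad_bounded C F \<Longrightarrow> quad_bounded D G \<Longrightarrow> avg (\<lambda>w. F w + G w) = (\<lambda>w. avg F w + avg G w)"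
  by (auto simp: avg_def integrable_avg fun_eq_iff)

lemma avg_pow_add:
  "quad_bounded C F \<Longrightarrow> quad_bounded D G \<Longrightarrow> avg_pow n (\<lambda>w. F w + G w) = (\<lambda>w. avg_pow n F w + avg_pow n G w)"
proof (induction n)
  case (Suc n)
  then show ?case using avg_add[OF quad_bounded_avg_pow[of C F n] quad_bounded_avg_pow[of D G n]] by simp
qed simp

lemma avg_linear:
  assumes "bounded_linear L" "quad_bounded C F"
  shows "avg (\<lambda>w. L (F w)) = (\<lambda>w. L (avg F w))"
  by (auto simp: avg_def fun_eq_iff integral_bounded_linear[OF assms(1) integrable_avg[OF assms(2)]])

lemma avg_pow_linear:
  assumes "bounded_linear L" "quad_bounded C F"
  shows "avg_pow n (\<lambda>w. L (F w)) = (\<lambda>w. L (avg_pow n F w))"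
  by (induction n) (simp_all add: avg_linear[OF assms(1) quad_bounded_avg_pow[OF assms(2)]])

lemma avg_pow_mult:
  fixes F :: "complex ^ 'd ^ 'd \<Rightarrow> real"
  shows "quad_bounded C F \<Longrightarrow> avg_pow n (\<lambda>w. c * F w) = (\<lambda>w. c * avg_pow n F w)"
  by (rule avg_pow_linear[OF bounded_linear_mult_right])

lemma avg_pow_diff:
  fixes F G :: "complex ^ 'd ^ 'd \<Rightarrow> real"
  assumes "quad_bounded C F" "quad_bounded D G"
  shows "avg_pow n (\<lambda>w. F w - G w) = (\<lambda>w. avg_pow n F w - avg_pow n G w)"
  using avg_pow_add[OF assms(1) quad_bounded_mult[OF assms(2), of "-1"], of n] avg_pow_mult[OF assms(2), of n "-1"]
  by simp

lemma avg_pow_mono: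
  fixes F G :: "complex ^ 'd ^ 'd \<Rightarrow> real"
  assumes F: "quad_bounded C F" and G: "quad_bounded D G" and le: "\<And>w. F w \<le> G w"
  shows "avg_pow n F w \<le> avg_pow n G w"
proof (induction n arbitrary: w)
  case (Suc n)
  show ?case unfolding funpow.simps o_apply avg_def[of "avg_pow n F"] avg_def[of "avg_pow n G"]
    by (intro integral_mono integrable_avg[OF quad_bounded_avg_pow[OF F]] integrable_avg[OF quad_bounded_avg_pow[OF G]] Suc)
qed (simp add: le)

lemma avg_pow_abs_le:
  fixes F G :: "complex ^ 'd ^ 'd \<Rightarrow> real"
  assumes F: "quad_bounded C F" and G: "quad_bounded D G" and le: "\<And>w. \<bar>F w\<bar> \<le> G w"
  shows "\<bar>avg_pow n F w\<bar> \<le> avg_pow n G w"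
proof -
  have "- F w \<le> G w" "F w \<le> G w" for w using le[of w] by auto
  then show ?thesis
    using avg_pow_mono[OF F G, of n w] avg_pow_mono[OF quad_bounded_mult[OF F, of "-1"] G, of n w]
      avg_pow_mult[OF F, of n "-1"] by (simp add: abs_le_iff)
qed

lemma avg_pow_norm_sq: "avg_pow n (\<lambda>w. (norm w)\<^sup>2) = (\<lambda>w. (norm w)\<^sup>2)"
proof -
  have "avg (\<lambda>w. (norm w)\<^sup>2) = (\<lambda>w. (norm w)\<^sup>2)"
    using integral_norm_sq_matrix by (auto simp: avg_def has_bochner_integral_iff)
  then show ?thesis by (induction n) simp_all
qed

lemma quad_bounded_gram: "quad_bounded 1 (\<lambda>w :: complex ^ 'd ^ 'd. adj w ** w)"
  using norm_matrix_mult_le[of "adj _"] by (auto simp: quad_bounded_def power2_eq_square)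

lemma avg_pow_gram: "avg_pow n (\<lambda>w. adj w ** w) = (\<lambda>w. adj w ** w)"
proof -
  have "avg (\<lambda>w. adj w ** w) w = adj w ** w" for w
  proof -
    have "linear (\<lambda>A. adj w ** A ** w)"
    proof (rule linearI)
      show "adj w ** (A + B) ** w = adj w ** A ** w + adj w ** B ** w" for A B
        by (simp add: matrix_add_ldistrib matrix_matrix_mult_def vec_eq_iff distrib_right sum.distrib distrib_left)
      show "adj w ** (c *\<^sub>R A) ** w = c *\<^sub>R (adj w ** A ** w)" for c A
        by (simp only: matrix_mult_scaleR)
    qed
    then have "bounded_linear (\<lambda>A. adj w ** A ** w)" by (simp add: linear_conv_bounded_linear)
    from has_bochner_integral_bounded_linear[OF this unital] show ?thesis
      by (simp add: avg_def has_bochner_integral_iff adj_mult matrix_mul_assoc)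
  qed
  then have "avg (\<lambda>w. adj w ** w) = (\<lambda>w. adj w ** w)" by auto
  then show ?thesis by (induction n) simp_all
qed

text \<open>Dominated convergence along sequences, with majorant
  \<open>C * (norm v)^2 * B^2\<close>. The continuity feeds the compactness argument for the gain in
  purity.\<close>

lemma continuous_on_avg:
  assumes F: "quad_bounded C F" and c: "continuous_on UNIV F"
  shows "continuous_on UNIV (avg F)"
proof (rule continuous_at_imp_continuous_on, rule ballI)
  fix w :: "complex ^ 'd ^ 'd"
  show "isCont (avg F) w"
  proof (rule continuous_at_sequentiallyI)
    fix u :: "nat \<Rightarrow> complex ^ 'd ^ 'd" assume u: "u \<longlonglongrightarrow> w"
    then have "bounded (range u)" by (intro convergent_imp_bounded) (auto simp: convergent_def)
    then obtain B where B: "\<And>n. norm (u n) \<le> B" by (auto simp: bounded_iff)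
    have C: "C \<ge> 0"
    proof -
      have "0 \<le> C * (norm (mat 1 :: complex ^ 'd ^ 'd))\<^sup>2" using order_trans[OF norm_ge_zero quad_boundedD(2)[OF F]] .
      moreover have "mat 1 \<noteq> (0 :: complex ^ 'd ^ 'd)" by (auto simp: mat_def vec_eq_iff)
      ultimately show ?thesis by (simp add: zero_le_mult_iff)
    qed
    note [measurable] = quad_boundedD(1)[OF F]
    show "(\<lambda>n. avg F (u n)) \<longlonglongrightarrow> avg F w" unfolding avg_def
    proof (rule integral_dominated_convergence[where w = "\<lambda>v. C * ((norm v)\<^sup>2 * B\<^sup>2)"])
      show "integrable \<mu> (\<lambda>v. C * ((norm v)\<^sup>2 * B\<^sup>2))" using integrable_norm_sq by simp
      show "AE v in \<mu>. (\<lambda>n. F (v ** u n)) \<longlonglongrightarrow> F (v ** w)"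
      proof (rule AE_I2)
        fix v :: "complex ^ 'd ^ 'd"
        have "continuous_on UNIV (\<lambda>x :: complex ^ 'd ^ 'd. v ** x)"
          by (auto simp: matrix_matrix_mult_def intro!: continuous_intros)
        then have "(\<lambda>n. v ** u n) \<longlonglongrightarrow> v ** w" using u by (auto intro: continuous_on_tendsto_compose)
        then show "(\<lambda>n. F (v ** u n)) \<longlonglongrightarrow> F (v ** w)" by (auto intro: continuous_on_tendsto_compose[OF c])
      qed
      show "AE v in \<mu>. norm (F (v ** u n)) \<le> C * ((norm v)\<^sup>2 * B\<^sup>2)" for n
      proof (rule AE_I2)
        fix v :: "complex ^ 'd ^ 'd"
        have "norm (v ** u n) \<le> norm v * B"
          by (rule order_trans[OF norm_matrix_mult_le mult_left_mono[OF B]]) simp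
        then have "(norm (v ** u n))\<^sup>2 \<le> (norm v * B)\<^sup>2" by (intro power_mono) auto
        then show "norm (F (v ** u n)) \<le> C * ((norm v)\<^sup>2 * B\<^sup>2)"
          using order_trans[OF quad_boundedD(2)[OF F] mult_left_mono[OF _ C]] by (simp add: power_mult_distrib)
      qed
    qed measurable
  qed
qed

lemma continuous_on_avg_pow: "quad_bounded C F \<Longrightarrow> continuous_on UNIV F \<Longrightarrow> continuous_on UNIV (avg_pow n F)"
  by (induction n) (auto intro: continuous_on_avg[OF quad_bounded_avg_pow])

text \<open>The matrices \<open>w\<^sup>* v\<^sup>* v w\<close> average to \<open>w\<^sup>* w\<close>, so the mean of the following weighted square is the
  increase of the purity; this yields both monotonicity and the equality case.\<close>

definition gram_gap :: "complex ^ 'd ^ 'd \<Rightarrow> complex ^ 'd ^ 'd \<Rightarrow> real" where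
  "gram_gap w u = (norm u)\<^sup>2 *
     (norm ((1 / (norm u)\<^sup>2) *\<^sub>R (adj u ** u) - (1 / (norm w)\<^sup>2) *\<^sub>R (adj w ** w)))\<^sup>2"

text \<open>Averaging changes only the purity term of \<open>norm_gram_diff\<close>; the other two
  contribute -2 and +1 times \<open>purity w\<close>.\<close>

lemma avg_pow_gram_gap:
  assumes w: "w \<noteq> 0"
  shows "avg_pow m (gram_gap w) w = avg_pow m purity w - purity w"
    and "\<exists>C. quad_bounded C (gram_gap w)"
proof -
  define R where "R = adj w ** w"
  have eq: "gram_gap w = (\<lambda>u. purity u + (- 2 / (norm w)\<^sup>2) * ((adj u ** u) \<bullet> R) + ((norm R)\<^sup>2 / (norm w) ^ 4) * (norm u)\<^sup>2)"
    using norm_gram_diff[OF w] by (auto simp: gram_gap_def R_def fun_eq_iff)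
  have bl: "bounded_linear (\<lambda>A. A \<bullet> R)" by (rule bounded_linear_inner_left)
  obtain K where K: "quad_bounded K (\<lambda>u. (adj u ** u) \<bullet> R)"
    by (rule quad_bounded_linear[OF bl quad_bounded_gram])
  note 1 = quad_bounded_mult[OF K, of "- 2 / (norm w)\<^sup>2"]
  note 2 = quad_bounded_mult[OF quad_bounded_norm_sq, of "(norm R)\<^sup>2 / (norm w) ^ 4"]
  note 3 = quad_bounded_add[OF quad_bounded_purity 1]
  show "\<exists>C. quad_bounded C (gram_gap w)" unfolding eq using quad_bounded_add[OF 3 2] by blast
  have "avg_pow m (gram_gap w) w = avg_pow m purity w + (- 2 / (norm w)\<^sup>2) * (R \<bullet> R) + ((norm R)\<^sup>2 / (norm w) ^ 4) * (norm w)\<^sup>2"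
    unfolding eq avg_pow_add[OF 3 2] avg_pow_add[OF quad_bounded_purity 1] avg_pow_mult[OF K]
      avg_pow_mult[OF quad_bounded_norm_sq] avg_pow_norm_sq avg_pow_linear[OF bl quad_bounded_gram] avg_pow_gram
    by (simp add: R_def)
  also have "\<dots> = avg_pow m purity w - purity w"
    using w by (simp add: purity_def R_def[symmetric] dot_square_norm field_simps power_numeral_reduce)
  finally show "avg_pow m (gram_gap w) w = avg_pow m purity w - purity w" .
qed

lemma avg_purity_ge: "purity w \<le> avg_pow m purity w"
proof (cases "w = 0")
  case True
  have "0 \<le> avg_pow m purity w"
    using avg_pow_mono[of 0 "\<lambda>_. 0" 1 purity m w] quad_bounded_purity avg_pow_mult[OF quad_bounded_purity, of m 0]
    by (auto simp: quad_bounded_def purity_nonneg)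
  then show ?thesis using True by (simp add: purity_def)
next
  case False
  obtain C where C: "quad_bounded C (gram_gap w)" using avg_pow_gram_gap(2)[OF False] by blast
  have "0 \<le> avg_pow m (gram_gap w) w"
    using avg_pow_mono[of 0 "\<lambda>_. 0" C "gram_gap w" m w] C avg_pow_mult[OF quad_bounded_purity, of m 0]
    by (auto simp: quad_bounded_def gram_gap_def)
  then show ?thesis using avg_pow_gram_gap(1)[OF False] by simp
qed

lemma avg_pow_purity_mono: "m \<le> n \<Longrightarrow> avg_pow m purity w \<le> avg_pow n purity w"
proof (rule lift_Suc_mono_le[of "\<lambda>n. avg_pow n purity w"])
  fix n
  have "avg_pow n purity w \<le> avg_pow n (avg purity) w"
    using avg_purity_ge[of _ 1] by (intro avg_pow_mono[OF quad_bounded_purity quad_bounded_avg[OF quad_bounded_purity]]) simp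
  then show "avg_pow n purity w \<le> avg_pow (Suc n) purity w" by (simp add: funpow_swap1)
qed

text \<open>Connects the iterated averages with the product measures in which
  \<open>purifying\<close> is phrased. The last matrix acts outermost, so its coordinate is split
  off and integrated first.\<close>

lemma nn_integral_avg_pow:
  fixes G :: "complex ^ 'd ^ 'd \<Rightarrow> real"
  assumes "quad_bounded C G" "\<And>w. 0 \<le> G w"
  shows "(\<integral>\<^sup>+ \<omega>. ennreal (G (W \<omega> m ** w)) \<partial>(\<Pi>\<^sub>M i\<in>{..<m}. \<mu>)) = ennreal (avg_pow m G w)"
  using assms
proof (induction m arbitrary: G)
  case 0
  show ?case by (simp add: PiM_empty nn_integral_count_space_finite)
next
  case (Suc m)
  interpret product_sigma_finite "\<lambda>_ :: nat. \<mu>" by unfold_locales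
  note [measurable] = quad_boundedD(1)[OF Suc.prems(1)]
  have avg0: "0 \<le> avg G w" for w unfolding avg_def using Suc.prems(2) by simp
  have W_Suc: "W (fun_upd \<omega> m v) (Suc m) = v ** W \<omega> m" for \<omega> :: "nat \<Rightarrow> complex ^ 'd ^ 'd" and v
    using W_cong[of m "fun_upd \<omega> m v" \<omega>] by simp
  have [measurable]: "(\<lambda>\<omega>. W \<omega> (Suc m)) \<in> borel_measurable (\<Pi>\<^sub>M i\<in>insert m {..<m}. \<mu>)"
    by (rule W_measurable) (auto simp: sets_mu)
  have "(\<integral>\<^sup>+ \<omega>. ennreal (G (W \<omega> (Suc m) ** w)) \<partial>(\<Pi>\<^sub>M i\<in>{..<Suc m}. \<mu>)) =
        (\<integral>\<^sup>+ \<omega>. ennreal (G (W \<omega> (Suc m) ** w)) \<partial>(\<Pi>\<^sub>M i\<in>insert m {..<m}. \<mu>))"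
    by (simp add: lessThan_Suc)
  also have "\<dots> = (\<integral>\<^sup>+ \<omega>. \<integral>\<^sup>+ v. ennreal (G (v ** (W \<omega> m ** w))) \<partial>\<mu> \<partial>(\<Pi>\<^sub>M i\<in>{..<m}. \<mu>))"
    by (subst product_nn_integral_insert) (simp_all add: W_Suc matrix_mul_assoc del: W.simps)
  also have "\<dots> = (\<integral>\<^sup>+ \<omega>. ennreal (avg G (W \<omega> m ** w)) \<partial>(\<Pi>\<^sub>M i\<in>{..<m}. \<mu>))"
    unfolding avg_def
    by (intro nn_integral_cong nn_integral_eq_integral integrable_avg[OF Suc.prems(1)]) (simp add: Suc.prems)
  also have "\<dots> = ennreal (avg_pow m (avg G) w)"
    by (rule Suc.IH[OF quad_bounded_avg[OF Suc.prems(1)] avg0])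
  finally show ?case by (simp add: funpow_swap1)
qed

text \<open>If purity never grows, the gap vanishes almost surely, so \<open>adj u ** u\<close> is a
  multiple of \<open>adj w ** w\<close> for \<open>u = W \<omega> n ** w\<close>. Sandwiching with
  \<open>K\<close> turns this into the condition of (Pur) for the projector onto the range of
  \<open>w\<close>.\<close>

lemma purifying_imp_rank_one:
  assumes pur: "purifying \<mu>" and w: "w \<noteq> 0" and eq: "\<And>m. avg_pow m purity w = purity w"
  shows "purity w = (norm w)\<^sup>2"
proof -
  obtain \<pi> K where \<pi>: "orthogonal_projector \<pi>" "\<pi> = w ** K" "\<pi> ** w = w" by (rule range_projector)
  have adj_\<pi>: "\<pi> = adj K ** adj w" using \<pi>(1,2) adj_mult by (metis orthogonal_projector_def)
  have pp: "\<pi> ** \<pi> = \<pi>" using \<pi>(1) by (simp add: orthogonal_projector_def)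
  have "0 ** w = 0" by (simp add: matrix_matrix_mult_def vec_eq_iff)
  then have "\<pi> \<noteq> 0" using w \<pi>(3) by auto
  moreover have "AE \<omega> in (\<Pi>\<^sub>M i\<in>{..<n}. \<mu>). proportional_to (\<pi> ** adj (W \<omega> n) ** W \<omega> n ** \<pi>) \<pi>" for n
  proof -
    obtain C where C: "quad_bounded C (gram_gap w)" using avg_pow_gram_gap(2)[OF w] by blast
    have "(\<integral>\<^sup>+ \<omega>. ennreal (gram_gap w (W \<omega> n ** w)) \<partial>(\<Pi>\<^sub>M i\<in>{..<n}. \<mu>)) = 0"
      by (subst nn_integral_avg_pow[OF C]) (simp_all add: gram_gap_def[of w "_ ** _"] avg_pow_gram_gap[OF w] eq, simp add: gram_gap_def)
    moreover have "(\<lambda>\<omega>. ennreal (gram_gap w (W \<omega> n ** w))) \<in> borel_measurable (\<Pi>\<^sub>M i\<in>{..<n}. \<mu>)"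
    proof -
      have [measurable]: "(\<lambda>\<omega>. W \<omega> n) \<in> borel_measurable (\<Pi>\<^sub>M i\<in>{..<n}. \<mu>)"
        by (rule W_measurable) (auto simp: sets_mu)
      show ?thesis using quad_boundedD(1)[OF C] by measurable
    qed
    ultimately have "AE \<omega> in (\<Pi>\<^sub>M i\<in>{..<n}. \<mu>). ennreal (gram_gap w (W \<omega> n ** w)) = 0"
      by (subst (asm) nn_integral_0_iff_AE) auto
    then show ?thesis
    proof eventually_elim
      case (elim \<omega>)
      define u where "u = W \<omega> n ** w"
      define c where "c = (norm u)\<^sup>2 / (norm w)\<^sup>2"
      have "gram_gap w u = 0" using elim by (simp add: u_def gram_gap_def)
      then have Z: "adj u ** u = c *\<^sub>R (adj w ** w)"
      proof (cases "u = 0")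
        case True
        then show ?thesis by (simp add: c_def matrix_matrix_mult_def vec_eq_iff)
      next
        case False
        then have "(1 / (norm u)\<^sup>2) *\<^sub>R (adj u ** u) = (1 / (norm w)\<^sup>2) *\<^sub>R (adj w ** w)"
          using \<open>gram_gap w u = 0\<close> by (simp add: gram_gap_def)
        then have "(norm u)\<^sup>2 *\<^sub>R ((1 / (norm u)\<^sup>2) *\<^sub>R (adj u ** u)) = (norm u)\<^sup>2 *\<^sub>R ((1 / (norm w)\<^sup>2) *\<^sub>R (adj w ** w))"
          by simp
        then show ?thesis using False by (simp add: c_def)
      qed
      have "\<pi> ** adj (W \<omega> n) ** W \<omega> n ** \<pi> = adj K ** (adj u ** u) ** K"
      proof -
        have "\<pi> ** A ** B ** \<pi> = (adj K ** adj w) ** A ** B ** (w ** K)" for A B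
          by (simp only: adj_\<pi>[symmetric] \<pi>(2)[symmetric])
        then show ?thesis by (simp add: u_def adj_mult matrix_mul_assoc)
      qed
      also have "\<dots> = c *\<^sub>R (adj K ** (adj w ** w) ** K)"
        unfolding Z by (simp only: matrix_mult_scaleR)
      also have "adj K ** (adj w ** w) ** K = (adj K ** adj w) ** (w ** K)" by (simp add: matrix_mul_assoc)
      also have "\<dots> = \<pi>" unfolding adj_\<pi>[symmetric] \<pi>(2)[symmetric] pp ..
      finally have "\<pi> ** adj (W \<omega> n) ** W \<omega> n ** \<pi> = map_matrix ((*) (complex_of_real c)) \<pi>"
        by (simp add: map_matrix_def vec_eq_iff scaleR_conv_of_real[where 'a = complex])
      then show ?case unfolding proportional_to_def by blast
    qed
  qed
  ultimately have "rank \<pi> = 1" using pur \<pi>(1) by (auto simp: purifying_def)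
  then obtain a b where ab: "\<And>k i. \<pi> $ k $ i = a $ k * b $ i" by (rule rank_one_columns) blast
  have "w $ k $ i = a $ k * (\<chi> i. \<Sum>l\<in>UNIV. b $ l * w $ l $ i) $ i" for k i
    using arg_cong[OF \<pi>(3)[symmetric], of "\<lambda>A. A $ k $ i"]
    by (simp add: matrix_matrix_mult_def ab sum_distrib_left mult.assoc)
  then show ?thesis by (rule purity_rank_one)
qed

end

text \<open>In singular values: twice the second elementary symmetric function of their squares,
  divided by the sum of their squares. It vanishes exactly when the rank is at most one.\<close>

definition defect :: "complex ^ 'd::finite ^ 'd \<Rightarrow> real" where
  "defect w = (norm w)\<^sup>2 - purity w"

lemma defect_nonneg: "defect w \<ge> 0"
  by (simp add: defect_def purity_le)

lemma quad_bounded_defect: "quad_bounded 1 defect"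
  unfolding quad_bounded_def
  using purity_nonneg defect_nonneg by (auto simp: defect_def[abs_def] abs_of_nonneg purity_le)

lemma purity_scaleR: "purity (r *\<^sub>R w) = r\<^sup>2 * purity w"
proof (cases "r = 0")
  case False
  have "adj (r *\<^sub>R w) = r *\<^sub>R adj w" by (simp add: adj_def vec_eq_iff)
  then have "adj (r *\<^sub>R w) ** (r *\<^sub>R w) = r\<^sup>2 *\<^sub>R (adj w ** w)"
    by (simp only: matrix_mult_scaleR) (simp add: power2_eq_square)
  then have "(norm (adj (r *\<^sub>R w) ** (r *\<^sub>R w)))\<^sup>2 = r\<^sup>2 * (r\<^sup>2 * (norm (adj w ** w))\<^sup>2)"
    by (simp add: power_mult_distrib power2_eq_square[of "r\<^sup>2"] mult.assoc)
  moreover have "(norm (r *\<^sub>R w))\<^sup>2 = r\<^sup>2 * (norm w)\<^sup>2" by (simp add: power_mult_distrib)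
  moreover have "r\<^sup>2 \<noteq> 0" using False by simp
  ultimately show ?thesis unfolding purity_def by (simp only: mult_divide_mult_cancel_left times_divide_eq_right simp_thms)
qed (simp add: purity_def)

lemma lagrange_identity:
  fixes a b :: "complex ^ 'd::finite"
  shows "(\<Sum>k\<in>UNIV. \<Sum>l\<in>UNIV. (cmod (a $ k * b $ l - a $ l * b $ k))\<^sup>2)
     = 2 * ((norm a)\<^sup>2 * (norm b)\<^sup>2 - (cmod (hinner a b))\<^sup>2)"
proof -
  have "complex_of_real (\<Sum>k\<in>UNIV. \<Sum>l\<in>UNIV. (cmod (a $ k * b $ l - a $ l * b $ k))\<^sup>2)
    = (\<Sum>k\<in>UNIV. \<Sum>l\<in>UNIV. (a $ k * b $ l - a $ l * b $ k) * cnj (a $ k * b $ l - a $ l * b $ k))"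
    by (simp only: of_real_sum complex_norm_square)
  also have "\<dots> = (\<Sum>k\<in>UNIV. \<Sum>l\<in>UNIV.
       (cnj (a $ k) * a $ k) * (cnj (b $ l) * b $ l) + (cnj (b $ k) * b $ k) * (cnj (a $ l) * a $ l)
     - (cnj (b $ k) * a $ k) * (cnj (a $ l) * b $ l) - (cnj (a $ k) * b $ k) * (cnj (b $ l) * a $ l))"
    by (intro sum.cong refl) (simp add: algebra_simps)
  also have "\<dots> = hinner a a * hinner b b + hinner b b * hinner a a - hinner b a * hinner a b - hinner a b * hinner b a"
    by (simp only: sum.distrib sum_subtractf sum_product[symmetric] hinner_def)
  also have "\<dots> = complex_of_real (2 * ((norm a)\<^sup>2 * (norm b)\<^sup>2 - (cmod (hinner a b))\<^sup>2))"
    by (simp add: hinner_self hinner_cnj[of b a] complex_norm_square[symmetric] mult.commute[of "cnj _"] del: of_real_power)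
  finally show ?thesis by (simp only: of_real_eq_iff)
qed

text \<open>Each summand is the squared area spanned by \<open>column i w\<close> and
  \<open>w *v x\<close>. As \<open>w *v x\<close> combines the columns with the coefficients of a
  unit vector, Cauchy-Schwarz bounds it by the squared areas spanned with all columns, and these add
  up to \<open>(norm w)^2 * defect w\<close>.\<close>

lemma sum_wedge_le_defect:
  fixes w :: "complex ^ 'd::finite ^ 'd"
  assumes x: "norm x = 1"
  shows "(\<Sum>i\<in>UNIV. (norm (column i w))\<^sup>2 * (norm (w *v x))\<^sup>2 - (cmod (hinner (column i w) (w *v x)))\<^sup>2)
      \<le> (norm w)\<^sup>2 * defect w"
proof -
  define c where "c i = column i w" for i
  let ?w = "\<lambda>a b k l. a $ k * b $ l - a $ l * (b $ k :: complex)"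
  have wx: "(w *v x) $ k = (\<Sum>j\<in>UNIV. c j $ k * x $ j)" for k
    by (simp add: matrix_vector_mult_def c_def column_def)
  \<comment> \<open>Cauchy-Schwarz is applied to each coordinate \<open>k\<close>, \<open>l\<close>
    of the wedge product separately.\<close>
  have pt: "(cmod (?w (c i) (w *v x) k l))\<^sup>2 \<le> (\<Sum>j\<in>UNIV. (cmod (?w (c i) (c j) k l))\<^sup>2)" for i k l
  proof -
    define z where "z = (\<chi> j. cnj (?w (c i) (c j) k l))"
    have "?w (c i) (w *v x) k l = hinner z x"
      by (simp add: wx z_def hinner_def sum_distrib_left sum_subtractf[symmetric] algebra_simps)
    then have "cmod (?w (c i) (w *v x) k l) \<le> norm z" using hinner_cauchy_schwarz[of z x] x by simp
    then have "(cmod (?w (c i) (w *v x) k l))\<^sup>2 \<le> (norm z)\<^sup>2" by (intro power_mono) auto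
    also have "(norm z)\<^sup>2 = (\<Sum>j\<in>UNIV. (cmod (?w (c i) (c j) k l))\<^sup>2)"
      unfolding norm_sq_vec z_def by (simp only: vec_lambda_beta complex_mod_cnj)
    finally show ?thesis .
  qed
  have "2 * (\<Sum>i\<in>UNIV. (norm (c i))\<^sup>2 * (norm (w *v x))\<^sup>2 - (cmod (hinner (c i) (w *v x)))\<^sup>2)
      = (\<Sum>i\<in>UNIV. \<Sum>k\<in>UNIV. \<Sum>l\<in>UNIV. (cmod (?w (c i) (w *v x) k l))\<^sup>2)"
    unfolding lagrange_identity by (simp add: sum_distrib_left)
  also have "\<dots> \<le> (\<Sum>i\<in>UNIV. \<Sum>k\<in>UNIV. \<Sum>l\<in>UNIV. \<Sum>j\<in>UNIV. (cmod (?w (c i) (c j) k l))\<^sup>2)"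
    by (intro sum_mono pt)
  also have "\<dots> = (\<Sum>i\<in>UNIV. \<Sum>j\<in>UNIV. \<Sum>k\<in>UNIV. \<Sum>l\<in>UNIV. (cmod (?w (c i) (c j) k l))\<^sup>2)"
  proof (rule sum.cong[OF refl])
    fix i
    have "(\<Sum>k\<in>UNIV. \<Sum>l\<in>UNIV. \<Sum>j\<in>UNIV. (cmod (?w (c i) (c j) k l))\<^sup>2)
      = (\<Sum>k\<in>UNIV. \<Sum>j\<in>UNIV. \<Sum>l\<in>UNIV. (cmod (?w (c i) (c j) k l))\<^sup>2)"
      by (intro sum.cong refl sum.swap)
    also have "\<dots> = (\<Sum>j\<in>UNIV. \<Sum>k\<in>UNIV. \<Sum>l\<in>UNIV. (cmod (?w (c i) (c j) k l))\<^sup>2)" by (rule sum.swap)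
    finally show "(\<Sum>k\<in>UNIV. \<Sum>l\<in>UNIV. \<Sum>j\<in>UNIV. (cmod (?w (c i) (c j) k l))\<^sup>2)
      = (\<Sum>j\<in>UNIV. \<Sum>k\<in>UNIV. \<Sum>l\<in>UNIV. (cmod (?w (c i) (c j) k l))\<^sup>2)" .
  qed
  also have "\<dots> = (\<Sum>i\<in>UNIV. \<Sum>j\<in>UNIV. 2 * ((norm (c i))\<^sup>2 * (norm (c j))\<^sup>2 - (cmod (hinner (c i) (c j)))\<^sup>2))"
    unfolding lagrange_identity ..
  also have "\<dots> = 2 * ((\<Sum>i\<in>UNIV. (norm (c i))\<^sup>2) * (\<Sum>j\<in>UNIV. (norm (c j))\<^sup>2)
      - (\<Sum>i\<in>UNIV. \<Sum>j\<in>UNIV. (cmod (hinner (c i) (c j)))\<^sup>2))"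
    by (simp only: sum_distrib_left[symmetric] sum_subtractf sum_product)
  also have "(\<Sum>i\<in>UNIV. (norm (c i))\<^sup>2) = (norm w)\<^sup>2" unfolding c_def by (rule norm_sq_columns[symmetric])
  also have "(\<Sum>i\<in>UNIV. \<Sum>j\<in>UNIV. (cmod (hinner (c i) (c j)))\<^sup>2) = (norm (adj w ** w))\<^sup>2"
    unfolding norm_matrix_sq by (simp add: c_def column_def hinner_def matrix_matrix_mult_def adj_def)
  also have "(norm w)\<^sup>2 * (norm w)\<^sup>2 - (norm (adj w ** w))\<^sup>2 = (norm w)\<^sup>2 * defect w"
  proof (cases "w = 0")
    case True
    then have "adj w ** w = 0" by (simp add: matrix_matrix_mult_def vec_eq_iff)
    then show ?thesis using True by simp
  qed (simp add: defect_def purity_def right_diff_distrib)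
  finally show ?thesis by (simp add: c_def)
qed

section \<open>Decay of the defect of long products\<close>

context kraus_measure begin

lemma avg_pow_scaleR:
  fixes F :: "complex ^ 'd ^ 'd \<Rightarrow> real"
  assumes "\<And>r w. F (r *\<^sub>R w) = r\<^sup>2 * F w"
  shows "avg_pow n F (r *\<^sub>R w) = r\<^sup>2 * avg_pow n F w"
proof (induction n arbitrary: w)
  case (Suc n)
  then show ?case by (simp add: avg_def matrix_mult_scaleR)
qed (simp add: assms)

text \<open>Away from rank one the gain in purity is uniform. Otherwise there are unit matrices
  whose gain after \<open>m\<close> steps is below \<open>1 / Suc m\<close>; the gain is monotone in
  the number of steps, so a limit point never gains anything and has rank one by (Pur).\<close>

lemma purity_gap_compact:
  assumes pur: "purifying \<mu>" and \<delta>: "\<delta> > 0"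
  obtains m \<eta> where "\<eta> > 0"
    "\<And>w :: complex ^ 'd ^ 'd. norm w = 1 \<Longrightarrow> defect w \<ge> \<delta> \<Longrightarrow> avg_pow m purity w - purity w \<ge> \<eta>"
proof (rule ccontr)
  assume nt: "\<not> thesis"
  have "\<exists>w :: complex ^ 'd ^ 'd. norm w = 1 \<and> defect w \<ge> \<delta> \<and> avg_pow m purity w - purity w < 1 / real (Suc m)" for m
  proof (rule ccontr)
    assume neg: "\<not> ?thesis"
    have thesis by (rule that[of "1 / real (Suc m)" m]) (use neg in \<open>auto simp: not_less\<close>)
    with nt show False by simp
  qed
  then obtain w :: "nat \<Rightarrow> complex ^ 'd ^ 'd" where
    w: "\<And>m. norm (w m) = 1" "\<And>m. defect (w m) \<ge> \<delta>" "\<And>m. avg_pow m purity (w m) - purity (w m) < 1 / real (Suc m)"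
    by metis
  have "bounded (range w)" using w(1) by (auto simp: bounded_iff)
  then obtain z r where r: "strict_mono r" and lim: "(w \<circ> r) \<longlonglongrightarrow> z"
    using bounded_imp_convergent_subsequence by blast
  have "(\<lambda>n. norm ((w \<circ> r) n)) \<longlonglongrightarrow> norm z" by (intro tendsto_norm lim)
  then have nz: "norm z = 1" using w(1) by (simp add: LIMSEQ_const_iff)
  have pz: "(\<lambda>n. purity ((w \<circ> r) n)) \<longlonglongrightarrow> purity z"
    by (rule continuous_on_tendsto_compose[OF continuous_on_purity lim]) auto
  have "avg_pow j purity z = purity z" for j
  proof (rule antisym)
    have "(\<lambda>n. avg_pow j purity ((w \<circ> r) n)) \<longlonglongrightarrow> avg_pow j purity z"
      by (rule continuous_on_tendsto_compose[OF continuous_on_avg_pow[OF quad_bounded_purity continuous_on_purity] lim]) auto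
    then have 1: "(\<lambda>n. avg_pow j purity ((w \<circ> r) n) - purity ((w \<circ> r) n)) \<longlonglongrightarrow> avg_pow j purity z - purity z"
      using pz by (rule tendsto_diff)
    have 2: "(\<lambda>n. 1 / real (Suc n)) \<longlonglongrightarrow> 0" by (rule LIMSEQ_Suc[OF lim_const_over_n])
    have "avg_pow j purity z - purity z \<le> 0"
    proof (rule LIMSEQ_le[OF 1 2], intro exI allI impI)
      fix n assume "j \<le> n"
      then have "j \<le> r n" using seq_suble[OF r, of n] by simp
      have "avg_pow j purity (w (r n)) - purity (w (r n)) \<le> avg_pow (r n) purity (w (r n)) - purity (w (r n))"
        using avg_pow_purity_mono[OF \<open>j \<le> r n\<close>] by simp
      also have "\<dots> \<le> 1 / real (Suc (r n))" using w(3)[of "r n"] by simp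
      also have "\<dots> \<le> 1 / real (Suc n)" using seq_suble[OF r, of n] by (intro divide_left_mono) auto
      finally show "avg_pow j purity ((w \<circ> r) n) - purity ((w \<circ> r) n) \<le> 1 / real (Suc n)" by simp
    qed
    then show "avg_pow j purity z \<le> purity z" by simp
  qed (rule avg_purity_ge)
  then have "purity z = (norm z)\<^sup>2" using nz by (intro purifying_imp_rank_one[OF pur]) auto
  moreover have "(\<lambda>n. (norm ((w \<circ> r) n))\<^sup>2 - purity ((w \<circ> r) n)) \<longlonglongrightarrow> (norm z)\<^sup>2 - purity z"
    by (intro tendsto_intros lim pz)
  then have "(norm z)\<^sup>2 - purity z \<ge> \<delta>"
    by (rule LIMSEQ_le_const) (use w(2) in \<open>auto simp: defect_def\<close>)
  ultimately show False using \<delta> by simp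
qed

text \<open>The averaged purity is increasing and bounded, so its gain over \<open>m\<close> further
  steps tends to 0, whereas on the unit sphere a defect of at least \<open>\<delta>\<close> forces a
  gain of at least \<open>\<eta>\<close>.\<close>

lemma avg_pow_defect_small:
  assumes pur: "purifying \<mu>" and \<epsilon>: "\<epsilon> > 0"
  obtains n where "avg_pow n defect (mat 1 :: complex ^ 'd ^ 'd) \<le> \<epsilon>"
proof -
  let ?I = "mat 1 :: complex ^ 'd ^ 'd"
  define \<delta> where "\<delta> = \<epsilon> / (2 * ((norm ?I)\<^sup>2 + 1))"
  have N: "(norm ?I)\<^sup>2 + 1 > 0" by (simp add: add_nonneg_pos)
  have \<delta>: "\<delta> > 0" using \<epsilon> N by (simp add: \<delta>_def)
  obtain m \<eta> where \<eta>: "\<eta> > 0" and gap: "\<And>w :: complex ^ 'd ^ 'd. norm w = 1 \<Longrightarrow> defect w \<ge> \<delta> \<Longrightarrow> avg_pow m purity w - purity w \<ge> \<eta>"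
    by (rule purity_gap_compact[OF pur \<delta>]) blast
  \<comment> \<open>On the unit sphere the defect is below \<open>\<delta>\<close> or paid for by
    the gain; homogeneity of degree two extends this to all \<open>w\<close>.\<close>
  have "defect w \<le> \<delta> * (norm w)\<^sup>2 + (1 / \<eta>) * (avg_pow m purity w - purity w)" for w :: "complex ^ 'd ^ 'd"
  proof (cases "w = 0")
    case True
    then show ?thesis using avg_purity_ge[of w m] \<eta> by (simp add: defect_def purity_def)
  next
    case False
    define u where "u = (1 / norm w) *\<^sub>R w"
    have u: "norm u = 1" "w = norm w *\<^sub>R u" using False by (auto simp: u_def)
    have "defect u \<le> \<delta> + (1 / \<eta>) * (avg_pow m purity u - purity u)"
    proof (cases "defect u \<ge> \<delta>")
      case True
      have "defect u \<le> 1" using u(1) purity_nonneg[of u] by (simp add: defect_def)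
      also have "1 \<le> (1 / \<eta>) * (avg_pow m purity u - purity u)" using gap[OF u(1) True] \<eta> by (simp add: field_simps)
      finally show ?thesis using \<delta> by simp
    next
      case False
      then show ?thesis using avg_purity_ge[of u m] \<eta> by (simp add: add_increasing2)
    qed
    then have "(norm w)\<^sup>2 * defect u \<le> (norm w)\<^sup>2 * (\<delta> + (1 / \<eta>) * (avg_pow m purity u - purity u))"
      by (intro mult_left_mono) auto
    moreover have "purity w = (norm w)\<^sup>2 * purity u" using purity_scaleR[of "norm w" u] u(2) by simp
    moreover have "avg_pow m purity w = (norm w)\<^sup>2 * avg_pow m purity u"
      using avg_pow_scaleR[OF purity_scaleR, of m "norm w" u] u(2) by simp
    moreover have "defect w = (norm w)\<^sup>2 * defect u" using \<open>purity w = _\<close> u(1) by (simp add: defect_def right_diff_distrib)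
    ultimately show ?thesis by (simp add: algebra_simps)
  qed
  note bound = this
  have qp: "quad_bounded 1 (avg_pow m purity)" by (intro quad_bounded_avg_pow quad_bounded_purity)
  note q1 = quad_bounded_diff[OF qp quad_bounded_purity]
  note q2 = quad_bounded_mult[OF q1, of "1 / \<eta>"]
  note q3 = quad_bounded_mult[OF quad_bounded_norm_sq, of \<delta>]
  have h1: "avg_pow n defect ?I \<le> \<delta> * (norm ?I)\<^sup>2 + (1 / \<eta>) * (avg_pow (n + m) purity ?I - avg_pow n purity ?I)" for n
  proof -
    have "avg_pow n defect ?I \<le> avg_pow n (\<lambda>w. \<delta> * (norm w)\<^sup>2 + (1 / \<eta>) * (avg_pow m purity w - purity w)) ?I"
      by (rule avg_pow_mono[OF quad_bounded_defect quad_bounded_add[OF q3 q2] bound])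
    also have "\<dots> = \<delta> * (norm ?I)\<^sup>2 + (1 / \<eta>) * (avg_pow n (avg_pow m purity) ?I - avg_pow n purity ?I)"
      unfolding avg_pow_add[OF q3 q2] avg_pow_mult[OF quad_bounded_norm_sq] avg_pow_norm_sq avg_pow_mult[OF q1]
        avg_pow_diff[OF qp quad_bounded_purity] ..
    finally show ?thesis by (simp add: funpow_add)
  qed
  obtain n where h2: "(1 / \<eta>) * (avg_pow (n + m) purity ?I - avg_pow n purity ?I) \<le> \<epsilon> / 2"
  proof -
    have "avg_pow n purity ?I \<le> (norm ?I)\<^sup>2" for n
      using avg_pow_mono[OF quad_bounded_purity quad_bounded_norm_sq purity_le, of n ?I] by (simp add: avg_pow_norm_sq)
    then have "convergent (\<lambda>n. avg_pow n purity ?I)"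
      by (intro Bseq_mono_convergent BseqI'[of _ "(norm ?I)\<^sup>2"])
         (auto intro: avg_pow_purity_mono simp: abs_of_nonneg[OF order_trans[OF purity_nonneg avg_purity_ge]])
    then obtain l where l: "(\<lambda>n. avg_pow n purity ?I) \<longlonglongrightarrow> l" by (auto simp: convergent_def)
    have "(\<lambda>n. (1 / \<eta>) * (avg_pow (n + m) purity ?I - avg_pow n purity ?I)) \<longlonglongrightarrow> (1 / \<eta>) * (l - l)"
      by (intro tendsto_mult tendsto_const tendsto_diff l LIMSEQ_ignore_initial_segment)
    then have "\<forall>\<^sub>F n in sequentially. (1 / \<eta>) * (avg_pow (n + m) purity ?I - avg_pow n purity ?I) < \<epsilon> / 2"
      by (rule order_tendstoD(2)) (use \<epsilon> in simp)
    then obtain n where "(1 / \<eta>) * (avg_pow (n + m) purity ?I - avg_pow n purity ?I) < \<epsilon> / 2"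
      by (auto simp: eventually_sequentially)
    then show ?thesis using that by (meson less_imp_le)
  qed
  have h3: "\<delta> * (norm ?I)\<^sup>2 \<le> \<epsilon> / 2"
    using \<epsilon> N by (simp add: \<delta>_def field_simps)
  have "avg_pow n defect ?I \<le> \<epsilon>" using h1[of n] h2 h3 by linarith
  then show ?thesis by (rule that)
qed

end

section \<open>Uniform convergence of Cesaro averages\<close>

text \<open>A stand-in for the value of \<open>f\<close> at the range of \<open>w\<close> that makes
  sense at every rank and is independent of the vector \<open>x\<close>. A zero column has weight 0,
  which hides its unspecified class.\<close>

definition column_average :: "('d::finite cproj \<Rightarrow> real) \<Rightarrow> complex ^ 'd ^ 'd \<Rightarrow> real" where
  "column_average f w = (\<Sum>i\<in>UNIV. f (proj_class (column i w)) * (norm (column i w))\<^sup>2) / (norm w)\<^sup>2"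

definition weighted_value :: "('d::finite cproj \<Rightarrow> real) \<Rightarrow> complex ^ 'd \<Rightarrow> complex ^ 'd ^ 'd \<Rightarrow> real" where
  "weighted_value f x w = f (proj_class (w *v x)) * (norm (w *v x))\<^sup>2"

lemma abs_column_average_le:
  assumes "\<And>p. \<bar>f p\<bar> \<le> K"
  shows "\<bar>column_average f w\<bar> \<le> K"
proof (cases "w = 0")
  case True
  have "0 \<le> K" using assms[of undefined] by linarith
  then show ?thesis using True by (simp add: column_average_def)
next
  case False
  have "\<bar>\<Sum>i\<in>UNIV. f (proj_class (column i w)) * (norm (column i w))\<^sup>2\<bar>
     \<le> (\<Sum>i\<in>UNIV. \<bar>f (proj_class (column i w)) * (norm (column i w))\<^sup>2\<bar>)" by (rule sum_abs)
  also have "\<dots> \<le> (\<Sum>i\<in>UNIV. K * (norm (column i w))\<^sup>2)"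
    by (intro sum_mono) (simp add: abs_mult mult_right_mono assms)
  also have "\<dots> = K * (norm w)\<^sup>2" by (simp add: sum_distrib_left[symmetric] norm_sq_columns[of w])
  finally show ?thesis using False by (simp add: column_average_def divide_le_eq)
qed

lemma column_measurable [measurable]: "column i \<in> borel_measurable (borel :: (complex ^ 'd::finite ^ 'd) measure)"
proof -
  have "(\<lambda>w :: complex ^ 'd ^ 'd. w *v axis i 1) \<in> borel_measurable borel" by measurable
  then show ?thesis by (simp add: mult_axis)
qed

lemma column_average_measurable:
  assumes [measurable]: "f \<in> borel_measurable borel"
  shows "column_average f \<in> borel_measurable borel"
  unfolding column_average_def by measurable

text \<open>The squared distance between the lines of \<open>w *v x\<close> and of a column, times
  the squared norms, is the area controlled by \<open>sum_wedge_le_defect\<close>; this is why the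
  modulus of \<open>f\<close> is taken quadratic.\<close>

lemma weighted_value_approx:
  assumes f: "\<And>p q. \<bar>f p - f q\<bar> \<le> \<epsilon> + C * (dist p q)\<^sup>2" and \<epsilon>: "\<epsilon> \<ge> 0" and C: "C \<ge> 0" and x: "norm x = 1"
  shows "\<bar>weighted_value f x w - column_average f w * (norm (w *v x))\<^sup>2\<bar> \<le> \<epsilon> * (norm (w *v x))\<^sup>2 + C * defect w"
proof (cases "w = 0")
  case True
  then show ?thesis by (simp add: weighted_value_def column_average_def defect_def purity_def)
next
  case False
  define y where "y = w *v x"
  define c where "c i = column i w" for i
  have w0: "(norm w)\<^sup>2 > 0" using False by simp
  have cs: "(\<Sum>i\<in>UNIV. (norm (c i))\<^sup>2) = (norm w)\<^sup>2" unfolding c_def by (rule norm_sq_columns[symmetric])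
  have pt: "\<bar>(f (proj_class y) - f (proj_class (c i))) * ((norm (c i))\<^sup>2 * (norm y)\<^sup>2)\<bar>
     \<le> \<epsilon> * ((norm (c i))\<^sup>2 * (norm y)\<^sup>2) + C * ((norm (c i))\<^sup>2 * (norm y)\<^sup>2 - (cmod (hinner (c i) y))\<^sup>2)" for i
  proof (cases "c i = 0 \<or> y = 0")
    case False
    then have p: "(norm (c i))\<^sup>2 * (norm y)\<^sup>2 > 0" by simp
    have "\<bar>(f (proj_class y) - f (proj_class (c i))) * ((norm (c i))\<^sup>2 * (norm y)\<^sup>2)\<bar> =
      \<bar>f (proj_class y) - f (proj_class (c i))\<bar> * ((norm (c i))\<^sup>2 * (norm y)\<^sup>2)"
      by (simp add: abs_mult)
    also have "\<dots> \<le> (\<epsilon> + C * (dist (proj_class (c i)) (proj_class y))\<^sup>2) * ((norm (c i))\<^sup>2 * (norm y)\<^sup>2)"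
      using f[of "proj_class y" "proj_class (c i)"] by (intro mult_right_mono) (auto simp: dist_commute)
    also have "(dist (proj_class (c i)) (proj_class y))\<^sup>2 = 1 - (cmod (hinner (c i) y))\<^sup>2 / ((norm (c i))\<^sup>2 * (norm y)\<^sup>2)"
      using False by (intro dist_proj_class) auto
    also have "(\<epsilon> + C * (1 - (cmod (hinner (c i) y))\<^sup>2 / ((norm (c i))\<^sup>2 * (norm y)\<^sup>2))) * ((norm (c i))\<^sup>2 * (norm y)\<^sup>2)
       = \<epsilon> * ((norm (c i))\<^sup>2 * (norm y)\<^sup>2) + C * ((norm (c i))\<^sup>2 * (norm y)\<^sup>2 - (cmod (hinner (c i) y))\<^sup>2)"
      using p by (simp add: field_simps)
    finally show ?thesis .
  qed auto
  have "(norm w)\<^sup>2 * (weighted_value f x w - column_average f w * (norm y)\<^sup>2)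
      = f (proj_class y) * (norm y)\<^sup>2 * (norm w)\<^sup>2 - (\<Sum>i\<in>UNIV. f (proj_class (c i)) * (norm (c i))\<^sup>2) * (norm y)\<^sup>2"
    using w0 by (simp add: weighted_value_def column_average_def y_def c_def field_simps)
  also have "\<dots> = (\<Sum>i\<in>UNIV. (f (proj_class y) - f (proj_class (c i))) * ((norm (c i))\<^sup>2 * (norm y)\<^sup>2))"
    unfolding cs[symmetric] by (simp add: sum_distrib_left sum_distrib_right sum_subtractf[symmetric] algebra_simps)
  finally have "\<bar>(norm w)\<^sup>2 * (weighted_value f x w - column_average f w * (norm y)\<^sup>2)\<bar>
     \<le> (\<Sum>i\<in>UNIV. \<epsilon> * ((norm (c i))\<^sup>2 * (norm y)\<^sup>2) + C * ((norm (c i))\<^sup>2 * (norm y)\<^sup>2 - (cmod (hinner (c i) y))\<^sup>2))"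
    using order_trans[OF sum_abs sum_mono[OF pt]] by simp
  also have "\<dots> = \<epsilon> * ((\<Sum>i\<in>UNIV. (norm (c i))\<^sup>2) * (norm y)\<^sup>2) +
      C * (\<Sum>i\<in>UNIV. (norm (c i))\<^sup>2 * (norm y)\<^sup>2 - (cmod (hinner (c i) y))\<^sup>2)"
    by (simp only: sum.distrib sum_distrib_left sum_distrib_right)
  also have "\<dots> \<le> \<epsilon> * ((norm w)\<^sup>2 * (norm y)\<^sup>2) + C * ((norm w)\<^sup>2 * defect w)"
    unfolding cs using sum_wedge_le_defect[OF x, of w] C by (intro add_left_mono mult_left_mono) (auto simp: c_def y_def)
  also have "\<dots> = (norm w)\<^sup>2 * (\<epsilon> * (norm y)\<^sup>2 + C * defect w)" by (simp add: algebra_simps)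
  finally show ?thesis using w0 by (simp add: abs_mult y_def)
qed

text \<open>Below the distance \<open>d\<close> of uniform continuity the term
  \<open>\<epsilon>\<close> suffices; beyond it the quadratic term exceeds the total oscillation
  \<open>2 * K\<close>.\<close>

lemma uniform_modulus:
  fixes f :: "'d::finite cproj \<Rightarrow> real"
  assumes f: "continuous_on UNIV f" and \<epsilon>: "\<epsilon> > 0"
  obtains C where "C \<ge> 0" "\<And>p q. \<bar>f p - f q\<bar> \<le> \<epsilon> + C * (dist p q)\<^sup>2"
proof -
  obtain K where K: "K \<ge> 0" "\<And>p. \<bar>f p\<bar> \<le> K" using bounded_borelE[OF bounded_borel_continuous[OF f]] by blast
  have "uniformly_continuous_on UNIV f" using compact_uniformly_continuous[OF f compact_cproj] .
  then obtain d where d: "d > 0" "\<And>p q. dist p q < d \<Longrightarrow> \<bar>f p - f q\<bar> < \<epsilon>"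
    using \<epsilon> unfolding uniformly_continuous_on_def dist_real_def by (metis UNIV_I)
  have "\<bar>f p - f q\<bar> \<le> \<epsilon> + (2 * K / d\<^sup>2) * (dist p q)\<^sup>2" for p q
  proof (cases "dist p q < d")
    case True
    then have "\<bar>f p - f q\<bar> \<le> \<epsilon>" using d(2) by (simp add: less_imp_le)
    moreover have "0 \<le> (2 * K / d\<^sup>2) * (dist p q)\<^sup>2" using K(1) by simp
    ultimately show ?thesis by linarith
  next
    case False
    then have "d\<^sup>2 \<le> (dist p q)\<^sup>2" using d(1) by (intro power_mono) auto
    then have "2 * K \<le> (2 * K / d\<^sup>2) * (dist p q)\<^sup>2"
      using K(1) d(1) by (simp add: field_simps mult_left_mono)
    moreover have "\<bar>f p - f q\<bar> \<le> 2 * K" using K(2)[of p] K(2)[of q] by linarith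
    ultimately show ?thesis using \<epsilon> by linarith
  qed
  then show ?thesis using K(1) by (intro that[of "2 * K / d\<^sup>2"]) auto
qed

section \<open>Reduction to quadratic forms, and uniform averages\<close>

context kraus_measure begin

text \<open>The weight makes the value at \<open>w *v x\<close> homogeneous, so that powers of the
  kernel become averages over matrix products, and the averaging itself does not involve
  \<open>x\<close>.\<close>

lemma avg_weighted_value: "avg (weighted_value f x) = weighted_value (kernel_op \<mu> f) x"
proof
  fix w :: "complex ^ 'd ^ 'd"
  show "avg (weighted_value f x) w = weighted_value (kernel_op \<mu> f) x w"
  proof (cases "w *v x = 0")
    case True
    then show ?thesis by (simp add: avg_def weighted_value_def matrix_vector_mul_assoc[symmetric])
  next
    case False
    have "avg (weighted_value f x) w = (\<integral>v. f (proj_act v (proj_class (w *v x))) * (norm (v *v unit_rep (proj_class (w *v x))))\<^sup>2 * (norm (w *v x))\<^sup>2 \<partial>\<mu>)"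
      unfolding avg_def weighted_value_def using False
      by (simp add: proj_act_proj_class matrix_vector_mul_assoc[symmetric] power_divide)
    then show ?thesis by (simp add: weighted_value_def kernel_op_def)
  qed
qed

lemma avg_pow_weighted_value: "avg_pow n (weighted_value f x) = weighted_value (kernel_pow n f) x"
  by (induction n) (simp_all add: avg_weighted_value)

lemma quad_bounded_weighted_value:
  assumes f: "bounded_borel f" and x: "norm x = 1"
  shows "\<exists>C. quad_bounded C (weighted_value f x)"
proof -
  note [measurable] = bounded_borelD[OF f]
  obtain K where K: "K \<ge> 0" "\<And>p. \<bar>f p\<bar> \<le> K" using bounded_borelE[OF f] by blast
  have "norm (weighted_value f x w) \<le> K * (norm w)\<^sup>2" for w
  proof -
    have "(norm (w *v x))\<^sup>2 \<le> (norm w)\<^sup>2" using norm_matrix_vector_le[of w x] x by (intro power_mono) auto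
    then show ?thesis using K by (simp add: weighted_value_def abs_mult mult_mono)
  qed
  moreover have "weighted_value f x \<in> borel_measurable borel" unfolding weighted_value_def by measurable
  ultimately show ?thesis by (auto simp: quad_bounded_def)
qed

text \<open>When \<open>w\<close> is close to rank one, the line \<open>w x\<close> hardly depends on \<open>x\<close>, so that \<open>f\<close> of it can be
  replaced by an average over the columns of \<open>w\<close>; what remains is a quadratic form in \<open>x\<close>.\<close>

lemma kernel_pow_near_qform:
  assumes pur: "purifying \<mu>" and f: "continuous_on UNIV f" and \<epsilon>: "\<epsilon> > 0"
  obtains m B where "\<And>p. \<bar>kernel_pow m f p - qform B (unit_rep p)\<bar> \<le> \<epsilon>"
proof -
  have bf: "bounded_borel f" by (rule bounded_borel_continuous[OF f])
  obtain K where K: "K \<ge> 0" "\<And>p. \<bar>f p\<bar> \<le> K" using bounded_borelE[OF bf] by blast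
  obtain C where C: "C \<ge> 0" "\<And>p q. \<bar>f p - f q\<bar> \<le> \<epsilon> / 2 + C * (dist p q)\<^sup>2"
    using uniform_modulus[OF f, of "\<epsilon> / 2"] \<epsilon> by auto
  \<comment> \<open>The error of the approximation is \<open>\<epsilon> / 2\<close> plus
    \<open>C\<close> times the averaged defect; the \<open>+ 1\<close> guards against
    \<open>C = 0\<close>.\<close>
  obtain m where m: "avg_pow m defect (mat 1 :: complex ^ 'd ^ 'd) \<le> \<epsilon> / (2 * (C + 1))"
    using avg_pow_defect_small[OF pur, of "\<epsilon> / (2 * (C + 1))"] \<epsilon> C(1) by auto
  \<comment> \<open>Matrix-valued, so that averaging \<open>F\<close> yields one matrix
    \<open>B\<close> that serves all \<open>x\<close> at once.\<close>
  define F where "F w = column_average f w *\<^sub>R (adj w ** w)" for w :: "complex ^ 'd ^ 'd"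
  have qF: "quad_bounded K F"
  proof -
    have "norm (F w) \<le> K * (norm w)\<^sup>2" for w
      using abs_column_average_le[OF K(2), where w = w] norm_matrix_mult_le[of "adj w" w] K(1)
      by (auto simp: F_def power2_eq_square intro!: mult_mono)
    moreover have "F \<in> borel_measurable borel" unfolding F_def
      using column_average_measurable[OF bounded_borelD[OF bf]] by measurable
    ultimately show ?thesis by (simp add: quad_bounded_def)
  qed
  have "\<bar>kernel_pow m f p - qform (avg_pow m F (mat 1)) (unit_rep p)\<bar> \<le> \<epsilon>" for p
  proof -
    define x where "x = unit_rep p"
    have x: "norm x = 1" "proj_class x = p" by (simp_all add: x_def unit_rep)
    have bl: "bounded_linear (\<lambda>A :: complex ^ 'd ^ 'd. qform A x)"
    proof -
      have "linear (\<lambda>A :: complex ^ 'd ^ 'd. qform A x)"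
        using qform_sum[of "\<lambda>b. if b then _ else _" "{True, False}" x]
        by (intro linearI) (simp_all add: qform_scaleR)
      then show ?thesis by (simp add: linear_conv_bounded_linear)
    qed
    have F_eq: "qform (F w) x = column_average f w * (norm (w *v x))\<^sup>2" for w
      by (simp add: F_def qform_scaleR) (simp add: qform_def matrix_vector_mul_assoc[symmetric] hinner_adj[symmetric] hinner_self)
    obtain D where D: "quad_bounded D (weighted_value f x)" using quad_bounded_weighted_value[OF bf x(1)] by blast
    obtain E where E: "quad_bounded E (\<lambda>w. qform (F w) x)" by (rule quad_bounded_linear[OF bl qF])
    note q1 = quad_bounded_diff[OF D E]
    have q2: "quad_bounded 1 (\<lambda>w :: complex ^ 'd ^ 'd. (norm (w *v x))\<^sup>2)"
    proof -
      have "(norm (w *v x))\<^sup>2 \<le> (norm w)\<^sup>2" for w :: "complex ^ 'd ^ 'd"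
        using norm_matrix_vector_le[of w x] x(1) by (intro power_mono) auto
      then show ?thesis by (simp add: quad_bounded_def)
    qed
    note q3 = quad_bounded_add[OF quad_bounded_mult[OF q2, of "\<epsilon> / 2"] quad_bounded_mult[OF quad_bounded_defect, of C]]
    have nx: "avg_pow m (\<lambda>w. (norm (w *v x))\<^sup>2) (mat 1) = 1"
    proof -
      have "(\<lambda>w :: complex ^ 'd ^ 'd. (norm (w *v x))\<^sup>2) = weighted_value (\<lambda>_. 1) x" by (simp add: weighted_value_def fun_eq_iff)
      moreover have "kernel_op \<mu> (\<lambda>_. 1) = (\<lambda>_. 1)" by (auto simp: fun_eq_iff)
      then have "kernel_pow m (\<lambda>_. 1) = (\<lambda>_. 1)" by (induction m) simp_all
      ultimately show ?thesis using x(1) by (simp only: avg_pow_weighted_value) (simp add: weighted_value_def)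
    qed
    have "\<bar>avg_pow m (\<lambda>w. weighted_value f x w - qform (F w) x) (mat 1)\<bar>
       \<le> avg_pow m (\<lambda>w. \<epsilon> / 2 * (norm (w *v x))\<^sup>2 + C * defect w) (mat 1)"
      by (rule avg_pow_abs_le[OF q1 q3]) (use weighted_value_approx[OF C(2) _ C(1) x(1)] \<epsilon> in \<open>simp add: F_eq\<close>)
    also have "\<dots> = \<epsilon> / 2 * 1 + C * avg_pow m defect (mat 1)"
      unfolding avg_pow_add[OF quad_bounded_mult[OF q2] quad_bounded_mult[OF quad_bounded_defect]]
        avg_pow_mult[OF q2] avg_pow_mult[OF quad_bounded_defect] nx ..
    also have "C * avg_pow m defect (mat 1) \<le> C * (\<epsilon> / (2 * (C + 1)))" by (intro mult_left_mono m C)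
    also have "\<dots> \<le> \<epsilon> / 2" using C(1) \<epsilon> by (simp add: field_simps)
    finally have "\<bar>avg_pow m (\<lambda>w. weighted_value f x w - qform (F w) x) (mat 1)\<bar> \<le> \<epsilon>" by simp
    moreover have "avg_pow m (weighted_value f x) (mat 1) = kernel_pow m f p"
      unfolding avg_pow_weighted_value using x by (simp add: weighted_value_def)
    ultimately show ?thesis
      unfolding avg_pow_diff[OF D E] avg_pow_linear[OF bl qF] by (simp add: x_def)
  qed
  then show ?thesis by (rule that)
qed

text \<open>Invariance is given on sets. To reach functions, \<open>J\<close> is formed as the joint
  law of the line and the next matrix; its image under the action is \<open>\<nu>\<close>, and
  Fubini gives the rest.\<close>

lemma integral_invariant:
  assumes inv: "invariant_prob \<mu> \<nu>" and f: "bounded_borel f"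
  shows "(\<integral>p. kernel_op \<mu> f p \<partial>\<nu>) = (\<integral>p. f p \<partial>\<nu>)"
proof -
  have \<nu>: "prob_space \<nu>" and sets_\<nu> [measurable_cong]: "sets \<nu> = sets borel"
    using inv by (auto simp: invariant_prob_def proj_prob_def)
  interpret \<nu>: prob_space \<nu> by fact
  interpret pair: pair_sigma_finite \<nu> \<mu> ..
  note [measurable] = bounded_borelD[OF f]
  define wt where "wt = (\<lambda>(p, v :: complex ^ 'd ^ 'd). ennreal ((norm (v *v unit_rep p))\<^sup>2))"
  have wt [measurable]: "wt \<in> borel_measurable (\<nu> \<Otimes>\<^sub>M \<mu>)" unfolding wt_def by measurable
  define J where "J = density (\<nu> \<Otimes>\<^sub>M \<mu>) wt"
  have act [measurable]: "(\<lambda>(p, v). proj_act v p) \<in> borel_measurable (\<nu> \<Otimes>\<^sub>M \<mu>)" by measurable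
  have "distr J borel (\<lambda>(p, v). proj_act v p) = \<nu>"
  proof (rule measure_eqI)
    show "sets (distr J borel (\<lambda>(p, v). proj_act v p)) = sets \<nu>" by (simp add: sets_\<nu>)
    fix S assume "S \<in> sets (distr J borel (\<lambda>(p, v). proj_act v p))"
    then have S [measurable]: "S \<in> sets borel" by simp
    have "emeasure (distr J borel (\<lambda>(p, v). proj_act v p)) S = emeasure J ((\<lambda>(p, v). proj_act v p) -` S \<inter> space J)"
      by (rule emeasure_distr) (auto simp: J_def)
    also have "\<dots> = (\<integral>\<^sup>+ z. wt z * indicator ((\<lambda>(p, v). proj_act v p) -` S \<inter> space (\<nu> \<Otimes>\<^sub>M \<mu>)) z \<partial>(\<nu> \<Otimes>\<^sub>M \<mu>))"
      unfolding J_def by (simp add: emeasure_density measurable_sets[OF act])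
    also have "\<dots> = (\<integral>\<^sup>+ z. indicator S (proj_act (snd z) (fst z)) * wt z \<partial>(\<nu> \<Otimes>\<^sub>M \<mu>))"
      by (intro nn_integral_cong) (auto simp: indicator_def)
    also have "\<dots> = (\<integral>\<^sup>+ p. \<integral>\<^sup>+ v. indicator S (proj_act (snd (p, v)) (fst (p, v))) * wt (p, v) \<partial>\<mu> \<partial>\<nu>)"
      by (rule nn_integral_fst[symmetric]) measurable
    also have "\<dots> = (\<integral>\<^sup>+ p. kernel \<mu> p S \<partial>\<nu>)" by (simp add: kernel_def wt_def)
    also have "\<dots> = emeasure \<nu> S" using inv S by (simp add: invariant_prob_def)
    finally show "emeasure (distr J borel (\<lambda>(p, v). proj_act v p)) S = emeasure \<nu> S" .
  qed
  note J = this
  interpret J: prob_space J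
  proof
    have "emeasure J (space J) = emeasure (distr J borel (\<lambda>(p, v). proj_act v p)) UNIV"
      by (subst emeasure_distr) (auto simp: J_def)
    then show "emeasure J (space J) = 1"
      unfolding J using \<nu>.emeasure_space_1 sets_eq_imp_space_eq[OF sets_\<nu>] by simp
  qed
  obtain K where K: "\<And>p. \<bar>f p\<bar> \<le> K" using bounded_borelE[OF f] by blast
  have "(\<integral>p. f p \<partial>\<nu>) = (\<integral>z. f (proj_act (snd z) (fst z)) \<partial>J)"
    by (subst J[symmetric], subst integral_distr) (auto simp: J_def case_prod_unfold)
  have iJ: "integrable J (\<lambda>z. f (proj_act (snd z) (fst z)))"
    by (rule J.integrable_const_bound[of _ K]) (auto simp: K J_def)
  have wt_eq: "wt = (\<lambda>z. ennreal ((norm (snd z *v unit_rep (fst z)))\<^sup>2))" by (auto simp: wt_def)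
  have i: "integrable (\<nu> \<Otimes>\<^sub>M \<mu>) (\<lambda>z. (norm (snd z *v unit_rep (fst z)))\<^sup>2 * f (proj_act (snd z) (fst z)))"
    using iJ unfolding J_def wt_eq by (subst (asm) integrable_density) auto
  have "(\<integral>z. f (proj_act (snd z) (fst z)) \<partial>J) = (\<integral>z. (norm (snd z *v unit_rep (fst z)))\<^sup>2 * f (proj_act (snd z) (fst z)) \<partial>(\<nu> \<Otimes>\<^sub>M \<mu>))"
    unfolding J_def wt_eq by (subst integral_density) auto
  also have "\<dots> = (\<integral>p. kernel_op \<mu> f p \<partial>\<nu>)"
    by (subst pair.integral_fst'[OF i, symmetric]) (simp add: kernel_op_def[abs_def] mult.commute)
  finally show ?thesis using \<open>(\<integral>p. f p \<partial>\<nu>) = _\<close> by simp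
qed

lemma integral_kernel_pow:
  assumes "invariant_prob \<mu> \<nu>" "bounded_borel f"
  shows "(\<integral>p. kernel_pow n f p \<partial>\<nu>) = (\<integral>p. f p \<partial>\<nu>)"
  by (induction n) (simp_all add: integral_invariant[OF assms(1) bounded_borel_kernel_pow[OF assms(2)]])

text \<open>The constant \<open>c\<close> supplied by the quadratic forms is identified last, by
  integrating the averages against the invariant law, which gives all of them the mean of
  \<open>f\<close>.\<close>

lemma cesaro_uniform:
  assumes pur: "purifying \<mu>" and erg: "ergodic_measure \<mu>" and inv: "invariant_prob \<mu> \<nu>"
    and f: "continuous_on UNIV f" and \<epsilon>: "\<epsilon> > 0"
  obtains n where "n > 0" "\<And>p. \<bar>(\<Sum>k<n. kernel_pow k f p) / real n - (\<integral>p. f p \<partial>\<nu>)\<bar> \<le> \<epsilon>"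
proof -
  have bf: "bounded_borel f" by (rule bounded_borel_continuous[OF f])
  obtain K where K: "K \<ge> 0" "\<And>p. \<bar>f p\<bar> \<le> K" using bounded_borelE[OF bf] by blast
  \<comment> \<open>Three errors \<open>e\<close> separate the averages from \<open>c\<close>: the
    approximation by a quadratic form, the time shift by \<open>m\<close>, and the Cesaro error of
    the form. Another \<open>3 * e\<close> separates \<open>c\<close> from the integral.\<close>
  define e where "e = \<epsilon> / 6"
  have e: "e > 0" using \<epsilon> by (simp add: e_def)
  obtain m B where mB: "\<And>p. \<bar>kernel_pow m f p - qform B (unit_rep p)\<bar> \<le> e"
    by (rule kernel_pow_near_qform[OF pur f e]) blast
  obtain c where c: "\<And>\<epsilon> N. \<epsilon> > 0 \<Longrightarrow> \<exists>n\<ge>N. n > 0 \<and>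
    (\<forall>x. norm x = 1 \<longrightarrow> \<bar>(\<Sum>k<n. qform ((dual_channel ^^ k) B) x) / real n - c\<bar> \<le> \<epsilon>)"
    by (rule ergodic_cesaro_qform[OF erg, of B]) blast
  \<comment> \<open>So large that the \<open>2 * m\<close> boundary terms of the shift by
    \<open>m\<close> contribute at most \<open>e\<close>.\<close>
  obtain n where n: "n \<ge> nat \<lceil>2 * real m * K / e\<rceil>" "n > 0"
    and cn: "\<And>x. norm x = 1 \<Longrightarrow> \<bar>(\<Sum>k<n. qform ((dual_channel ^^ k) B) x) / real n - c\<bar> \<le> e"
    using c[OF e] by blast
  have nm: "2 * real m * K / real n \<le> e"
  proof -
    have "2 * real m * K / e \<le> real n" using n(1) by linarith
    then show ?thesis using e n(2) by (simp add: field_simps)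
  qed
  \<comment> \<open>As a function of the line, the form depends linearly on
    \<open>line_of p\<close>, hence is continuous.\<close>
  have bq: "bounded_borel (\<lambda>p. qform B (unit_rep p))"
  proof -
    have "qform B (unit_rep p) = Re (\<Sum>i\<in>UNIV. \<Sum>j\<in>UNIV. B $ i $ j * line_of p $ j $ i)" for p :: "'d cproj"
      by (simp add: qform_def hinner_def matrix_vector_mult_def line_projector_def sum_distrib_left mult_ac)
    moreover have "continuous_on UNIV (\<lambda>p :: 'd cproj. Re (\<Sum>i\<in>UNIV. \<Sum>j\<in>UNIV. B $ i $ j * line_of p $ j $ i))"
      by (intro continuous_intros continuous_on_line_of)
    ultimately show ?thesis by (intro bounded_borel_continuous) simp
  qed
  have near: "\<bar>(\<Sum>k<n. kernel_pow k f p) / real n - c\<bar> \<le> 3 * e" for p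
  proof -
    have 1: "\<bar>kernel_pow k (kernel_pow m f) p - qform ((dual_channel ^^ k) B) (unit_rep p)\<bar> \<le> e" for k
    proof -
      have "\<bar>kernel_pow k (\<lambda>p. kernel_pow m f p - qform B (unit_rep p)) p\<bar> \<le> e"
        by (intro kernel_pow_abs_le bounded_borel_diff bounded_borel_kernel_pow bf bq mB)
      then show ?thesis
        unfolding kernel_pow_diff[OF bounded_borel_kernel_pow[OF bf] bq] kernel_pow_qform by simp
    qed
    have "\<bar>(\<Sum>k<n. kernel_pow k (kernel_pow m f) p) - (\<Sum>k<n. qform ((dual_channel ^^ k) B) (unit_rep p))\<bar> \<le> (\<Sum>k<n. e)"
      unfolding sum_subtractf[symmetric] by (rule order_trans[OF sum_abs sum_mono[OF 1]])
    then have 2: "\<bar>(\<Sum>k<n. kernel_pow k (kernel_pow m f) p) / real n - (\<Sum>k<n. qform ((dual_channel ^^ k) B) (unit_rep p)) / real n\<bar> \<le> e"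
      using n(2) by (simp add: diff_divide_distrib[symmetric] divide_le_eq mult.commute)
    have shift: "(\<Sum>k<a + b. h k) = (\<Sum>k<a. h k) + (\<Sum>k<b. h (a + k))" for h :: "nat \<Rightarrow> real" and a b
      by (induction b) auto
    have "(\<Sum>k<n. kernel_pow k f p) - (\<Sum>k<n. kernel_pow k (kernel_pow m f) p)
       = (\<Sum>k<m. kernel_pow k f p) - (\<Sum>k<m. kernel_pow (n + k) f p)"
    proof -
      have "(\<Sum>k<n. kernel_pow k f p) + (\<Sum>k<m. kernel_pow (n + k) f p) = (\<Sum>k<m. kernel_pow k f p) + (\<Sum>k<n. kernel_pow (m + k) f p)"
        using shift[of "\<lambda>k. kernel_pow k f p" n m] shift[of "\<lambda>k. kernel_pow k f p" m n]
        by (simp add: add.commute[of m n])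
      moreover have "kernel_pow (m + k) f p = kernel_pow k (kernel_pow m f) p" for k
        by (simp add: funpow_add add.commute[of m])
      ultimately show ?thesis by simp
    qed
    moreover have "\<bar>(\<Sum>k<m. kernel_pow k f p)\<bar> \<le> (\<Sum>k<m. K)" "\<bar>\<Sum>k<m. kernel_pow (n + k) f p\<bar> \<le> (\<Sum>k<m. K)"
      by (intro order_trans[OF sum_abs] sum_mono kernel_pow_abs_le bf K)+
    ultimately have "\<bar>(\<Sum>k<n. kernel_pow k f p) - (\<Sum>k<n. kernel_pow k (kernel_pow m f) p)\<bar> \<le> 2 * real m * K"
      by simp
    then have "\<bar>(\<Sum>k<n. kernel_pow k f p) - (\<Sum>k<n. kernel_pow k (kernel_pow m f) p)\<bar> / real n \<le> 2 * real m * K / real n"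
      using n(2) by (intro divide_right_mono) auto
    then have "\<bar>(\<Sum>k<n. kernel_pow k f p) / real n - (\<Sum>k<n. kernel_pow k (kernel_pow m f) p) / real n\<bar> \<le> e"
      using nm n(2) by (simp add: diff_divide_distrib[symmetric])
    then show ?thesis using 2 cn[of "unit_rep p"] unit_rep(1)[of p] by linarith
  qed
  have \<nu>: "prob_space \<nu>" and sets_\<nu>: "sets \<nu> = sets borel"
    using inv by (auto simp: invariant_prob_def proj_prob_def)
  interpret \<nu>: prob_space \<nu> by fact
  have ib: "integrable \<nu> h" if bh: "bounded_borel h" for h
  proof -
    obtain L where "\<And>p. \<bar>h p\<bar> \<le> L" using bounded_borelE[OF bh] by blast
    moreover have "h \<in> borel_measurable \<nu>"
      using bounded_borelD[OF bh] measurable_cong_sets[OF sets_\<nu> refl] by blast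
    ultimately show ?thesis by (intro \<nu>.integrable_const_bound[of _ L]) auto
  qed
  have "(\<integral>p. (\<Sum>k<n. kernel_pow k f p) / real n \<partial>\<nu>) = (\<integral>p. f p \<partial>\<nu>)"
    using n(2) by (simp add: integral_kernel_pow[OF inv bf] ib bounded_borel_kernel_pow[OF bf])
  moreover have "\<bar>(\<integral>p. (\<Sum>k<n. kernel_pow k f p) / real n - c \<partial>\<nu>)\<bar> \<le> 3 * e"
  proof -
    have "bounded_borel (\<lambda>p. (\<Sum>k<n. kernel_pow k f p) / real n - c)"
      using bounded_borel_diff[OF bounded_borel_cmult[OF bounded_borel_sum[OF bounded_borel_kernel_pow[OF bf], where I = "{..<n}"], of "1 / real n"] bounded_borel_const[of c]]
      by simp
    note i = ib[OF this]
    have "\<bar>(\<integral>p. (\<Sum>k<n. kernel_pow k f p) / real n - c \<partial>\<nu>)\<bar> \<le> (\<integral>p. \<bar>(\<Sum>k<n. kernel_pow k f p) / real n - c\<bar> \<partial>\<nu>)"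
      by (rule integral_abs_bound)
    also have "\<dots> \<le> (\<integral>p. 3 * e \<partial>\<nu>)" by (intro integral_mono integrable_abs i near) auto
    finally show ?thesis by (simp add: \<nu>.prob_space)
  qed
  moreover have "(\<integral>p. (\<Sum>k<n. kernel_pow k f p) / real n - c \<partial>\<nu>) = (\<integral>p. (\<Sum>k<n. kernel_pow k f p) / real n \<partial>\<nu>) - c"
    by (subst Bochner_Integration.integral_diff)
       (auto intro!: ib bounded_borel_sum bounded_borel_kernel_pow bf integrable_divide Bochner_Integration.integrable_sum simp: \<nu>.prob_space)
  ultimately have "\<bar>(\<integral>p. f p \<partial>\<nu>) - c\<bar> \<le> 3 * e" by simp
  then have "\<bar>(\<Sum>k<n. kernel_pow k f p) / real n - (\<integral>p. f p \<partial>\<nu>)\<bar> \<le> \<epsilon>" for p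
    using near[of p] unfolding e_def by linarith
  with n(2) show ?thesis by (rule that)
qed

end

section \<open>Exponential moments of the chain\<close>

lemma exp_third_order:
  fixes x :: real
  assumes "\<bar>x\<bar> \<le> 1"
  shows "\<bar>exp x - (1 + x + x\<^sup>2 / 2)\<bar> \<le> \<bar>x\<bar> ^ 3"
proof -
  obtain t where t: "\<bar>t\<bar> \<le> \<bar>x\<bar>" "exp x = (\<Sum>m<3. x ^ m / fact m) + exp t / fact 3 * x ^ 3"
    using Maclaurin_exp_le[of x 3] by blast
  have "(\<Sum>m<3. x ^ m / fact m) = 1 + x + x\<^sup>2 / 2" by (simp add: numeral_3_eq_3 numeral_2_eq_2)
  moreover have "(fact 3 :: real) = 6" by (simp add: fact_numeral)
  ultimately have "exp x - (1 + x + x\<^sup>2 / 2) = exp t / 6 * x ^ 3" using t(2) by simp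
  then have "\<bar>exp x - (1 + x + x\<^sup>2 / 2)\<bar> = \<bar>exp t / 6 * x ^ 3\<bar>" by (rule arg_cong)
  also have "\<dots> = exp t / 6 * \<bar>x\<bar> ^ 3" by (simp add: abs_mult power_abs)
  also have "\<dots> \<le> 1 * \<bar>x\<bar> ^ 3"
  proof (rule mult_right_mono)
    have "exp t \<le> exp 1" using t(1) assms by simp
    also have "\<dots> \<le> 3" by (rule exp_le)
    finally show "exp t / 6 \<le> 1" by simp
  qed simp
  finally show ?thesis by simp
qed

lemma bounded_borel_exp:
  assumes "bounded_borel f" shows "bounded_borel (\<lambda>p. exp (f p))"
proof -
  obtain K where "\<And>p. \<bar>f p\<bar> \<le> K" using bounded_borelE[OF assms] by blast
  then have "\<bar>exp (f p)\<bar> \<le> exp K" for p using abs_le_D1 by auto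
  moreover have "(\<lambda>p. exp (f p)) \<in> borel_measurable borel" using bounded_borelD[OF assms] by measurable
  ultimately show ?thesis by (auto simp: bounded_borel_def)
qed

section \<open>Correctors and tilted kernels\<close>

context kraus_measure begin

lemma kernel_op_sum:
  "(\<And>i. i \<in> I \<Longrightarrow> bounded_borel (f i)) \<Longrightarrow> kernel_op \<mu> (\<lambda>p. \<Sum>i\<in>I. f i p) p = (\<Sum>i\<in>I. kernel_op \<mu> (f i) p)"
  by (induction I rule: infinite_finite_induct) (simp_all add: kernel_op_add bounded_borel_sum)

text \<open>The difference \<open>kernel_pow j h - h\<close> is \<Pi> minus the identity applied to
  the sum of the powers below \<open>j\<close>. Averaging these sums over \<open>j < n\<close>
  solves the Poisson equation for \<open>h\<close> up to its Cesaro average, with a bounded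
  solution.\<close>

lemma cesaro_corrector:
  assumes h: "bounded_borel h" and n: "n > 0"
  obtains u where "bounded_borel u"
    "\<And>p. h p + kernel_op \<mu> u p - u p = (\<Sum>k<n. kernel_pow k h p) / real n"
proof -
  define u where "u p = (1 / real n) * (\<Sum>j<n. \<Sum>i<j. kernel_pow i h p)" for p
  have b: "bounded_borel (\<lambda>p. \<Sum>i<j. kernel_pow i h p)" for j
    by (intro bounded_borel_sum bounded_borel_kernel_pow h)
  have bu: "bounded_borel u" unfolding u_def[abs_def] by (intro bounded_borel_cmult bounded_borel_sum b)
  have "h p + kernel_op \<mu> u p - u p = (\<Sum>k<n. kernel_pow k h p) / real n" for p
  proof -
    have "kernel_op \<mu> u p = (1 / real n) * (\<Sum>j<n. \<Sum>i<j. kernel_pow (Suc i) h p)"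
      unfolding u_def[abs_def] kernel_op_cmult by (simp add: kernel_op_sum b bounded_borel_kernel_pow[OF h])
    then have "kernel_op \<mu> u p - u p = (1 / real n) * (\<Sum>j<n. \<Sum>i<j. kernel_pow (Suc i) h p - kernel_pow i h p)"
      by (simp add: u_def sum_subtractf right_diff_distrib)
    also have "\<dots> = (1 / real n) * (\<Sum>j<n. kernel_pow j h p - h p)"
    proof -
      have "(\<Sum>i<j. kernel_pow (Suc i) h p - kernel_pow i h p) = kernel_pow j h p - h p" for j
        using sum_lessThan_telescope[of "\<lambda>i. kernel_pow i h p" j] by (simp only: funpow_0)
      then show ?thesis by simp
    qed
    also have "\<dots> = (\<Sum>k<n. kernel_pow k h p) / real n - h p"
      using n by (simp add: sum_subtractf field_simps)
    finally show ?thesis by simp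
  qed
  with bu show ?thesis by (rule that)
qed

text \<open>The corrector \<open>u\<close> replaces the conditional variance \<open>\<Pi>(gt\<^sup>2) - (\<Pi> gt)\<^sup>2\<close> of a martingale increment
  by a Cesaro average, which is uniformly close to its mean.\<close>

lemma tilted_kernel_bounds:
  assumes pur: "purifying \<mu>" and erg: "ergodic_measure \<mu>" and inv: "invariant_prob \<mu> \<nu>"
    and gt: "continuous_on UNIV gt" and g: "continuous_on UNIV g"
    and poisson: "\<And>p. gt p - kernel_op \<mu> gt p = g p"
    and \<gamma>: "\<gamma> = (\<integral>p. (gt p)\<^sup>2 - (kernel_op \<mu> gt p)\<^sup>2 \<partial>\<nu>)"
    and \<epsilon>: "\<epsilon> > 0"
  obtains t0 C :: real and H :: "real \<Rightarrow> 'd cproj \<Rightarrow> real" where "t0 > 0" "C \<ge> 1"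
    "\<And>t. bounded_borel (H t)"
    "\<And>t p. \<bar>t\<bar> \<le> t0 \<Longrightarrow> 1 / C \<le> H t p \<and> H t p \<le> C"
    "\<And>t p. \<bar>t\<bar> \<le> t0 \<Longrightarrow> exp (t\<^sup>2 * (\<gamma> - \<epsilon>) / 2) * H t p \<le> exp (t * g p) * kernel_op \<mu> (H t) p"
    "\<And>t p. \<bar>t\<bar> \<le> t0 \<Longrightarrow> exp (t * g p) * kernel_op \<mu> (H t) p \<le> exp (t\<^sup>2 * (\<gamma> + \<epsilon>) / 2) * H t p"
proof -
  \<comment> \<open>Not the conditional variance itself: this version is continuous, since
    \<open>\<Pi> gt = gt - g\<close>, and its integral is \<open>\<gamma>\<close> by
    definition.\<close>
  define h where "h p = (gt p)\<^sup>2 - (kernel_op \<mu> gt p)\<^sup>2" for p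
  have kgt: "kernel_op \<mu> gt = (\<lambda>p. gt p - g p)" using poisson by (auto simp: fun_eq_iff algebra_simps)
  have ch: "continuous_on UNIV h" unfolding h_def kgt by (intro continuous_intros gt g)
  have bgt: "bounded_borel gt" by (rule bounded_borel_continuous[OF gt])
  have bgt2: "bounded_borel (\<lambda>p. (gt p)\<^sup>2)"
    using bounded_borel_mult[OF bgt bgt] by (simp add: power2_eq_square)
  have bh: "bounded_borel h" by (rule bounded_borel_continuous[OF ch])
  obtain n where n: "n > 0" "\<And>p. \<bar>(\<Sum>k<n. kernel_pow k h p) / real n - \<gamma>\<bar> \<le> \<epsilon> / 2"
    using cesaro_uniform[OF pur erg inv ch, of "\<epsilon> / 2"] \<epsilon> unfolding \<gamma> h_def by auto
  obtain u0 where u0: "bounded_borel u0" "\<And>p. h p + kernel_op \<mu> u0 p - u0 p = (\<Sum>k<n. kernel_pow k h p) / real n"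
    by (rule cesaro_corrector[OF bh n(1)]) blast
  define A where "A p = (\<Sum>k<n. kernel_pow k h p) / real n" for p
  \<comment> \<open>The term \<open>- gt^2\<close> exchanges \<open>\<Pi>(gt^2)\<close> for
    \<open>gt^2\<close> in the conditional variance, which thereby becomes \<open>h\<close>;
    \<open>u0\<close> then levels \<open>h\<close>.\<close>
  define u where "u p = u0 p - (gt p)\<^sup>2" for p
  have bu: "bounded_borel u" unfolding u_def[abs_def] by (intro bounded_borel_diff u0 bgt2)
  obtain K1 where K1: "\<And>p. \<bar>gt p\<bar> \<le> K1" using bounded_borelE[OF bgt] by blast
  obtain K2 where K2: "\<And>p. \<bar>u p\<bar> \<le> K2" using bounded_borelE[OF bu] by blast
  define K where "K = max 1 (max K1 K2)"
  have K: "K \<ge> 1" "\<And>p. \<bar>gt p\<bar> \<le> K" "\<And>p. \<bar>u p\<bar> \<le> K" using K1 K2 by (auto simp: K_def le_max_iff_disj)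
  \<comment> \<open>27 from the cubic remainder of the exponential at an argument of size
    \<open>3 * K * a\<close>, and 3 from the cross terms dropped in its square.\<close>
  define M where "M = 30 * K ^ 3"
  define b where "b = \<bar>\<gamma>\<bar> + \<epsilon>"
  \<comment> \<open>In this order the four bounds keep the exponent in [-1, 1], make the cubic error
    at most \<open>\<epsilon> / 4\<close> relative to \<open>t^2 / 2\<close>, keep
    \<open>t^2 * (\<gamma> - \<epsilon>) / 2\<close> in [-1, 1], and make the quadratic remainder of
    its exponential at most \<open>\<epsilon> / 4\<close> relative to
    \<open>t^2 / 2\<close>.\<close>
  define t0 where "t0 = min (1 / (3 * K)) (min (\<epsilon> / (8 * M)) (min (1 / (b + 1)) (\<epsilon> / (3 * (b + 1)\<^sup>2))))"
  have M: "M > 0" using K(1) by (simp add: M_def)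
  have b: "b > 0" using \<epsilon> by (simp add: b_def)
  have t0: "t0 > 0" using K(1) M \<epsilon> b by (simp add: t0_def)
  define H where "H t p = exp (t * gt p + t\<^sup>2 / 2 * u p)" for t p
  have bH: "bounded_borel (H t)" for t
    unfolding H_def[abs_def] by (intro bounded_borel_exp bounded_borel_add bounded_borel_cmult bgt bu)
  have main: "1 / exp (2 * K) \<le> H t p \<and> H t p \<le> exp (2 * K)
     \<and> exp (t\<^sup>2 * (\<gamma> - \<epsilon>) / 2) * H t p \<le> exp (t * g p) * kernel_op \<mu> (H t) p
     \<and> exp (t * g p) * kernel_op \<mu> (H t) p \<le> exp (t\<^sup>2 * (\<gamma> + \<epsilon>) / 2) * H t p" if t: "\<bar>t\<bar> \<le> t0" for t p
  proof -
    define a where "a = \<bar>t\<bar>"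
    have a0: "a \<ge> 0" by (simp add: a_def)
    have a1: "3 * K * a \<le> 1"
    proof -
      have "a \<le> 1 / (3 * K)" using t by (simp add: t0_def a_def)
      then show ?thesis using K(1) by (simp add: field_simps)
    qed
    have a_le1: "a \<le> 1"
    proof -
      have "1 * a \<le> 3 * K * a" using K(1) a0 by (intro mult_right_mono) auto
      then show ?thesis using a1 by simp
    qed
    have a2: "8 * M * a \<le> \<epsilon>"
    proof -
      have "a \<le> \<epsilon> / (8 * M)" using t by (simp add: t0_def a_def)
      then show ?thesis using M by (simp add: field_simps)
    qed
    have a3: "(b + 1) * a \<le> 1"
    proof -
      have "a \<le> 1 / (b + 1)" using t by (simp add: t0_def a_def)
      then show ?thesis using b by (simp add: field_simps)
    qed
    have a4: "3 * (b + 1)\<^sup>2 * a \<le> \<epsilon>"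
    proof -
      have "a \<le> \<epsilon> / (3 * (b + 1)\<^sup>2)" using t by (simp add: t0_def a_def)
      then show ?thesis using b by (simp add: field_simps)
    qed
    have t2: "t\<^sup>2 = a\<^sup>2" by (simp add: a_def)
    have a_sq: "a\<^sup>2 \<le> a" using a0 a_le1 by (simp add: power2_eq_square mult_left_le)
    have expo: "\<bar>t * gt p + t\<^sup>2 / 2 * u p\<bar> \<le> 2 * K"
    proof -
      have "\<bar>t * gt p\<bar> \<le> 1 * K" unfolding abs_mult using K(2)[of p] a_le1 by (intro mult_mono) (auto simp: a_def)
      moreover have "\<bar>t\<^sup>2 / 2 * u p\<bar> \<le> (1 / 2) * K"
        unfolding abs_mult using K(3)[of p] a_sq a_le1 by (intro mult_mono) (auto simp: t2)
      ultimately show ?thesis using K(1) by linarith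
    qed
    have H_bounds: "1 / exp (2 * K) \<le> H t p" "H t p \<le> exp (2 * K)"
      using expo unfolding H_def by (simp_all add: inverse_eq_divide[symmetric] exp_minus[symmetric] abs_le_iff)
    define \<tau> where "\<tau> = t\<^sup>2 / 2"
    have \<tau>_a: "\<tau> = a\<^sup>2 / 2" by (simp add: \<tau>_def t2)
    define D where "D q = gt q - kernel_op \<mu> gt p" for q
    define \<xi> where "\<xi> q = t * D q + \<tau> * (u q - u p)" for q
    \<comment> \<open>The expansion of \<open>exp (\<xi> q)\<close> to second order in
      \<open>t\<close>; the first-order term is centred by the choice of \<open>D\<close>.\<close>
    define Q where "Q q = 1 + t * D q + \<tau> * (u q - u p) + \<tau> * (D q)\<^sup>2" for q
    have bD: "bounded_borel D" unfolding D_def[abs_def] by (intro bounded_borel_diff bgt bounded_borel_const)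
    have bD2: "bounded_borel (\<lambda>q. (D q)\<^sup>2)" using bounded_borel_mult[OF bD bD] by (simp add: power2_eq_square)
    have bup: "bounded_borel (\<lambda>q. u q - u p)" by (intro bounded_borel_diff bu bounded_borel_const)
    have b\<xi>: "bounded_borel \<xi>" unfolding \<xi>_def[abs_def] by (intro bounded_borel_add bounded_borel_cmult bD bup)
    have bQ: "bounded_borel Q" unfolding Q_def[abs_def]
      by (intro bounded_borel_add bounded_borel_cmult bD bup bD2 bounded_borel_const)
    have D_le: "\<bar>D q\<bar> \<le> 2 * K" for q
      using K(2)[of q] kernel_op_abs_le[OF bgt K(2), of p] unfolding D_def by linarith
    have u_le: "\<bar>u q - u p\<bar> \<le> 2 * K" for q using K(3)[of q] K(3)[of p] by linarith
    have approx: "\<bar>exp (\<xi> q) - Q q\<bar> \<le> M * a ^ 3" for q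
    proof -
      define X where "X = t * D q"
      define Y where "Y = \<tau> * (u q - u p)"
      have 1: "\<bar>X\<bar> \<le> a * (2 * K)" unfolding X_def abs_mult a_def by (intro mult_left_mono D_le) simp
      have 2: "\<bar>Y\<bar> \<le> a\<^sup>2 * K"
        unfolding Y_def abs_mult \<tau>_a using mult_left_mono[OF u_le[of q], of "a\<^sup>2 / 2"] by simp
      have 22: "a\<^sup>2 * K \<le> a * K" using a_sq K(1) by (intro mult_right_mono) auto
      have \<xi>: "\<xi> q = X + Y" by (simp add: \<xi>_def X_def Y_def)
      have x: "\<bar>\<xi> q\<bar> \<le> 3 * K * a" 
      proof -
        have "a * (2 * K) + a * K = 3 * K * a" by simp
        then show ?thesis using abs_triangle_ineq[of X Y] 1 2 22 unfolding \<xi> by linarith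
      qed
      have "\<bar>exp (\<xi> q) - (1 + \<xi> q + (\<xi> q)\<^sup>2 / 2)\<bar> \<le> \<bar>\<xi> q\<bar> ^ 3"
        by (rule exp_third_order) (use x a1 in linarith)
      also have "\<dots> \<le> (3 * K * a) ^ 3" using x by (intro power_mono) auto
      finally have e1: "\<bar>exp (\<xi> q) - (1 + \<xi> q + (\<xi> q)\<^sup>2 / 2)\<bar> \<le> 27 * K ^ 3 * a ^ 3" by (simp add: power_mult_distrib)
      have "(\<xi> q)\<^sup>2 / 2 - X\<^sup>2 / 2 = X * Y + Y\<^sup>2 / 2"
        unfolding \<xi> by (simp add: power2_eq_square field_simps)
      moreover have "\<bar>X * Y\<bar> \<le> (a * (2 * K)) * (a\<^sup>2 * K)"
        unfolding abs_mult by (intro mult_mono 1 2) (use a0 K(1) in auto)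
      moreover have "\<bar>Y\<^sup>2 / 2\<bar> \<le> (a\<^sup>2 * K) * (a\<^sup>2 * K) / 2"
        using mult_mono[OF 2 2] a0 K(1) by (simp add: power2_eq_square)
      ultimately have "\<bar>(\<xi> q)\<^sup>2 / 2 - X\<^sup>2 / 2\<bar> \<le> (a * (2 * K)) * (a\<^sup>2 * K) + (a\<^sup>2 * K) * (a\<^sup>2 * K) / 2"
        by linarith
      also have "\<dots> \<le> 3 * K\<^sup>2 * a ^ 3"
      proof -
        have "a ^ 3 * a \<le> a ^ 3 * 1" using a_le1 a0 by (intro mult_left_mono) auto
        then have "K\<^sup>2 * (a ^ 3 * a) \<le> K\<^sup>2 * a ^ 3" by (intro mult_left_mono) auto
        moreover have "0 \<le> K\<^sup>2 * (a ^ 3 * a)" using a0 by simp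
        ultimately show ?thesis by (simp add: power2_eq_square power3_eq_cube field_simps)
      qed
      also have "\<dots> \<le> 3 * K ^ 3 * a ^ 3"
        using K(1) a0 power_increasing[of 2 3 K] by (intro mult_right_mono mult_left_mono) auto
      finally have e2: "\<bar>(\<xi> q)\<^sup>2 / 2 - X\<^sup>2 / 2\<bar> \<le> 3 * K ^ 3 * a ^ 3" .
      have "\<tau> * (D q)\<^sup>2 = X\<^sup>2 / 2" by (simp add: X_def \<tau>_def power_mult_distrib)
      then have "exp (\<xi> q) - Q q = (exp (\<xi> q) - (1 + \<xi> q + (\<xi> q)\<^sup>2 / 2)) + ((\<xi> q)\<^sup>2 / 2 - X\<^sup>2 / 2)"
        by (simp add: Q_def \<xi>_def)
      then have "\<bar>exp (\<xi> q) - Q q\<bar> \<le> 27 * K ^ 3 * a ^ 3 + 3 * K ^ 3 * a ^ 3"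
        using order_trans[OF abs_triangle_ineq add_mono[OF e1 e2]] by simp
      then show ?thesis unfolding M_def by (simp add: algebra_simps)
    qed
    \<comment> \<open>The variance of \<open>gt\<close> under the kernel and the mean increment of
      \<open>u\<close> combine to the Cesaro average \<open>A p\<close>.\<close>
    have kQ: "kernel_op \<mu> Q p = 1 + \<tau> * A p"
    proof -
      have k1: "kernel_op \<mu> Q p = 1 + t * kernel_op \<mu> D p + \<tau> * kernel_op \<mu> (\<lambda>q. u q - u p) p + \<tau> * kernel_op \<mu> (\<lambda>q. (D q)\<^sup>2) p"
        unfolding Q_def[abs_def]
        by (simp add: kernel_op_add kernel_op_cmult bounded_borel_add bounded_borel_cmult bD bup bD2 bounded_borel_const del: times_divide_eq_left)
      have k2: "kernel_op \<mu> D p = 0"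
        unfolding D_def[abs_def] by (simp add: kernel_op_diff bgt bounded_borel_const)
      have k3: "kernel_op \<mu> (\<lambda>q. u q - u p) p = kernel_op \<mu> u0 p - kernel_op \<mu> (\<lambda>q. (gt q)\<^sup>2) p - u p"
        unfolding kernel_op_diff[OF bu bounded_borel_const] kernel_op_const
        unfolding u_def[abs_def] kernel_op_diff[OF u0(1) bgt2] ..
      have k4: "kernel_op \<mu> (\<lambda>q. (D q)\<^sup>2) p = kernel_op \<mu> (\<lambda>q. (gt q)\<^sup>2) p - (kernel_op \<mu> gt p)\<^sup>2"
      proof -
        have "(\<lambda>q. (D q)\<^sup>2) = (\<lambda>q. ((gt q)\<^sup>2 + (-2 * kernel_op \<mu> gt p) * gt q) + (kernel_op \<mu> gt p)\<^sup>2)"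
          by (auto simp: D_def power2_eq_square algebra_simps)
        then have "kernel_op \<mu> (\<lambda>q. (D q)\<^sup>2) p = kernel_op \<mu> (\<lambda>q. (gt q)\<^sup>2) p + (-2 * kernel_op \<mu> gt p) * kernel_op \<mu> gt p + (kernel_op \<mu> gt p)\<^sup>2"
          by (simp only: kernel_op_add kernel_op_cmult bounded_borel_add bounded_borel_cmult bgt bgt2 bounded_borel_const kernel_op_const)
        then show ?thesis by (simp add: power2_eq_square)
      qed
      have "kernel_op \<mu> Q p = 1 + \<tau> * (h p + kernel_op \<mu> u0 p - u0 p)"
        unfolding k1 k2 k3 k4 by (simp add: u_def[of p] h_def algebra_simps)
      then show ?thesis by (simp add: u0(2) A_def)
    qed
    define E where "E = kernel_op \<mu> (\<lambda>q. exp (\<xi> q)) p"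
    have be: "bounded_borel (\<lambda>q. exp (\<xi> q))" by (rule bounded_borel_exp[OF b\<xi>])
    have E_approx: "\<bar>E - (1 + \<tau> * A p)\<bar> \<le> M * a ^ 3"
    proof -
      have "\<bar>kernel_op \<mu> (\<lambda>q. exp (\<xi> q) - Q q) p\<bar> \<le> M * a ^ 3"
        by (rule kernel_op_abs_le[OF bounded_borel_diff[OF be bQ] approx])
      then show ?thesis unfolding kernel_op_diff[OF be bQ] kQ E_def .
    qed
    have Ma: "M * a ^ 3 \<le> \<tau> * (\<epsilon> / 4)"
    proof -
      have "a\<^sup>2 * (8 * M * a) \<le> a\<^sup>2 * \<epsilon>" by (intro mult_left_mono a2) simp
      then show ?thesis by (simp add: \<tau>_a power2_eq_square power3_eq_cube field_simps)
    qed
    have A_near: "A p \<le> \<gamma> + \<epsilon> / 2" "\<gamma> - \<epsilon> / 2 \<le> A p"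
      using n(2)[of p] unfolding A_def[symmetric] by linarith+
    have \<tau>0: "\<tau> \<ge> 0" by (simp add: \<tau>_def)
    have upper: "E \<le> exp (t\<^sup>2 * (\<gamma> + \<epsilon>) / 2)"
    proof -
      have "\<tau> * A p \<le> \<tau> * (\<gamma> + \<epsilon> / 2)" using A_near \<tau>0 by (intro mult_left_mono) auto
      then have "E \<le> 1 + \<tau> * (\<gamma> + \<epsilon> / 2) + \<tau> * (\<epsilon> / 4)" using E_approx Ma by linarith
      also have "\<dots> \<le> 1 + \<tau> * (\<gamma> + \<epsilon>)"
      proof -
        have "0 \<le> \<tau> * (\<epsilon> / 4)" using \<epsilon> \<tau>0 by simp
        then show ?thesis by (simp add: field_simps)
      qed
      also have "\<dots> \<le> exp (\<tau> * (\<gamma> + \<epsilon>))" by (rule exp_ge_add_one_self)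
      finally show ?thesis by (simp add: \<tau>_def)
    qed
    \<comment> \<open>Of the margin, the Cesaro error takes \<open>\<epsilon> / 2\<close> and the
      Taylor error \<open>\<epsilon> / 4\<close>; the last quarter pays for replacing
      \<open>exp z\<close> by \<open>1 + z\<close>, convexity going the wrong way here.\<close>
    have lower: "exp (t\<^sup>2 * (\<gamma> - \<epsilon>) / 2) \<le> E"
    proof -
      define z where "z = \<tau> * (\<gamma> - \<epsilon>)"
      have gb: "\<bar>\<gamma> - \<epsilon>\<bar> \<le> b" using \<epsilon> by (simp add: b_def)
      have z_le: "\<bar>z\<bar> \<le> \<tau> * b" unfolding z_def abs_mult using gb \<tau>0 by (intro mult_mono) auto
      have "\<tau> * b \<le> a * b" using a_sq b a0 by (intro mult_right_mono) (auto simp: \<tau>_a)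
      then have z1: "\<bar>z\<bar> \<le> 1" using z_le a3 a0 by (simp add: algebra_simps)
      have "\<bar>z\<bar> ^ 3 \<le> \<bar>z\<bar>\<^sup>2" using z1 by (intro power_decreasing) auto
      then have "exp z \<le> 1 + z + 3 / 2 * z\<^sup>2" using exp_third_order[OF z1] by simp
      also have "3 / 2 * z\<^sup>2 \<le> \<tau> * (\<epsilon> / 4)"
      proof -
        have "z\<^sup>2 \<le> (\<tau> * b)\<^sup>2" using z_le by (metis abs_ge_zero power2_abs power_mono)
        also have "\<dots> = \<tau> * (a\<^sup>2 * (b\<^sup>2 / 2))" by (simp add: \<tau>_a power2_eq_square)
        finally have "3 / 2 * z\<^sup>2 \<le> \<tau> * (3 / 4 * (b\<^sup>2 * a\<^sup>2))" by simp
        also have "\<dots> \<le> \<tau> * (\<epsilon> / 4)"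
        proof (rule mult_left_mono)
          have "b\<^sup>2 * a\<^sup>2 \<le> (b + 1)\<^sup>2 * a" using b a_sq by (intro mult_mono power_mono) auto
          then show "3 / 4 * (b\<^sup>2 * a\<^sup>2) \<le> \<epsilon> / 4" using a4 by linarith
        qed (rule \<tau>0)
        finally show ?thesis .
      qed
      also have "1 + z + \<tau> * (\<epsilon> / 4) = 1 + \<tau> * (\<gamma> - \<epsilon> / 2) - \<tau> * (\<epsilon> / 4)"
        by (simp add: z_def field_simps)
      also have "\<dots> \<le> E"
      proof -
        have "\<tau> * (\<gamma> - \<epsilon> / 2) \<le> \<tau> * A p" using A_near \<tau>0 by (intro mult_left_mono) auto
        then show ?thesis using E_approx Ma by linarith
      qed
      finally show ?thesis by (simp add: z_def \<tau>_def)
    qed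
    have "exp (t * g p) * kernel_op \<mu> (H t) p = H t p * E"
    proof -
      have "exp (t * g p) * H t q = H t p * exp (\<xi> q)" for q
        unfolding H_def \<xi>_def D_def kgt exp_add[symmetric] \<tau>_def[symmetric] by (simp add: algebra_simps)
      then show ?thesis unfolding E_def kernel_op_cmult[symmetric] by simp
    qed
    moreover have "H t p \<ge> 0" by (simp add: H_def)
    ultimately show ?thesis
      using H_bounds mult_left_mono[OF upper, of "H t p"] mult_left_mono[OF lower, of "H t p"]
      by (simp only: mult.commute[of "exp _" "H t p"] simp_thms)
  qed
  have eK: "exp (2 * K) \<ge> 1" using K(1) by simp
  show ?thesis by (rule that[OF t0 eK bH]) (use main in blast)+
qed

end

section \<open>The trajectory and its Markov property\<close>

locale quantum_trajectory = kraus_measure \<mu> for \<mu> :: "(complex ^ 'd::finite ^ 'd) measure" +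
  fixes \<nu> :: "'d cproj measure" and P :: "('d cproj \<times> (nat \<Rightarrow> complex ^ 'd ^ 'd)) measure"
  assumes initial: "proj_prob \<nu>" and path: "is_path_measure \<mu> \<nu> P"
begin

lemma sets_initial [measurable_cong]: "sets \<nu> = sets borel"
  using initial by (simp add: proj_prob_def)

lemma sets_P: "sets P = sets path_space"
  using path by (simp add: is_path_measure_def)

lemma space_P [simp]: "space P = UNIV"
  using sets_eq_imp_space_eq[OF sets_P] by (simp add: path_space_def space_pair_measure space_PiM)

sublocale P: prob_space P
  using path by (simp add: is_path_measure_def)

abbreviation prefix_space :: "nat \<Rightarrow> ('d cproj \<times> (nat \<Rightarrow> complex ^ 'd ^ 'd)) measure" where
  "prefix_space n \<equiv> borel \<Otimes>\<^sub>M (\<Pi>\<^sub>M i\<in>{..<n}. borel)"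

abbreviation prefix_law :: "nat \<Rightarrow> (nat \<Rightarrow> complex ^ 'd ^ 'd) measure" where
  "prefix_law n \<equiv> \<Pi>\<^sub>M i\<in>{..<n}. \<mu>"

definition prefix :: "nat \<Rightarrow> 'd cproj \<times> (nat \<Rightarrow> complex ^ 'd ^ 'd) \<Rightarrow> 'd cproj \<times> (nat \<Rightarrow> complex ^ 'd ^ 'd)" where
  "prefix n = (\<lambda>(p, \<omega>). (p, restrict \<omega> {..<n}))"

text \<open>The past as a pull-back: its events are exactly the preimages of measurable sets of
  prefixes.\<close>

definition history :: "nat \<Rightarrow> ('d cproj \<times> (nat \<Rightarrow> complex ^ 'd ^ 'd)) measure" where
  "history n = vimage_algebra UNIV (prefix n) (prefix_space n)"

lemma sets_prefix_law [measurable_cong]: "sets (prefix_law n) = sets (\<Pi>\<^sub>M i\<in>{..<n}. borel)"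
  by (intro sets_PiM_cong) (auto simp: sets_mu)

lemma sets_prefix_pair: "sets (\<nu> \<Otimes>\<^sub>M prefix_law n) = sets (prefix_space n)"
  by (intro sets_pair_measure_cong sets_initial sets_prefix_law)

lemma prefix_measurable_path: "prefix n \<in> measurable path_space (prefix_space n)"
  unfolding prefix_def path_space_def by measurable

lemma prefix_measurable [measurable]: "prefix n \<in> measurable P (prefix_space n)"
  using prefix_measurable_path measurable_cong_sets[OF sets_P refl] by blast

lemma prefix_in_space: "prefix n \<in> UNIV \<rightarrow> space (prefix_space n)"
  using measurable_space[OF prefix_measurable[of n]] by auto

lemma space_history [simp]: "space (history n) = UNIV"
  by (simp add: history_def)

lemma prefix_measurable_history [measurable]: "prefix n \<in> measurable (history n) (prefix_space n)"
  unfolding history_def by (rule measurable_vimage_algebra1[OF prefix_in_space])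

lemma sets_history: "sets (history n) = {prefix n -` B | B. B \<in> sets (prefix_space n)}"
  unfolding history_def by (subst sets_vimage_algebra2[OF prefix_in_space]) simp

lemma sets_history_P: "sets (history n) \<subseteq> sets P"
  unfolding history_def by (rule sets_image_in_sets[OF space_P prefix_measurable])

lemma sets_history_Suc: "sets (history n) \<subseteq> sets (history (Suc n))"
  unfolding history_def[of n]
proof (rule sets_image_in_sets)
  have "(\<lambda>(p, \<omega>). (p, restrict \<omega> {..<n})) \<in> measurable (prefix_space (Suc n)) (prefix_space n)"
    by measurable
  then have "(\<lambda>z. (\<lambda>(p, \<omega>). (p, restrict \<omega> {..<n})) (prefix (Suc n) z)) \<in> measurable (history (Suc n)) (prefix_space n)"
    by (rule measurable_compose[OF prefix_measurable_history])
  moreover have "(\<lambda>z. (\<lambda>(p, \<omega>). (p, restrict \<omega> {..<n})) (prefix (Suc n) z)) = prefix n"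
    by (auto simp: prefix_def fun_eq_iff restrict_def)
  ultimately show "prefix n \<in> measurable (history (Suc n)) (prefix_space n)" by simp
qed simp

lemma chain_prefix: "n \<le> m \<Longrightarrow> chain n (prefix m z) = chain n z"
  by (cases z) (auto simp: prefix_def chain_def intro!: arg_cong2[where f = proj_act] W_cong)

lemma W_prefix_measurable [measurable]: "(\<lambda>\<omega>. W \<omega> n) \<in> borel_measurable (\<Pi>\<^sub>M i\<in>{..<n}. borel)"
  by (rule W_measurable) auto

lemma chain_measurable_prefix [measurable]: "chain n \<in> borel_measurable (prefix_space n)"
  unfolding chain_def case_prod_unfold by measurable

lemma chain_measurable_history [measurable]: "chain n \<in> borel_measurable (history n)"
proof -
  have "(\<lambda>z. chain n (prefix n z)) \<in> borel_measurable (history n)" by measurable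
  then show ?thesis by (simp add: chain_prefix)
qed

lemma subalgebra_history: "subalgebra P (history n)"
  using sets_history_P by (simp add: subalgebra_def)

lemma chain_measurable [measurable]: "chain n \<in> borel_measurable P"
  by (rule measurable_from_subalg[OF subalgebra_history chain_measurable_history])

definition weight :: "nat \<Rightarrow> 'd cproj \<times> (nat \<Rightarrow> complex ^ 'd ^ 'd) \<Rightarrow> ennreal" where
  "weight n = (\<lambda>(p, \<omega>). ennreal ((norm (W \<omega> n *v unit_rep p))\<^sup>2))"

lemma weight_measurable [measurable]: "weight n \<in> borel_measurable (prefix_space n)"
  unfolding weight_def case_prod_unfold by measurable

lemma sigma_finite_prefix_law: "sigma_finite_measure (prefix_law n)"
proof -
  interpret product_sigma_finite "\<lambda>_ :: nat. \<mu>" by unfold_locales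
  show ?thesis by (rule sigma_finite) simp
qed

text \<open>\<open>is_path_measure\<close> fixes the law on rectangles, an intersection-stable
  generator that contains the whole space, which has finite mass.\<close>

lemma distr_prefix: "distr P (prefix_space n) (prefix n) = density (\<nu> \<Otimes>\<^sub>M prefix_law n) (weight n)"
proof -
  interpret Q: sigma_finite_measure "prefix_law n" by (rule sigma_finite_prefix_law)
  let ?Q = "\<Pi>\<^sub>M i\<in>{..<n}. (borel :: (complex ^ 'd ^ 'd) measure)"
  let ?E = "{a \<times> b | a b. a \<in> sets (borel :: 'd cproj measure) \<and> b \<in> sets ?Q}"
  have wt [measurable]: "weight n \<in> borel_measurable (\<nu> \<Otimes>\<^sub>M prefix_law n)"
    using weight_measurable measurable_cong_sets[OF sets_prefix_pair refl] by blast
  show ?thesis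
  proof (rule measure_eqI_generator_eq[where E = ?E and \<Omega> = "space (prefix_space n)" and A = "\<lambda>_. space (prefix_space n)"])
    show "Int_stable ?E" by (rule Int_stable_pair_measure_generator)
    show "?E \<subseteq> Pow (space (prefix_space n))" unfolding space_pair_measure by (rule pair_measure_closed)
    show "sets (distr P (prefix_space n) (prefix n)) = sigma_sets (space (prefix_space n)) ?E"
      by (simp add: sets_pair_measure space_pair_measure)
    show "sets (density (\<nu> \<Otimes>\<^sub>M prefix_law n) (weight n)) = sigma_sets (space (prefix_space n)) ?E"
      by (simp add: sets_prefix_pair) (simp add: sets_pair_measure space_pair_measure)
    show "range (\<lambda>_. space (prefix_space n)) \<subseteq> ?E"
      by (auto simp: space_pair_measure intro!: exI[of _ "space borel"] exI[of _ "space ?Q"])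
    show "emeasure (distr P (prefix_space n) (prefix n)) (space (prefix_space n)) \<noteq> \<infinity>"
      by (simp add: emeasure_distr P.emeasure_eq_measure)
    fix X assume "X \<in> ?E"
    then obtain S A where X: "X = S \<times> A" and S [measurable]: "S \<in> sets borel" and A: "A \<in> sets ?Q" by blast
    note [measurable] = A
    have A' [measurable]: "A \<in> sets (prefix_law n)" using A sets_prefix_law by blast
    have S' [measurable]: "S \<in> sets \<nu>" using S sets_initial by blast
    have XP: "X \<in> sets (prefix_space n)" unfolding X by measurable
    have "emeasure (distr P (prefix_space n) (prefix n)) X = emeasure P (prefix n -` X \<inter> space P)"
      by (rule emeasure_distr[OF prefix_measurable XP])
    also have "prefix n -` X \<inter> space P = S \<times> {\<omega>. restrict \<omega> {..<n} \<in> A}"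
      by (auto simp: prefix_def X)
    also have "emeasure P \<dots> = (\<integral>\<^sup>+ p\<in>S. (\<integral>\<^sup>+ \<omega>\<in>A. ennreal ((norm (W \<omega> n *v unit_rep p))\<^sup>2) \<partial>prefix_law n) \<partial>\<nu>)"
      using path S A by (simp add: is_path_measure_def)
    also have "\<dots> = (\<integral>\<^sup>+ p. \<integral>\<^sup>+ \<omega>. weight n (p, \<omega>) * indicator X (p, \<omega>) \<partial>prefix_law n \<partial>\<nu>)"
    proof (rule nn_integral_cong)
      fix p
      have 1: "(\<lambda>\<omega>. weight n (p, \<omega>) * indicator X (p, \<omega>)) = (\<lambda>\<omega>. (ennreal ((norm (W \<omega> n *v unit_rep p))\<^sup>2) * indicator A \<omega>) * indicator S p)"
        by (auto simp: weight_def X indicator_def)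
      show "(\<integral>\<^sup>+ \<omega>\<in>A. ennreal ((norm (W \<omega> n *v unit_rep p))\<^sup>2) \<partial>prefix_law n) * indicator S p
         = (\<integral>\<^sup>+ \<omega>. weight n (p, \<omega>) * indicator X (p, \<omega>) \<partial>prefix_law n)"
        unfolding 1 by (rule nn_integral_multc[symmetric]) measurable
    qed
    also have "\<dots> = (\<integral>\<^sup>+ z. weight n z * indicator X z \<partial>(\<nu> \<Otimes>\<^sub>M prefix_law n))"
    proof (rule Q.nn_integral_fst)
      show "(\<lambda>z. weight n z * indicator X z) \<in> borel_measurable (\<nu> \<Otimes>\<^sub>M prefix_law n)"
        using XP sets_prefix_pair by measurable
    qed
    also have "\<dots> = emeasure (density (\<nu> \<Otimes>\<^sub>M prefix_law n) (weight n)) X"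
      using XP sets_prefix_pair by (subst emeasure_density) (auto intro: wt)
    finally show "emeasure (distr P (prefix_space n) (prefix n)) X = emeasure (density (\<nu> \<Otimes>\<^sub>M prefix_law n) (weight n)) X" .
  qed auto
qed

lemma nn_integral_prefix:
  assumes [measurable]: "\<Phi> \<in> borel_measurable (prefix_space n)"
  shows "(\<integral>\<^sup>+ z. \<Phi> (prefix n z) \<partial>P) = (\<integral>\<^sup>+ p. \<integral>\<^sup>+ \<omega>. weight n (p, \<omega>) * \<Phi> (p, \<omega>) \<partial>prefix_law n \<partial>\<nu>)"
proof -
  interpret Q: sigma_finite_measure "prefix_law n" by (rule sigma_finite_prefix_law)
  have [measurable]: "weight n \<in> borel_measurable (\<nu> \<Otimes>\<^sub>M prefix_law n)" "\<Phi> \<in> borel_measurable (\<nu> \<Otimes>\<^sub>M prefix_law n)"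
    using weight_measurable assms measurable_cong_sets[OF sets_prefix_pair refl] by blast+
  have "(\<integral>\<^sup>+ z. \<Phi> (prefix n z) \<partial>P) = (\<integral>\<^sup>+ z. \<Phi> z \<partial>distr P (prefix_space n) (prefix n))"
    by (rule nn_integral_distr[symmetric]) auto
  also have "\<dots> = (\<integral>\<^sup>+ z. weight n z * \<Phi> z \<partial>(\<nu> \<Otimes>\<^sub>M prefix_law n))"
    unfolding distr_prefix by (rule nn_integral_density) auto
  also have "\<dots> = (\<integral>\<^sup>+ p. \<integral>\<^sup>+ \<omega>. weight n (p, \<omega>) * \<Phi> (p, \<omega>) \<partial>prefix_law n \<partial>\<nu>)"
    by (rule Q.nn_integral_fst[symmetric]) measurable
  finally show ?thesis .
qed

text \<open>With the last matrix \<open>v\<close> split off, the weight of \<open>n + 1\<close>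
  steps is the squared norm of \<open>v *v y\<close> for
  \<open>y = W \<omega> n *v unit_rep p\<close>. Taking out the squared norm of \<open>y\<close>,
  the weight of \<open>n\<close> steps, leaves the kernel at the line of \<open>y\<close>; where
  \<open>y = 0\<close> both sides vanish.\<close>

lemma nn_integral_markov:
  assumes \<Phi> [measurable]: "\<Phi> \<in> borel_measurable (prefix_space n)"
    and f: "bounded_borel f" "\<And>p. 0 \<le> f p"
  shows "(\<integral>\<^sup>+ z. \<Phi> (prefix n z) * ennreal (f (chain (Suc n) z)) \<partial>P)
       = (\<integral>\<^sup>+ z. \<Phi> (prefix n z) * ennreal (kernel_op \<mu> f (chain n z)) \<partial>P)"
proof -
  interpret product_sigma_finite "\<lambda>_ :: nat. \<mu>" by unfold_locales
  note [measurable] = bounded_borelD[OF f(1)] bounded_borelD[OF bounded_borel_kernel_op[OF f(1)]]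
  let ?r = "\<lambda>(p, \<omega> :: nat \<Rightarrow> complex ^ 'd ^ 'd). (p :: 'd cproj, restrict \<omega> {..<n})"
  have r [measurable]: "?r \<in> measurable (prefix_space (Suc n)) (prefix_space n)" by measurable
  have pr: "prefix n z = ?r (prefix (Suc n) z)" for z by (cases z) (auto simp: prefix_def restrict_def)
  define \<Psi> where "\<Psi> z = \<Phi> (?r z) * ennreal (f (chain (Suc n) z))" for z
  have \<Psi> [measurable]: "\<Psi> \<in> borel_measurable (prefix_space (Suc n))" unfolding \<Psi>_def by measurable
  have "(\<integral>\<^sup>+ z. \<Phi> (prefix n z) * ennreal (f (chain (Suc n) z)) \<partial>P) = (\<integral>\<^sup>+ z. \<Psi> (prefix (Suc n) z) \<partial>P)"
    unfolding \<Psi>_def pr by (simp add: chain_prefix)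
  also have "\<dots> = (\<integral>\<^sup>+ p. \<integral>\<^sup>+ \<omega>. weight (Suc n) (p, \<omega>) * \<Psi> (p, \<omega>) \<partial>prefix_law (Suc n) \<partial>\<nu>)"
    by (rule nn_integral_prefix[OF \<Psi>])
  also have "\<dots> = (\<integral>\<^sup>+ p. \<integral>\<^sup>+ \<omega>. weight n (p, \<omega>) * (\<Phi> (p, \<omega>) * ennreal (kernel_op \<mu> f (chain n (p, \<omega>)))) \<partial>prefix_law n \<partial>\<nu>)"
  proof (rule nn_integral_cong)
    fix p
    have [measurable]: "(\<lambda>\<omega>. weight (Suc n) (p, \<omega>) * \<Psi> (p, \<omega>)) \<in> borel_measurable (prefix_law (Suc n))"
      by measurable
    have "(\<integral>\<^sup>+ \<omega>. weight (Suc n) (p, \<omega>) * \<Psi> (p, \<omega>) \<partial>prefix_law (Suc n)) =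
       (\<integral>\<^sup>+ \<omega>. \<integral>\<^sup>+ v. weight (Suc n) (p, fun_upd \<omega> n v) * \<Psi> (p, fun_upd \<omega> n v) \<partial>\<mu> \<partial>prefix_law n)"
      unfolding lessThan_Suc by (rule product_nn_integral_insert) (simp_all add: lessThan_Suc[symmetric])
    also have "\<dots> = (\<integral>\<^sup>+ \<omega>. weight n (p, \<omega>) * (\<Phi> (p, \<omega>) * ennreal (kernel_op \<mu> f (chain n (p, \<omega>)))) \<partial>prefix_law n)"
    proof (rule nn_integral_cong)
      fix \<omega> :: "nat \<Rightarrow> complex ^ 'd ^ 'd" assume "\<omega> \<in> space (prefix_law n)"
      \<comment> \<open>Points of the product space are undefined outside the index set, so
        restricting undoes the update exactly.\<close>
      then have ext: "restrict (fun_upd \<omega> n v) {..<n} = \<omega>" for v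
        by (auto simp: space_PiM PiE_def extensional_def restrict_def fun_eq_iff)
      define y where "y = W \<omega> n *v unit_rep p"
      have Wn: "W (fun_upd \<omega> n v) (Suc n) *v unit_rep p = v *v y" for v
        using W_cong[of n "fun_upd \<omega> n v" \<omega>] by (simp add: y_def matrix_vector_mul_assoc)
      have A: "weight (Suc n) (p, fun_upd \<omega> n v) * \<Psi> (p, fun_upd \<omega> n v) =
         \<Phi> (p, \<omega>) * ennreal (f (proj_class (v *v y)) * (norm (v *v y))\<^sup>2)" for v
        unfolding weight_def \<Psi>_def chain_def split_beta fst_conv snd_conv Wn ext proj_act_def
        using f(2) by (simp add: ennreal_mult' mult_ac)
      have meas: "(\<lambda>v. ennreal (f (proj_class (v *v y)) * (norm (v *v y))\<^sup>2)) \<in> borel_measurable \<mu>" by measurable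
      have "(\<integral>\<^sup>+ v. ennreal (f (proj_class (v *v y)) * (norm (v *v y))\<^sup>2) \<partial>\<mu>) =
          ennreal ((norm y)\<^sup>2 * kernel_op \<mu> f (proj_class y))"
      proof (cases "y = 0")
        case False
        have eq: "f (proj_class (v *v y)) * (norm (v *v y))\<^sup>2 =
            (norm y)\<^sup>2 * (f (proj_act v (proj_class y)) * (norm (v *v unit_rep (proj_class y)))\<^sup>2)" for v
          using False by (simp add: proj_act_proj_class power_divide)
        have i: "integrable \<mu> (\<lambda>v. f (proj_act v (proj_class y)) * (norm (v *v unit_rep (proj_class y)))\<^sup>2)"
        proof -
          have "integrable (transition (proj_class y)) (\<lambda>v. f (proj_act v (proj_class y)))"
            by (rule integrable_transition[OF f(1)])
          then show ?thesis unfolding transition_def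
            by (subst (asm) integrable_density) (simp_all add: mult.commute)
        qed
        show ?thesis unfolding eq kernel_op_def
          by (subst nn_integral_eq_integral[OF integrable_mult_right[OF i]]) (simp_all add: f(2))
      qed simp
      moreover have "kernel_op \<mu> f q \<ge> 0" for q
        unfolding kernel_op_def by (intro integral_nonneg_AE) (simp add: f(2))
      ultimately show "(\<integral>\<^sup>+ v. weight (Suc n) (p, fun_upd \<omega> n v) * \<Psi> (p, fun_upd \<omega> n v) \<partial>\<mu>) =
          weight n (p, \<omega>) * (\<Phi> (p, \<omega>) * ennreal (kernel_op \<mu> f (chain n (p, \<omega>))))"
        unfolding A nn_integral_cmult[OF meas]
        by (simp add: weight_def chain_def y_def proj_act_def ennreal_mult' mult_ac)
    qed
    finally show "(\<integral>\<^sup>+ \<omega>. weight (Suc n) (p, \<omega>) * \<Psi> (p, \<omega>) \<partial>prefix_law (Suc n)) = \<dots>" .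
  qed
  also have "\<dots> = (\<integral>\<^sup>+ z. \<Phi> (prefix n z) * ennreal (kernel_op \<mu> f (chain n (prefix n z))) \<partial>P)"
    by (rule nn_integral_prefix[symmetric]) measurable
  finally show ?thesis by (simp add: chain_prefix)
qed

text \<open>Instead of factoring \<open>G\<close> through the prefix, the measures with densities
  \<open>f\<close> at time \<open>n + 1\<close> and \<open>kernel_op \<mu> f\<close> at time
  \<open>n\<close> are shown to agree on the history, where \<open>G\<close> lives.\<close>

lemma expectation_markov:
  assumes G: "G \<in> borel_measurable (history n)" "\<And>z. 0 \<le> G z"
    and f: "bounded_borel f" "\<And>p. 0 \<le> f p"
  shows "(\<integral>z. G z * f (chain (Suc n) z) \<partial>P) = (\<integral>z. G z * kernel_op \<mu> f (chain n z) \<partial>P)"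
proof -
  note [measurable] = bounded_borelD[OF f(1)] bounded_borelD[OF bounded_borel_kernel_op[OF f(1)]]
  have kf: "kernel_op \<mu> f q \<ge> 0" for q
    unfolding kernel_op_def by (intro integral_nonneg_AE) (simp add: f(2))
  have GP [measurable]: "G \<in> borel_measurable P" by (rule measurable_from_subalg[OF subalgebra_history G(1)])
  define N1 where "N1 = density P (\<lambda>z. ennreal (f (chain (Suc n) z)))"
  define N2 where "N2 = density P (\<lambda>z. ennreal (kernel_op \<mu> f (chain n z)))"
  have sub: "subalgebra N1 (history n)" "subalgebra N2 (history n)"
    using subalgebra_history[of n] by (auto simp: subalgebra_def N1_def N2_def)
  have "restr_to_subalg N1 (history n) = restr_to_subalg N2 (history n)"
  proof (rule measure_eqI)
    show "sets (restr_to_subalg N1 (history n)) = sets (restr_to_subalg N2 (history n))"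
      by (simp add: sets_restr_to_subalg sub)
    fix A assume "A \<in> sets (restr_to_subalg N1 (history n))"
    then have A: "A \<in> sets (history n)" by (simp add: sets_restr_to_subalg sub)
    then have AP: "A \<in> sets P" using sets_history_P by blast
    obtain B where B: "A = prefix n -` B" "B \<in> sets (prefix_space n)" using A unfolding sets_history by blast
    have ind: "indicator A z = (indicator B (prefix n z) :: ennreal)" for z by (simp add: B(1) indicator_def)
    have [measurable]: "indicator B \<in> borel_measurable (prefix_space n)" using B(2) by simp
    have "emeasure N1 A = (\<integral>\<^sup>+ z. indicator B (prefix n z) * ennreal (f (chain (Suc n) z)) \<partial>P)"
      unfolding N1_def using AP by (subst emeasure_density) (auto simp: ind mult.commute)
    also have "\<dots> = (\<integral>\<^sup>+ z. indicator B (prefix n z) * ennreal (kernel_op \<mu> f (chain n z)) \<partial>P)"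
      by (rule nn_integral_markov[OF _ f]) measurable
    also have "\<dots> = emeasure N2 A"
      unfolding N2_def using AP by (subst emeasure_density) (auto simp: ind mult.commute)
    finally show "emeasure (restr_to_subalg N1 (history n)) A = emeasure (restr_to_subalg N2 (history n)) A"
      using A sub by (simp add: emeasure_restr_to_subalg)
  qed
  moreover have [measurable]: "(\<lambda>z. ennreal (G z)) \<in> borel_measurable (history n)" using G(1) by measurable
  ultimately have "(\<integral>\<^sup>+ z. ennreal (G z) \<partial>N1) = (\<integral>\<^sup>+ z. ennreal (G z) \<partial>N2)"
    using nn_integral_subalgebra2[OF sub(1), of "\<lambda>z. ennreal (G z)"] nn_integral_subalgebra2[OF sub(2), of "\<lambda>z. ennreal (G z)"] by simp
  then have "(\<integral>\<^sup>+ z. ennreal (G z * f (chain (Suc n) z)) \<partial>P) = (\<integral>\<^sup>+ z. ennreal (G z * kernel_op \<mu> f (chain n z)) \<partial>P)"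
    unfolding N1_def N2_def by (simp add: nn_integral_density ennreal_mult' G(2) f(2) kf mult.commute)
  then show ?thesis
    by (subst (1 2) integral_eq_nn_integral) (auto simp: G(2) f(2) kf)
qed

text \<open>The tilts are functions of the current line, so integrating the pointwise kernel bounds
  against \<open>G\<close> and applying the Markov property to \<open>G\<close> times
  \<open>exp (t g)\<close> gives the tilting inequalities.\<close>

lemma log_mgf_process_trajectory:
  assumes pur: "purifying \<mu>" and erg: "ergodic_measure \<mu>" and inv: "invariant_prob \<mu> \<nu>'"
    and gt: "continuous_on UNIV gt" and g: "continuous_on UNIV g"
    and poisson: "\<And>p. gt p - kernel_op \<mu> gt p = g p"
    and \<gamma>: "\<gamma> = (\<integral>p. (gt p)\<^sup>2 - (kernel_op \<mu> gt p)\<^sup>2 \<partial>\<nu>')" and \<gamma>_pos: "\<gamma> > 0"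
  shows "log_mgf_process P history (\<lambda>n z. g (chain n z)) \<gamma>"
proof
  show "space (history n) = space P" for n by simp
  show "sets (history n) \<subseteq> sets P" for n by (rule sets_history_P)
  show "sets (history n) \<subseteq> sets (history (Suc n))" for n by (rule sets_history_Suc)
  have [measurable]: "g \<in> borel_measurable borel" using g by (rule borel_measurable_continuous_onI)
  show "(\<lambda>z. g (chain n z)) \<in> borel_measurable (history n)" for n by measurable
  obtain K where K: "\<And>p. \<bar>g p\<bar> \<le> K" using bounded_borelE[OF bounded_borel_continuous[OF g]] by blast
  then show "\<exists>K. \<forall>n z. \<bar>g (chain n z)\<bar> \<le> K" by blast
  show "\<gamma> > 0" by fact
  fix \<epsilon> :: real assume "\<epsilon> > 0"
  then obtain t0 C :: real and H :: "real \<Rightarrow> 'd cproj \<Rightarrow> real" where t0: "t0 > 0" and C: "C \<ge> 1"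
    and bH: "\<And>t. bounded_borel (H t)"
    and H: "\<And>t p. \<bar>t\<bar> \<le> t0 \<Longrightarrow> 1 / C \<le> H t p \<and> H t p \<le> C"
    and lo: "\<And>t p. \<bar>t\<bar> \<le> t0 \<Longrightarrow> exp (t\<^sup>2 * (\<gamma> - \<epsilon>) / 2) * H t p \<le> exp (t * g p) * kernel_op \<mu> (H t) p"
    and hi: "\<And>t p. \<bar>t\<bar> \<le> t0 \<Longrightarrow> exp (t * g p) * kernel_op \<mu> (H t) p \<le> exp (t\<^sup>2 * (\<gamma> + \<epsilon>) / 2) * H t p"
    by (rule tilted_kernel_bounds[OF pur erg inv gt g poisson \<gamma>]) (rule that; assumption)
  have "tilting P history (\<lambda>n z. g (chain n z)) t (\<gamma> - \<epsilon>) (\<gamma> + \<epsilon>) C (\<lambda>n z. H t (chain n z))" if t: "\<bar>t\<bar> \<le> t0" for t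
    unfolding tilting_def
  proof (intro conjI allI impI)
    note [measurable] = bounded_borelD[OF bH[of t]] bounded_borelD[OF bounded_borel_kernel_op[OF bH[of t]]]
    show "(\<lambda>z. H t (chain n z)) \<in> borel_measurable (history n)" for n by measurable
    show "1 / C \<le> H t (chain n z)" "H t (chain n z) \<le> C" for n z using H[OF t] by auto
    have H0: "0 \<le> H t p" for p using order_trans[OF _ conjunct1[OF H[OF t]], of 0 p] C by simp
    fix n and G :: "'d cproj \<times> (nat \<Rightarrow> complex ^ 'd ^ 'd) \<Rightarrow> real"
    assume G: "G \<in> borel_measurable (history n)" "\<forall>x. 0 \<le> G x" "\<exists>c. \<forall>x. G x \<le> c"
    have GP [measurable]: "G \<in> borel_measurable P" by (rule measurable_from_subalg[OF subalgebra_history G(1)])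
    obtain c where c: "\<And>z. G z \<le> c" using G(3) by blast
    have "(\<lambda>z. G z * exp (t * g (chain n z))) \<in> borel_measurable (history n)" using G(1) by measurable
    from expectation_markov[OF this _ bH[of t] H0]
    have eq: "P.expectation (\<lambda>z. G z * (exp (t * g (chain n z)) * H t (chain (Suc n) z))) =
       P.expectation (\<lambda>z. G z * (exp (t * g (chain n z)) * kernel_op \<mu> (H t) (chain n z)))"
      using G(2) by (simp add: mult.assoc)
    have int: "integrable P (\<lambda>z. G z * h (chain n z))" if h: "bounded_borel h" for h
    proof -
      obtain L where L: "L \<ge> 0" "\<And>p. \<bar>h p\<bar> \<le> L" using bounded_borelE[OF h] by blast
      note [measurable] = bounded_borelD[OF h]
      have "\<bar>G z * h (chain n z)\<bar> \<le> c * L" for z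
      proof -
        have Gz: "0 \<le> G z" "G z \<le> c" using G(2) c by blast+
        then show ?thesis unfolding abs_mult using L by (intro mult_mono) auto
      qed
      then show ?thesis by (intro P.integrable_const_bound[of _ "c * L"]) auto
    qed
    have b1: "bounded_borel (\<lambda>p. exp (t * g p) * kernel_op \<mu> (H t) p)"
      by (intro bounded_borel_mult bounded_borel_exp bounded_borel_cmult bounded_borel_kernel_op bH bounded_borel_continuous[OF g])
    have b2: "bounded_borel (\<lambda>p. a * H t p)" for a by (intro bounded_borel_cmult bH)
    have "P.expectation (\<lambda>z. G z * (exp (t\<^sup>2 * (\<gamma> - \<epsilon>) / 2) * H t (chain n z))) \<le>
        P.expectation (\<lambda>z. G z * (exp (t * g (chain n z)) * kernel_op \<mu> (H t) (chain n z)))"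
      by (intro integral_mono int[OF b1] int[OF b2] mult_left_mono lo[OF t]) (use G(2) in auto)
    then show "exp (t\<^sup>2 * (\<gamma> - \<epsilon>) / 2) * P.expectation (\<lambda>z. G z * H t (chain n z)) \<le>
        P.expectation (\<lambda>z. G z * (exp (t * g (chain n z)) * H t (chain (Suc n) z)))"
      unfolding eq by (simp add: mult.left_commute[of "G _"])
    have "P.expectation (\<lambda>z. G z * (exp (t * g (chain n z)) * kernel_op \<mu> (H t) (chain n z))) \<le>
       P.expectation (\<lambda>z. G z * (exp (t\<^sup>2 * (\<gamma> + \<epsilon>) / 2) * H t (chain n z)))"
      by (intro integral_mono int[OF b1] int[OF b2] mult_left_mono hi[OF t]) (use G(2) in auto)
    then show "P.expectation (\<lambda>z. G z * (exp (t * g (chain n z)) * H t (chain (Suc n) z))) \<le>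
       exp (t\<^sup>2 * (\<gamma> + \<epsilon>) / 2) * P.expectation (\<lambda>z. G z * H t (chain n z))"
      unfolding eq by (simp add: mult.left_commute[of "G _"])
  qed
  then show "\<exists>t0>0. \<exists>C\<ge>1. \<forall>t. \<bar>t\<bar> \<le> t0 \<longrightarrow> (\<exists>H. tilting P history (\<lambda>n z. g (chain n z)) t (\<gamma> - \<epsilon>) (\<gamma> + \<epsilon>) C H)"
    using t0 C by blast
qed

end

section \<open>The zero matrix\<close>

text \<open>Without \<open>\<sigma>\<close>-finiteness the product measure may fail to exist, in which case \<^const>\<open>PiM\<close> is the
  zero measure.\<close>

lemma PiM_box_or_null:
  assumes I: "finite I"
  shows "(\<forall>A. (\<forall>i\<in>I. A i \<in> sets (M i)) \<longrightarrow> emeasure (PiM I M) (Pi\<^sub>E I A) = (\<Prod>i\<in>I. emeasure (M i) (A i)))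
    \<or> emeasure (PiM I M) (space (PiM I M)) = 0"
proof -
  let ?\<Omega> = "\<Pi>\<^sub>E i\<in>I. space (M i)"
  let ?J = "{(J, X). (J \<noteq> {} \<or> I = {}) \<and> finite J \<and> J \<subseteq> I \<and> X \<in> (\<Pi> j\<in>J. sets (M j))}"
  let ?G = "\<lambda>(J, X). prod_emb I M J (Pi\<^sub>E J X)"
  let ?m = "\<lambda>(J, X). \<Prod>j\<in>J \<union> {i\<in>I. emeasure (M i) (space (M i)) \<noteq> 1}.
      if j \<in> J then emeasure (M j) (X j) else emeasure (M j) (space (M j))"
  have G: "?G ` ?J \<subseteq> Pow ?\<Omega>" by (auto simp: prod_emb_def)
  show ?thesis
  \<comment> \<open>The case distinction built into \<open>extend_measure\<close>, through which
    \<open>PiM\<close> is defined: if no measure has the prescribed values, the result is the zero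
    measure of \<open>sigma\<close>.\<close>
  proof (cases "\<exists>m. (\<forall>i\<in>?J. m (?G i) = ?m i) \<and> measure_space ?\<Omega> (sigma_sets ?\<Omega> (?G ` ?J)) m")
    case True
    then obtain m where m: "\<And>i. i \<in> ?J \<Longrightarrow> m (?G i) = ?m i" "measure_space ?\<Omega> (sigma_sets ?\<Omega> (?G ` ?J)) m"
      by blast
    have sets: "sets (PiM I M) = sigma_sets ?\<Omega> (?G ` ?J)"
      by (simp only: sets_PiM prod_algebra_def)
    have "emeasure (PiM I M) (Pi\<^sub>E I A) = (\<Prod>i\<in>I. emeasure (M i) (A i))" if A: "\<forall>i\<in>I. A i \<in> sets (M i)" for A
    proof -
      have "emeasure (PiM I M) (prod_emb I M I (Pi\<^sub>E I A)) = (\<Prod>j\<in>I \<union> {i\<in>I. emeasure (M i) (space (M i)) \<noteq> 1}.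
          if j \<in> I then emeasure (M j) (A j) else emeasure (M j) (space (M j)))"
      proof (subst emeasure_extend_measure_Pair[OF PiM_def, where \<mu>' = m])
        fix J X assume "(J \<noteq> {} \<or> I = {}) \<and> finite J \<and> J \<subseteq> I \<and> X \<in> (\<Pi> j\<in>J. sets (M j))"
        then have "(J, X) \<in> ?J" by simp
        from m(1)[OF this] show "m (prod_emb I M J (Pi\<^sub>E J X)) = (\<Prod>j\<in>J \<union> {i\<in>I. emeasure (M i) (space (M i)) \<noteq> 1}.
            if j \<in> J then emeasure (M j) (X j) else emeasure (M j) (space (M j)))" by (simp only: split)
      qed (use m(2) I A in \<open>auto simp: sets measure_space_def prod_emb_def\<close>)
      moreover have "prod_emb I M I (Pi\<^sub>E I A) = Pi\<^sub>E I A"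
        using A sets.sets_into_space by (intro prod_emb_PiE_same_index) blast
      moreover have "I \<union> {i\<in>I. emeasure (M i) (space (M i)) \<noteq> 1} = I" by blast
      ultimately show ?thesis by (simp cong: prod.cong)
    qed
    then show ?thesis by blast
  next
    case False
    have "PiM I M = extend_measure ?\<Omega> ?J ?G ?m" by (rule PiM_def)
    also have "\<dots> = sigma ?\<Omega> (?G ` ?J)" unfolding extend_measure_def by (simp only: False simp_thms if_False)
    finally have "emeasure (PiM I M) = (\<lambda>_. 0)" by (simp only: emeasure_sigma)
    then show ?thesis by simp
  qed
qed

lemma W_eq_0: "i < n \<Longrightarrow> \<omega> i = 0 \<Longrightarrow> W \<omega> n = (0 :: complex ^ 'd::finite ^ 'd)"
proof (induction n)
  case (Suc n)
  have "A ** 0 = 0" "0 ** A = 0" for A :: "complex ^ 'd ^ 'd"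
    by (simp_all add: matrix_matrix_mult_def vec_eq_iff)
  then show ?case using Suc by (cases "i = n") auto
qed simp

text \<open>Dropping a possible atom at \<open>0\<close> makes \<open>\<mu>\<close> \<open>\<sigma>\<close>-finite, because \<open>\<parallel>v\<parallel>\<^sup>2\<close> is integrable.\<close>

definition nonzero_part :: "(complex ^ 'd::finite ^ 'd) measure \<Rightarrow> (complex ^ 'd ^ 'd) measure" where
  "nonzero_part \<mu> = density \<mu> (indicator (- {0}))"

lemma sets_nonzero_part [simp, measurable_cong]: "sets (nonzero_part \<mu>) = sets \<mu>"
  by (simp add: nonzero_part_def)

lemma emeasure_nonzero_part:
  assumes "sets \<mu> = sets borel" "A \<in> sets borel"
  shows "emeasure (nonzero_part \<mu>) A = emeasure \<mu> (A - {0})"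
proof -
  have "emeasure (nonzero_part \<mu>) A = (\<integral>\<^sup>+ v. indicator (- {0}) v * indicator A v \<partial>\<mu>)"
    unfolding nonzero_part_def using assms by (intro emeasure_density) auto
  also have "\<dots> = (\<integral>\<^sup>+ v. indicator (A - {0}) v \<partial>\<mu>)"
    by (intro nn_integral_cong) (auto simp: indicator_def)
  also have "\<dots> = emeasure \<mu> (A - {0})" using assms by (intro nn_integral_indicator) auto
  finally show ?thesis .
qed

text \<open>The trace of \<open>adj v ** v\<close> is the squared Hilbert-Schmidt norm, so unitality
  makes \<open>(norm v)^2\<close> integrable, and Markov's inequality bounds the mass of the
  matrices of norm at least \<open>1 / Suc n\<close>.\<close>

lemma kraus_nonzero_part:
  assumes sets [measurable_cong]: "sets \<mu> = sets borel"
    and unital: "has_bochner_integral \<mu> (\<lambda>v :: complex ^ 'd::finite ^ 'd. adj v ** v) (mat 1)"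
  shows "kraus_measure (nonzero_part \<mu>)"
proof
  have ind: "(indicator (- {0}) :: complex ^ 'd ^ 'd \<Rightarrow> ennreal) = (\<lambda>v. ennreal (indicator (- {0}) v))"
    by (auto simp: indicator_def)
  have z: "adj 0 ** (0 :: complex ^ 'd ^ 'd) = 0" by (simp add: matrix_matrix_mult_def vec_eq_iff)
  have "has_bochner_integral \<mu> (\<lambda>v :: complex ^ 'd ^ 'd. indicator (- {0}) v *\<^sub>R (adj v ** v)) (mat 1)"
  proof -
    have "(\<lambda>v :: complex ^ 'd ^ 'd. indicator (- {0}) v *\<^sub>R (adj v ** v)) = (\<lambda>v. adj v ** v)"
      by (auto simp: indicator_def z)
    then show ?thesis using unital by simp
  qed
  then show "has_bochner_integral (nonzero_part \<mu>) (\<lambda>v. adj v ** v) (mat 1)"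
    unfolding nonzero_part_def ind by (intro has_bochner_integral_density) auto
  show "sets (nonzero_part \<mu>) = sets borel" by (simp add: sets)
  have int: "integrable \<mu> (\<lambda>v :: complex ^ 'd ^ 'd. (norm v)\<^sup>2)"
  proof -
    have "bounded_linear (\<lambda>A :: complex ^ 'd ^ 'd. Re (\<Sum>i\<in>UNIV. A $ i $ i))"
      by (intro bounded_linear_compose[OF bounded_linear_Re] bounded_linear_sum
          bounded_linear_compose[OF bounded_linear_vec_nth bounded_linear_vec_nth])
    from has_bochner_integral_bounded_linear[OF this unital]
    have "integrable \<mu> (\<lambda>v :: complex ^ 'd ^ 'd. Re (\<Sum>i\<in>UNIV. (adj v ** v) $ i $ i))"
      by (simp add: has_bochner_integral_iff)
    moreover have "Re (\<Sum>i\<in>UNIV. (adj v ** v) $ i $ i) = (norm v)\<^sup>2" for v :: "complex ^ 'd ^ 'd"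
    proof -
      have "(adj v ** v) $ i $ i = hinner (column i v) (column i v)" for i
        by (simp add: matrix_matrix_mult_def adj_def hinner_def column_def)
      then show ?thesis by (simp add: hinner_self norm_sq_columns)
    qed
    ultimately show ?thesis by simp
  qed
  \<comment> \<open>Including 0 makes these sets exhaust the space; \<open>nonzero_part\<close> has
    no mass there.\<close>
  define B where "B n = {v :: complex ^ 'd ^ 'd. v = 0 \<or> 1 / real (Suc n) \<le> norm v}" for n
  have B [measurable]: "B n \<in> sets borel" for n unfolding B_def by measurable
  have "emeasure (nonzero_part \<mu>) (B n) \<noteq> \<infinity>" for n
  proof -
    have "emeasure (nonzero_part \<mu>) (B n) = (\<integral>\<^sup>+ v. indicator (B n - {0}) v \<partial>\<mu>)"
      by (simp add: emeasure_nonzero_part sets)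
    also have "\<dots> \<le> (\<integral>\<^sup>+ v. ennreal ((real (Suc n))\<^sup>2 * (norm v)\<^sup>2) \<partial>\<mu>)"
    proof (rule nn_integral_mono)
      fix v :: "complex ^ 'd ^ 'd"
      show "indicator (B n - {0}) v \<le> ennreal ((real (Suc n))\<^sup>2 * (norm v)\<^sup>2)"
      proof (cases "v \<in> B n - {0}")
        case True
        then have "1 \<le> real (Suc n) * norm v" by (auto simp: B_def field_simps)
        then have "1 \<le> (real (Suc n) * norm v)\<^sup>2" by simp
        then show ?thesis using True by (simp add: power_mult_distrib del: of_nat_Suc)
      qed simp
    qed
    also have "\<dots> < \<infinity>" using int by (subst nn_integral_eq_integral) auto
    finally show ?thesis by simp
  qed
  moreover have "(\<Union>n. B n) = UNIV"
  proof -
    have "\<exists>n. v \<in> B n" for v :: "complex ^ 'd ^ 'd"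
    proof (cases "v = 0")
      case False
      then obtain n where "1 / real (Suc n) < norm v" using nat_approx_posE[of "norm v"] by auto
      then show ?thesis by (intro exI[of _ n]) (simp add: B_def)
    qed (auto simp: B_def)
    then show ?thesis by auto
  qed
  ultimately show "\<exists>A. countable A \<and> A \<subseteq> sets (nonzero_part \<mu>) \<and> \<Union> A = space (nonzero_part \<mu>) \<and>
      (\<forall>a\<in>A. emeasure (nonzero_part \<mu>) a \<noteq> \<infinity>)"
    using sets_eq_imp_space_eq[OF sets] B
    by (intro exI[of _ "range B"]) (auto simp: nonzero_part_def sets)
qed

lemma kernel_op_nonzero_part:
  assumes sets [measurable_cong]: "sets \<mu> = sets borel" and [measurable]: "f \<in> borel_measurable borel"
  shows "kernel_op (nonzero_part \<mu>) f p = kernel_op \<mu> f p"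
proof -
  have ind: "nonzero_part \<mu> = density \<mu> (\<lambda>v. ennreal (indicator (- {0}) v))"
    unfolding nonzero_part_def by (rule density_cong) (auto simp: indicator_def sets)
  have "kernel_op (nonzero_part \<mu>) f p = (\<integral>v. indicator (- {0}) v * (f (proj_act v p) * (norm (v *v unit_rep p))\<^sup>2) \<partial>\<mu>)"
    unfolding kernel_op_def ind by (subst integral_density) auto
  also have "\<dots> = kernel_op \<mu> f p" unfolding kernel_op_def
    by (intro Bochner_Integration.integral_cong) (auto simp: indicator_def)
  finally show ?thesis .
qed

lemma invariant_prob_nonzero_part:
  assumes sets [measurable_cong]: "sets \<mu> = sets borel" and inv: "invariant_prob \<mu> \<nu>"
  shows "invariant_prob (nonzero_part \<mu>) \<nu>"
proof -
  have "kernel (nonzero_part \<mu>) p S = kernel \<mu> p S" if [measurable]: "S \<in> sets borel" for p S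
  proof -
    have "kernel (nonzero_part \<mu>) p S =
        (\<integral>\<^sup>+ v. indicator (- {0}) v * (indicator S (proj_act v p) * ennreal ((norm (v *v unit_rep p))\<^sup>2)) \<partial>\<mu>)"
      unfolding kernel_def nonzero_part_def by (rule nn_integral_density) measurable
    also have "\<dots> = kernel \<mu> p S" unfolding kernel_def
      by (intro nn_integral_cong) (auto simp: indicator_def)
    finally show ?thesis .
  qed
  then show ?thesis using inv by (simp add: invariant_prob_def)
qed

text \<open>The supports agree off 0, and the zero matrix maps every subspace into itself.\<close>

lemma ergodic_nonzero_part:
  assumes sets: "sets \<mu> = sets borel" and erg: "ergodic_measure \<mu>"
  shows "ergodic_measure (nonzero_part \<mu>)"
proof -
  have supp: "v \<in> msupport (nonzero_part \<mu>) \<longleftrightarrow> v \<in> msupport \<mu>" if v: "v \<noteq> 0" for v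
  proof
    assume "v \<in> msupport (nonzero_part \<mu>)"
    then have "emeasure (nonzero_part \<mu>) U > 0" if "open U" "v \<in> U" for U using that by (auto simp: msupport_def)
    moreover have "emeasure (nonzero_part \<mu>) U \<le> emeasure \<mu> U" if "open U" for U
      using that by (simp add: emeasure_nonzero_part sets) (intro emeasure_mono, auto simp: sets)
    ultimately show "v \<in> msupport \<mu>" unfolding msupport_def by (auto intro: less_le_trans)
  next
    assume "v \<in> msupport \<mu>"
    moreover have "open (U - {0})" "v \<in> U - {0}" if "open U" "v \<in> U" for U using that v by auto
    ultimately show "v \<in> msupport (nonzero_part \<mu>)"
      unfolding msupport_def by (auto simp: emeasure_nonzero_part sets)
  qed
  have "invariant_subspace (nonzero_part \<mu>) E = invariant_subspace \<mu> E" for E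
  proof (cases "vec.subspace E")
    case True
    then have "0 \<in> E" by (rule vec.subspace_0)
    then have "(*v) 0 ` E \<subseteq> E" by auto
    then have "(\<forall>v\<in>msupport (nonzero_part \<mu>). (*v) v ` E \<subseteq> E) = (\<forall>v\<in>msupport \<mu>. (*v) v ` E \<subseteq> E)"
      using supp by metis
    then show ?thesis unfolding invariant_subspace_def by simp
  qed (simp add: invariant_subspace_def)
  then show ?thesis using erg by (simp add: ergodic_measure_def)
qed

text \<open>By \<open>PiM_box_or_null\<close> a product of nonzero mass has the expected values on
  boxes, and box values determine the product of the sigma-finite measure
  \<open>nonzero_part \<mu>\<close>.\<close>

lemma PiM_nonzero_part:
  fixes n :: nat
  assumes sets: "sets \<mu> = sets borel" and kr: "kraus_measure (nonzero_part \<mu>)"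
    and nn: "emeasure (\<Pi>\<^sub>M i\<in>{..<n}. \<mu>) (space (\<Pi>\<^sub>M i\<in>{..<n}. \<mu>)) \<noteq> 0"
  shows "(\<Pi>\<^sub>M i\<in>{..<n}. nonzero_part \<mu>) =
    density (\<Pi>\<^sub>M i\<in>{..<n}. \<mu>) (indicator {\<omega> \<in> space (\<Pi>\<^sub>M i\<in>{..<n}. \<mu>). \<forall>i\<in>{..<n}. \<omega> i \<noteq> (0 :: complex ^ 'd::finite ^ 'd)})"
    and "{\<omega> \<in> space (\<Pi>\<^sub>M i\<in>{..<n}. \<mu>). \<forall>i\<in>{..<n}. \<omega> i \<noteq> (0 :: complex ^ 'd ^ 'd)} \<in> sets (\<Pi>\<^sub>M i\<in>{..<n}. \<mu>)"
proof -
  interpret kraus_measure "nonzero_part \<mu>" by fact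
  interpret product_sigma_finite "\<lambda>_ :: nat. nonzero_part \<mu>" by unfold_locales
  let ?Q = "\<Pi>\<^sub>M i\<in>{..<n}. \<mu>"
  let ?N = "{\<omega> \<in> space ?Q. \<forall>i\<in>{..<n}. \<omega> i \<noteq> (0 :: complex ^ 'd ^ 'd)}"
  have space: "space \<mu> = UNIV" using sets_eq_imp_space_eq[OF sets] by simp
  have box: "emeasure ?Q (Pi\<^sub>E {..<n} A) = (\<Prod>i\<in>{..<n}. emeasure \<mu> (A i))"
    if "\<forall>i\<in>{..<n}. A i \<in> sets \<mu>" for A
    using PiM_box_or_null[of "{..<n}" "\<lambda>_. \<mu>"] nn that by auto
  have N_eq: "?N = Pi\<^sub>E {..<n} (\<lambda>_. - {0})" by (auto simp: space_PiM space PiE_def)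
  have "Pi\<^sub>E {..<n} (\<lambda>_. - {0 :: complex ^ 'd ^ 'd}) \<in> sets ?Q" by (rule sets_PiM_I_finite) (auto simp: sets)
  then show N: "?N \<in> sets ?Q" unfolding N_eq .
  show "(\<Pi>\<^sub>M i\<in>{..<n}. nonzero_part \<mu>) = density ?Q (indicator ?N)"
  proof (rule PiM_eqI[symmetric])
    show "sets (density ?Q (indicator ?N)) = sets (\<Pi>\<^sub>M i\<in>{..<n}. nonzero_part \<mu>)"
      by (simp cong: sets_PiM_cong)
    fix A assume A: "\<And>i. i \<in> {..<n} \<Longrightarrow> A i \<in> sets (nonzero_part \<mu>)"
    have PA: "Pi\<^sub>E {..<n} A \<in> sets ?Q" by (rule sets_PiM_I_finite) (use A in auto)
    have "emeasure (density ?Q (indicator ?N)) (Pi\<^sub>E {..<n} A) = (\<integral>\<^sup>+ \<omega>. indicator ?N \<omega> * indicator (Pi\<^sub>E {..<n} A) \<omega> \<partial>?Q)"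
      by (intro emeasure_density PA borel_measurable_indicator N)
    also have "\<dots> = (\<integral>\<^sup>+ \<omega>. indicator (Pi\<^sub>E {..<n} (\<lambda>i. A i - {0})) \<omega> \<partial>?Q)"
      unfolding N_eq by (intro nn_integral_cong) (auto simp: indicator_def PiE_def Pi_iff)
    also have "\<dots> = emeasure ?Q (Pi\<^sub>E {..<n} (\<lambda>i. A i - {0}))"
      by (intro nn_integral_indicator sets_PiM_I_finite) (use A sets in auto)
    also have "\<dots> = (\<Prod>i\<in>{..<n}. emeasure \<mu> (A i - {0}))" by (rule box) (use A sets in auto)
    also have "\<dots> = (\<Prod>i\<in>{..<n}. emeasure (nonzero_part \<mu>) (A i))"
      using A sets by (intro prod.cong refl emeasure_nonzero_part[symmetric]) auto
    finally show "emeasure (density ?Q (indicator ?N)) (Pi\<^sub>E {..<n} A) = (\<Prod>i\<in>{..<n}. emeasure (nonzero_part \<mu>) (A i))" .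
  qed simp
qed

text \<open>The premise of (Pur) is carried back to \<open>\<mu>\<close>: it is trivial for a null
  product, and a tuple with a zero entry has \<open>W \<omega> n = 0\<close>, which gives
  proportionality with factor 0.\<close>

lemma purifying_nonzero_part:
  assumes sets: "sets \<mu> = sets borel" and kr: "kraus_measure (nonzero_part \<mu>)" and pur: "purifying \<mu>"
  shows "purifying (nonzero_part \<mu>)"
  unfolding purifying_def
proof (intro allI impI)
  fix \<pi> :: "complex ^ 'a ^ 'a"
  let ?P = "\<lambda>n \<omega>. proportional_to (\<pi> ** adj (W \<omega> n) ** W \<omega> n ** \<pi>) \<pi>"
  assume a: "\<pi> \<noteq> 0 \<and> orthogonal_projector \<pi> \<and> (\<forall>n. AE \<omega> in (\<Pi>\<^sub>M i\<in>{..<n}. nonzero_part \<mu>). ?P n \<omega>)"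
  have "AE \<omega> in (\<Pi>\<^sub>M i\<in>{..<n}. \<mu>). ?P n \<omega>" for n
  proof (cases "emeasure (\<Pi>\<^sub>M i\<in>{..<n}. \<mu>) (space (\<Pi>\<^sub>M i\<in>{..<n}. \<mu>)) = 0")
    case True
    then have "space (\<Pi>\<^sub>M i\<in>{..<n}. \<mu>) \<in> null_sets (\<Pi>\<^sub>M i\<in>{..<n}. \<mu>)" by auto
    then show ?thesis by (rule AE_I') auto
  next
    case False
    let ?Q = "\<Pi>\<^sub>M i\<in>{..<n}. \<mu>"
    note d = PiM_nonzero_part[OF sets kr False]
    have "AE \<omega> in (\<Pi>\<^sub>M i\<in>{..<n}. nonzero_part \<mu>). ?P n \<omega>" using a by blast
    then have "AE \<omega> in ?Q. (0 :: ennreal) < indicator {\<omega> \<in> space ?Q. \<forall>i\<in>{..<n}. \<omega> i \<noteq> 0} \<omega> \<longrightarrow> ?P n \<omega>"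
      unfolding d(1) by (subst (asm) AE_density) (use d(2) in auto)
    then show ?thesis
    proof (rule AE_mp, intro AE_I2 impI)
      fix \<omega> assume \<omega>: "\<omega> \<in> space ?Q" "(0 :: ennreal) < indicator {\<omega> \<in> space ?Q. \<forall>i\<in>{..<n}. \<omega> i \<noteq> 0} \<omega> \<longrightarrow> ?P n \<omega>"
      show "?P n \<omega>"
      proof (cases "\<forall>i\<in>{..<n}. \<omega> i \<noteq> 0")
        case False
        then have "W \<omega> n = 0" using W_eq_0 by blast
        then have "\<pi> ** adj (W \<omega> n) ** W \<omega> n ** \<pi> = map_matrix ((*) 0) \<pi>"
          by (simp add: matrix_matrix_mult_def map_matrix_def vec_eq_iff)
        then show ?thesis unfolding proportional_to_def by blast
      qed (use \<omega> in auto)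
    qed
  qed
  then show "rank \<pi> = 1" using pur a unfolding purifying_def by blast
qed

text \<open>Tuples with a zero entry have weight 0, so the integrals over tuples do not
  change.\<close>

lemma path_measure_nonzero_part:
  assumes sets: "sets \<mu> = sets borel" and kr: "kraus_measure (nonzero_part \<mu>)"
    and \<nu>: "proj_prob \<nu>" and path: "is_path_measure \<mu> \<nu> P"
  shows "is_path_measure (nonzero_part \<mu>) \<nu> P"
  unfolding is_path_measure_def
proof (intro conjI allI ballI)
  show P: "prob_space P" and sets_P: "sets P = sets path_space"
    using path by (auto simp: is_path_measure_def)
  interpret P: prob_space P by fact
  have space_P: "space P = UNIV"
    using sets_eq_imp_space_eq[OF sets_P] by (simp add: path_space_def space_pair_measure space_PiM)
  fix n :: nat and S :: "'a cproj set" and A :: "(nat \<Rightarrow> complex ^ 'a ^ 'a) set"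
  let ?Q = "\<Pi>\<^sub>M i\<in>{..<n}. \<mu>"
  let ?N = "{\<omega> \<in> space ?Q. \<forall>i\<in>{..<n}. \<omega> i \<noteq> (0 :: complex ^ 'a ^ 'a)}"
  assume S: "S \<in> sets borel" and A: "A \<in> sets (\<Pi>\<^sub>M i\<in>{..<n}. borel)"
  have sets_Q: "sets ?Q = sets (\<Pi>\<^sub>M i\<in>{..<n}. borel)" by (intro sets_PiM_cong) (auto simp: sets)
  \<comment> \<open>A product of mass 0 would give the path measure total mass 0, as the full
    rectangle shows.\<close>
  have nn: "emeasure ?Q (space ?Q) \<noteq> 0"
  proof
    assume "emeasure ?Q (space ?Q) = 0"
    then have null: "space ?Q \<in> null_sets ?Q" by auto
    have "(\<integral>\<^sup>+ \<omega>\<in>space ?Q. ennreal ((norm (W \<omega> n *v unit_rep p))\<^sup>2) \<partial>?Q) = 0" for p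
    proof -
      have "AE \<omega> in ?Q. ennreal ((norm (W \<omega> n *v unit_rep p))\<^sup>2) * indicator (space ?Q) \<omega> = 0"
        by (rule AE_I'[OF null]) auto
      then show ?thesis by (subst nn_integral_cong_AE[where v = "\<lambda>_. 0"]) auto
    qed
    moreover have "space ?Q \<in> sets (\<Pi>\<^sub>M i\<in>{..<n}. borel)" using sets_Q by blast
    ultimately have "emeasure P (UNIV \<times> {\<omega>. restrict \<omega> {..<n} \<in> space ?Q}) = 0"
      using path by (simp add: is_path_measure_def)
    moreover have "UNIV \<times> {\<omega>. restrict \<omega> {..<n} \<in> space ?Q} = space P"
      using sets_eq_imp_space_eq[OF sets] by (auto simp: space_P space_PiM)
    ultimately show False using P.emeasure_space_1 by simp
  qed
  note d = PiM_nonzero_part[OF sets kr nn]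
  have "(\<integral>\<^sup>+ \<omega>\<in>A. ennreal ((norm (W \<omega> n *v unit_rep p))\<^sup>2) \<partial>?Q) =
      (\<integral>\<^sup>+ \<omega>\<in>A. ennreal ((norm (W \<omega> n *v unit_rep p))\<^sup>2) \<partial>(\<Pi>\<^sub>M i\<in>{..<n}. nonzero_part \<mu>))" for p
  proof -
    have [measurable]: "(\<lambda>\<omega>. W \<omega> n) \<in> borel_measurable ?Q" by (rule W_measurable) (auto simp: sets)
    have [measurable]: "A \<in> sets ?Q" using A sets_Q by blast
    have "(\<integral>\<^sup>+ \<omega>\<in>A. ennreal ((norm (W \<omega> n *v unit_rep p))\<^sup>2) \<partial>(\<Pi>\<^sub>M i\<in>{..<n}. nonzero_part \<mu>)) =
       (\<integral>\<^sup>+ \<omega>. indicator ?N \<omega> * (ennreal ((norm (W \<omega> n *v unit_rep p))\<^sup>2) * indicator A \<omega>) \<partial>?Q)"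
      unfolding d(1) by (rule nn_integral_density) (use d(2) in measurable)
    also have "\<dots> = (\<integral>\<^sup>+ \<omega>\<in>A. ennreal ((norm (W \<omega> n *v unit_rep p))\<^sup>2) \<partial>?Q)"
    proof (rule nn_integral_cong)
      fix \<omega> assume \<omega>: "\<omega> \<in> space ?Q"
      show "indicator ?N \<omega> * (ennreal ((norm (W \<omega> n *v unit_rep p))\<^sup>2) * indicator A \<omega>) =
         ennreal ((norm (W \<omega> n *v unit_rep p))\<^sup>2) * indicator A \<omega>"
      proof (cases "\<omega> \<in> ?N")
        case False
        then have "W \<omega> n = 0" using \<omega> W_eq_0 by blast
        then show ?thesis by simp
      qed simp
    qed
    finally show ?thesis ..
  qed
  then show "emeasure P (S \<times> {\<omega>. restrict \<omega> {..<n} \<in> A}) =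
      (\<integral>\<^sup>+ p\<in>S. (\<integral>\<^sup>+ \<omega>\<in>A. ennreal ((norm (W \<omega> n *v unit_rep p))\<^sup>2) \<partial>(\<Pi>\<^sub>M i\<in>{..<n}. nonzero_part \<mu>)) \<partial>\<nu>)"
    using path S A by (simp add: is_path_measure_def)
qed

section \<open>Hoelder continuity and the passage back to the given measure\<close>

lemma holder_continuous_imp_continuous:
  assumes "holder_continuous g" shows "continuous_on UNIV g"
proof -
  obtain \<alpha> C where "\<alpha> \<in> {0<..1}" "\<forall>p q. \<bar>g p - g q\<bar> \<le> C * dist p q powr \<alpha>"
    using assms unfolding holder_continuous_def by blast
  then have \<alpha>: "0 < \<alpha>" and C: "\<And>p q. \<bar>g p - g q\<bar> \<le> C * dist p q powr \<alpha>" by auto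
  have "isCont g p" for p
    unfolding isCont_def
  proof (rule LIM_zero_cancel, rule Lim_null_comparison)
    show "\<forall>\<^sub>F q in at p. norm (g q - g p) \<le> C * dist q p powr \<alpha>" using C by simp
    have "((\<lambda>q. dist q p) \<longlongrightarrow> dist p p) (at p)" by (intro tendsto_intros)
    then have "((\<lambda>q. dist q p powr \<alpha>) \<longlongrightarrow> 0) (at p)"
      using \<alpha> by (intro tendsto_zero_powrI[where b = \<alpha>]) (auto intro: tendsto_const)
    then show "((\<lambda>q. C * dist q p powr \<alpha>) \<longlongrightarrow> 0) (at p)" by (rule tendsto_mult_right_zero)
  qed
  then show ?thesis by (simp add: continuous_at_imp_continuous_on)
qed

theorem theorem6p1:
  fixes \<mu> :: "(complex ^ 'd ^ 'd) measure"
    and \<nu>\<^sub>i\<^sub>n\<^sub>v \<nu> :: "('d cproj) measure"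
    and P :: "('d cproj \<times> (nat \<Rightarrow> complex ^ 'd ^ 'd)) measure"
    and g gt :: "'d cproj \<Rightarrow> real"
    and \<gamma>sq :: real
  assumes "sets \<mu> = sets borel"
    and "(\<integral>\<^sup>+ v. ennreal ((onorm ((*v) v))\<^sup>2) \<partial>\<mu>) < \<infinity>"
    and "has_bochner_integral \<mu> (\<lambda>v. adj v ** v) (mat 1)"
    and "purifying \<mu>"
    and "ergodic_measure \<mu>"
    and "invariant_prob \<mu> \<nu>\<^sub>i\<^sub>n\<^sub>v"
    and "holder_continuous g"
    and "(\<integral>p. g p \<partial>\<nu>\<^sub>i\<^sub>n\<^sub>v) = 0"
    and "continuous_on UNIV gt"
    and "\<And>p. gt p - kernel_op \<mu> gt p = g p"
    and "\<gamma>sq = (\<integral>p. (gt p)\<^sup>2 - (kernel_op \<mu> gt p)\<^sup>2 \<partial>\<nu>\<^sub>i\<^sub>n\<^sub>v)"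
    and "\<gamma>sq > 0"
    and "proj_prob \<nu>"
    and "is_path_measure \<mu> \<nu> P"
  shows "\<forall>s\<in>{1, -1}. AE z in P.
    limsup (\<lambda>n. ereal (s * birkhoff_sum g n z / sqrt (2 * real n * \<gamma>sq * ln (ln (real n))))) = 1"
proof -
  let ?\<mu> = "nonzero_part \<mu>"
  have kr: "kraus_measure ?\<mu>" by (rule kraus_nonzero_part[OF assms(1,3)])
  have kernel: "kernel_op ?\<mu> gt p = kernel_op \<mu> gt p" for p
    by (rule kernel_op_nonzero_part[OF assms(1) borel_measurable_continuous_onI[OF assms(9)]])
  interpret kraus_measure ?\<mu> by (rule kr)
  interpret quantum_trajectory ?\<mu> \<nu> P
    by unfold_locales (rule assms(13) path_measure_nonzero_part[OF assms(1) kr assms(13,14)])+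
  have cg: "continuous_on UNIV g" by (rule holder_continuous_imp_continuous[OF assms(7)])
  interpret L: log_mgf_process P history "\<lambda>n z. g (chain n z)" \<gamma>sq
    by (rule log_mgf_process_trajectory[OF purifying_nonzero_part[OF assms(1) kr assms(4)] ergodic_nonzero_part[OF assms(1,5)]
          invariant_prob_nonzero_part[OF assms(1,6)] assms(9) cg _ _ assms(12)])
       (simp_all only: kernel assms(10,11))
  interpret N: log_mgf_process P history "\<lambda>n z. - g (chain n z)" \<gamma>sq by (rule L.log_mgf_process_uminus)
  have "L.S n z = birkhoff_sum g n z" "N.S n z = - birkhoff_sum g n z" for n z
    by (simp_all add: L.S_def N.S_def birkhoff_sum_def sum_negf)
  then show ?thesis using L.law_of_iterated_logarithm N.law_of_iterated_logarithm by simp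
qed

end
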